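(* Let $G$ be a compact group and $\alpha$ an automorphism of $G$ such that the pair $(G,\alpha)$ is topologically transitive and has finite depth. Then $(G,\alpha)$ has a composition series, and any two composition series for $(G,\alpha)$ are equivalent.
   Context: All groups are Hausdorff topological groups and automorphisms are automorphisms of topological groups. A subgroup $H$ is $\alpha$-stable if $\alpha(H)=H$. A pair $(K,\beta)$ with $K$ compact and $\beta\in\mathrm{Aut}(K)$ is topologically transitive if there is $x\in K$ whose orbit $\{\beta^n(x):n\in\mathbb{Z}\}$ is dense in $K$; a closed $\alpha$-stable subgroup $H$ is topologically transitive if $(H,\alpha|_H)$ is. $(G,\alpha)$ has finite depth if there is an open subgroup $V\le G$ with $\bigcap_{k\in\mathbb{Z}}\alpha^k(V)=\{1\}$. A subnormal series for $(G,\alpha)$ is a sequence $\{1\}=G_0\le G_1\le\cdots\le G_r=G$ of closed, $\alpha$-stable, topologically transitive subgroups such that for each $j$, $G_{j-1}$ is normal in $G_j$ and the induced automorphism $\alpha_j$ of $G_j/G_{j-1}$ is topologically transitive; the pairs $(G_j/G_{j-1},\alpha_j)$ are the subquotients. A pair $(K,\beta)$ with $K$ compact and infinite is irreducible if every proper, closed, normal, $\beta$-stable subgroup of $K$ is finite. A composition series is a subnormal series all of whose subquotients are irreducible. Two pairs $(G_1,\alpha_1)$, $(G_2,\alpha_2)$ are co-commensurable if there is a compact group $H$ with automorphism $\beta$ and surjective continuous homomorphisms $\varphi_i:H\to G_i$ with finite kernels and $\varphi_i\circ\beta=\alpha_i\circ\varphi_i$ ($i=1,2$). Two subnormal series $(G_j)_{j=0}^r$,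 $(H_j)_{j=0}^s$ are equivalent if $r=s$ and there is a permutation $\pi$ of $\{1,\dots,r\}$ such that $(G_j/G_{j-1},\alpha_j)$ is co-commensurable with $(H_{\pi(j)}/H_{\pi(j)-1},\alpha'_{\pi(j)})$ for each $j$ (with $\alpha'_i$ the induced automorphism on $H_i/H_{i-1}$). *)

theory Defs
  imports "HOL-Algebra.Coset" "HOL-Analysis.Analysis"
begin

definition topgroup :: "('a, 'm) monoid_scheme \<Rightarrow> 'a topology \<Rightarrow> bool" where
  "topgroup G T \<longleftrightarrow> group G \<and> topspace T = carrier G \<and> Hausdorff_space T \<and>
     continuous_map (prod_topology T T) T (\<lambda>(x, y). x \<otimes>\<^bsub>G\<^esub> y) \<and>
     continuous_map T T (\<lambda>x. inv\<^bsub>G\<^esub> x)"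

definition top_aut :: "('a, 'm) monoid_scheme \<Rightarrow> 'a topology \<Rightarrow> ('a \<Rightarrow> 'a) \<Rightarrow> bool" where
  "top_aut G T a \<longleftrightarrow> a \<in> iso G G \<and> homeomorphic_map T T a"

definition aut_inv :: "('a, 'm) monoid_scheme \<Rightarrow> ('a \<Rightarrow> 'a) \<Rightarrow> ('a \<Rightarrow> 'a)" where
  "aut_inv G a = inv_into (carrier G) a"

definition orbit :: "('a, 'm) monoid_scheme \<Rightarrow> ('a \<Rightarrow> 'a) \<Rightarrow> 'a \<Rightarrow> 'a set" where
  "orbit G a x = {(a ^^ n) x | n. True} \<union> {(aut_inv G a ^^ n) x | n. True}"

definition top_transitive :: "('a, 'm) monoid_scheme \<Rightarrow> 'a topology \<Rightarrow> ('a \<Rightarrow> 'a) \<Rightarrow> bool" where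
  "top_transitive G T a \<longleftrightarrow> (\<exists>x \<in> carrier G. T closure_of (orbit G a x) = carrier G)"

definition finite_depth :: "('a, 'm) monoid_scheme \<Rightarrow> 'a topology \<Rightarrow> ('a \<Rightarrow> 'a) \<Rightarrow> bool" where
  "finite_depth G T a \<longleftrightarrow> (\<exists>V. subgroup V G \<and> openin T V \<and>
     (\<Inter>n. (a ^^ n) ` V) \<inter> (\<Inter>n. (aut_inv G a ^^ n) ` V) = {\<one>\<^bsub>G\<^esub>})"

definition stable :: "('a \<Rightarrow> 'a) \<Rightarrow> 'a set \<Rightarrow> bool" where
  "stable a H \<longleftrightarrow> a ` H = H"

definition sub_top_transitive :: "('a, 'm) monoid_scheme \<Rightarrow> 'a topology \<Rightarrow> ('a \<Rightarrow> 'a) \<Rightarrow> 'a set \<Rightarrow> bool" where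
  "sub_top_transitive G T a H \<longleftrightarrow> top_transitive (G\<lparr>carrier := H\<rparr>) (subtopology T H) a"

text \<open>Quotient topology on the coset space \<open>H/N\<close> (H carrying the topology X): a set of
  cosets is open iff its union (= its preimage under the canonical projection) is open.\<close>
definition quot_top :: "('a, 'm) monoid_scheme \<Rightarrow> 'a topology \<Rightarrow> 'a set \<Rightarrow> 'a set topology" where
  "quot_top H X N = topology (\<lambda>U. U \<subseteq> carrier (H Mod N) \<and> openin X (\<Union>U))"

definition subquot :: "('a, 'm) monoid_scheme \<Rightarrow> 'a set \<Rightarrow> 'a set \<Rightarrow> 'a set monoid" where
  "subquot G Gj Gi = (G\<lparr>carrier := Gj\<rparr>) Mod Gi"

definition subquot_top :: "('a, 'm) monoid_scheme \<Rightarrow> 'a topology \<Rightarrow> 'a set \<Rightarrow> 'a set \<Rightarrow> 'a set topology" where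
  "subquot_top G T Gj Gi = quot_top (G\<lparr>carrier := Gj\<rparr>) (subtopology T Gj) Gi"

definition induced_aut :: "('a \<Rightarrow> 'a) \<Rightarrow> 'a set \<Rightarrow> 'a set" where
  "induced_aut a C = a ` C"

definition subnormal_series ::
  "('a, 'm) monoid_scheme \<Rightarrow> 'a topology \<Rightarrow> ('a \<Rightarrow> 'a) \<Rightarrow> (nat \<Rightarrow> 'a set) \<Rightarrow> nat \<Rightarrow> bool" where
  "subnormal_series G T a Gs r \<longleftrightarrow>
     Gs 0 = {\<one>\<^bsub>G\<^esub>} \<and> Gs r = carrier G \<and>
     (\<forall>j \<le> r. subgroup (Gs j) G \<and> closedin T (Gs j) \<and> stable a (Gs j) \<and>
               sub_top_transitive G T a (Gs j)) \<and>
     (\<forall>j \<in> {1..r}. Gs (j - 1) \<subseteq> Gs j \<and> Gs (j - 1) \<lhd> G\<lparr>carrier := Gs j\<rparr> \<and>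
               top_transitive (subquot G (Gs j) (Gs (j - 1)))
                              (subquot_top G T (Gs j) (Gs (j - 1))) (induced_aut a))"

definition irreducible_pair :: "('b, 'm) monoid_scheme \<Rightarrow> 'b topology \<Rightarrow> ('b \<Rightarrow> 'b) \<Rightarrow> bool" where
  "irreducible_pair K TK b \<longleftrightarrow> compact_space TK \<and> infinite (carrier K) \<and>
     (\<forall>N. N \<noteq> carrier K \<and> closedin TK N \<and> N \<lhd> K \<and> stable b N \<longrightarrow> finite N)"

definition composition_series ::
  "('a, 'm) monoid_scheme \<Rightarrow> 'a topology \<Rightarrow> ('a \<Rightarrow> 'a) \<Rightarrow> (nat \<Rightarrow> 'a set) \<Rightarrow> nat \<Rightarrow> bool" where
  "composition_series G T a Gs r \<longleftrightarrow> subnormal_series G T a Gs r \<and>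
     (\<forall>j \<in> {1..r}. irreducible_pair (subquot G (Gs j) (Gs (j - 1)))
                       (subquot_top G T (Gs j) (Gs (j - 1))) (induced_aut a))"

text \<open>Co-commensurability. The witness compact group H is taken on the type \<open>'b \<times> 'c\<close>;
  this loses no generality, since any witness can be replaced by its image in
  \<open>G1 \<times> G2\<close> under \<open>(\<phi>1, \<phi>2)\<close>.\<close>
definition co_commensurable ::
  "('b, 'm) monoid_scheme \<Rightarrow> 'b topology \<Rightarrow> ('b \<Rightarrow> 'b) \<Rightarrow>
   ('c, 'n) monoid_scheme \<Rightarrow> 'c topology \<Rightarrow> ('c \<Rightarrow> 'c) \<Rightarrow> bool" where
  "co_commensurable G1 T1 a1 G2 T2 a2 \<longleftrightarrow>
     (\<exists>(H :: ('b \<times> 'c) monoid) TH b f1 f2.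
        topgroup H TH \<and> compact_space TH \<and> top_aut H TH b \<and>
        f1 \<in> hom H G1 \<and> continuous_map TH T1 f1 \<and> f1 ` carrier H = carrier G1 \<and>
        finite (kernel H G1 f1) \<and> (\<forall>x \<in> carrier H. f1 (b x) = a1 (f1 x)) \<and>
        f2 \<in> hom H G2 \<and> continuous_map TH T2 f2 \<and> f2 ` carrier H = carrier G2 \<and>
        finite (kernel H G2 f2) \<and> (\<forall>x \<in> carrier H. f2 (b x) = a2 (f2 x)))"

definition equivalent_series ::
  "('a, 'm) monoid_scheme \<Rightarrow> 'a topology \<Rightarrow> ('a \<Rightarrow> 'a) \<Rightarrow>
   (nat \<Rightarrow> 'a set) \<Rightarrow> nat \<Rightarrow> (nat \<Rightarrow> 'a set) \<Rightarrow> nat \<Rightarrow> bool" where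
  "equivalent_series G T a Gs r Hs s \<longleftrightarrow> r = s \<and>
     (\<exists>\<pi>. bij_betw \<pi> {1..r} {1..r} \<and>
        (\<forall>j \<in> {1..r}.
           co_commensurable
             (subquot G (Gs j) (Gs (j - 1))) (subquot_top G T (Gs j) (Gs (j - 1))) (induced_aut a)
             (subquot G (Hs (\<pi> j)) (Hs (\<pi> j - 1))) (subquot_top G T (Hs (\<pi> j)) (Hs (\<pi> j - 1)))
             (induced_aut a)))"

end

theory Submission
  imports Defs "HOL-Library.Multiset" "HOL-Combinatorics.Permutations"
begin

text \<open>
  Replacing the given open subgroup by its normal core \<open>N\<close>, an element \<open>x\<close> is determined by the
  sequence of cosets of \<open>\<alpha>\<^sup>k(x)\<close> modulo \<open>N\<close>, so \<open>G\<close> is a group shift over the finite alphabet \<open>G/N\<close>,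
  and so is every closed stable subgroup \<open>D\<close>. For such \<open>D\<close> two things are needed.

  First, let \<open>E(D)\<close> be the set of symbols that occur at time 0 in elements of \<open>D\<close> which are trivial at all
  negative times. By compactness, finitely many negative times suffice to define \<open>E(D)\<close>, which makes \<open>D\<close> a shift
  of finite type; the same argument shows that \<open>K \<le> H\<close> and \<open>E(K) = E(H)\<close> force \<open>K\<close> to have finite
  index in \<open>H\<close>, hence \<open>K = H\<close> if \<open>H\<close> is topologically transitive. So \<open>|E|\<close> is strictly monotone on
  topologically transitive subgroups, and chains of these have bounded length.

  Second, the closure of the group of homoclinic points of \<open>D\<close> is topologically transitive, has
  finite index in \<open>D\<close>, and is normalised by whatever normalises \<open>D\<close>.

  Existence follows by taking a proper normal transitive subgroup with \<open>|E|\<close> maximal. Uniqueness is the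
  inductive Jordan-Hoelder argument: two different maximal terms \<open>K\<close>, \<open>L\<close> of \<open>H\<close> satisfy \<open>KL = H\<close>,
  and \<open>K \<inter> L\<close> is replaced by the transitive subgroup of finite index inside it.
\<close>

section \<open>Quotients and products of topological groups\<close>

text \<open>Irreducibility and co-commensurability hold only up to finite groups, whereas the
  classical argument compares subgroups exactly, and \<open>K \<inter> L\<close> need not be
  transitive. Transitivity removes the slack: let \<open>H\<close> be transitive and
  \<open>K \<inter> H\<close> of finite index in \<open>H\<close>. If a point of \<open>H\<close>
  with dense orbit lay outside \<open>K\<close>, its orbit would stay in the finitely many cosets of
  \<open>K\<close> that meet \<open>H - K\<close>; their union is closed and misses the identity, so
  it cannot contain \<open>H\<close>. Hence containment up to finite index between such subgroups is
  true containment, and a subgroup may be traded for its \<open>nub\<close> at the cost of a finite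
  index. Homoclinic points give transitivity because two of them, shifted far apart, multiply
  without disturbing each other; a Baire argument then produces a dense orbit. All of this takes
  place inside \<open>G\<close>, with pairs of subgroups in the role of quotients, so that no group
  of cosets has to be formed in the inductions. Both inductions, for existence and for uniqueness,
  run on the size of E.\<close>

lemma continuous_map_fst': "continuous_map Z (prod_topology X Y) f \<Longrightarrow> continuous_map Z X (\<lambda>z. fst (f z))"
  using continuous_map_compose [OF _ continuous_map_fst] by (simp add: o_def)

lemma continuous_map_snd': "continuous_map Z (prod_topology X Y) f \<Longrightarrow> continuous_map Z Y (\<lambda>z. snd (f z))"
  using continuous_map_compose [OF _ continuous_map_snd] by (simp add: o_def)

lemma carrier_restrict: "carrier (G\<lparr>carrier := H\<rparr>) = H"
  by simp

lemma topgroup_topspace: "topgroup G T \<Longrightarrow> topspace T = carrier G"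
  and topgroup_Hausdorff: "topgroup G T \<Longrightarrow> Hausdorff_space T"
  by (simp_all add: topgroup_def)

lemma topgroup_subgroup:
  assumes G: "topgroup G T" and H: "subgroup H G"
  shows "topgroup (G\<lparr>carrier := H\<rparr>) (subtopology T H)"
proof -
  have g: "group G" and top: "topspace T = carrier G" and haus: "Hausdorff_space T"
    and mult: "continuous_map (prod_topology T T) T (\<lambda>(x, y). x \<otimes>\<^bsub>G\<^esub> y)"
    and inv: "continuous_map T T (\<lambda>x. inv\<^bsub>G\<^esub> x)"
    using G by (auto simp: topgroup_def)
  have HG: "H \<subseteq> carrier G" by (rule subgroup.subset [OF H])
  have eq: "prod_topology (subtopology T H) (subtopology T H) = subtopology (prod_topology T T) (H \<times> H)"
    by (simp add: subtopology_Times)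
  show ?thesis
    unfolding topgroup_def
  proof (intro conjI)
    show "group (G\<lparr>carrier := H\<rparr>)" by (rule subgroup.subgroup_is_group [OF H g])
    show "topspace (subtopology T H) = carrier (G\<lparr>carrier := H\<rparr>)" using top HG by auto
    show "Hausdorff_space (subtopology T H)" by (rule Hausdorff_space_subtopology [OF haus])
    show "continuous_map (prod_topology (subtopology T H) (subtopology T H)) (subtopology T H)
       (\<lambda>(x, y). x \<otimes>\<^bsub>G\<lparr>carrier := H\<rparr>\<^esub> y)"
      unfolding eq
      using continuous_map_from_subtopology [OF mult, of "H \<times> H"] subgroup.m_closed [OF H]
      by (auto simp: continuous_map_in_subtopology)
    have "continuous_map (subtopology T H) (subtopology T H) (\<lambda>x. inv\<^bsub>G\<^esub> x)"
      using continuous_map_from_subtopology [OF inv, of H] subgroup.m_inv_closed [OF H]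
      by (auto simp: continuous_map_in_subtopology)
    then show "continuous_map (subtopology T H) (subtopology T H) (\<lambda>x. inv\<^bsub>G\<lparr>carrier := H\<rparr>\<^esub> x)"
      by (rule continuous_map_eq) (simp add: group.m_inv_consistent [OF g H])
  qed
qed

lemma topgroup_DirProd:
  assumes "topgroup G T" "topgroup G' T'"
  shows "topgroup (G \<times>\<times> G') (prod_topology T T')"
proof -
  have g: "group G" "topspace T = carrier G" "Hausdorff_space T"
    and mult: "continuous_map (prod_topology T T) T (\<lambda>(x, y). x \<otimes>\<^bsub>G\<^esub> y)"
    and inv: "continuous_map T T (\<lambda>x. inv\<^bsub>G\<^esub> x)"
    using assms(1) by (auto simp: topgroup_def)
  have g': "group G'" "topspace T' = carrier G'" "Hausdorff_space T'"
    and mult': "continuous_map (prod_topology T' T') T' (\<lambda>(x, y). x \<otimes>\<^bsub>G'\<^esub> y)"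
    and inv': "continuous_map T' T' (\<lambda>x. inv\<^bsub>G'\<^esub> x)"
    using assms(2) by (auto simp: topgroup_def)
  let ?P = "prod_topology T T'"
  show ?thesis
    unfolding topgroup_def
  proof (intro conjI)
    show "group (G \<times>\<times> G')" by (rule DirProd_group [OF g(1) g'(1)])
    show "topspace ?P = carrier (G \<times>\<times> G')" using g g' by simp
    show "Hausdorff_space ?P" using g g' by (simp add: Hausdorff_space_prod_topology)
    have 1: "continuous_map (prod_topology ?P ?P) (prod_topology T T) (\<lambda>z. (fst (fst z), fst (snd z)))"
      and 2: "continuous_map (prod_topology ?P ?P) (prod_topology T' T') (\<lambda>z. (snd (fst z), snd (snd z)))"
      by (intro continuous_map_pairedI continuous_map_fst' [OF continuous_map_fst]
          continuous_map_snd' [OF continuous_map_snd] continuous_map_fst' [OF continuous_map_snd]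
          continuous_map_snd' [OF continuous_map_fst])+
    have "continuous_map (prod_topology ?P ?P) ?P
        (\<lambda>z. (fst (fst z) \<otimes>\<^bsub>G\<^esub> fst (snd z), snd (fst z) \<otimes>\<^bsub>G'\<^esub> snd (snd z)))"
      using continuous_map_compose [OF 1 mult] continuous_map_compose [OF 2 mult']
      by (intro continuous_map_pairedI) (simp_all add: o_def)
    then show "continuous_map (prod_topology ?P ?P) ?P (\<lambda>(x, y). x \<otimes>\<^bsub>G \<times>\<times> G'\<^esub> y)"
      by (rule continuous_map_eq) (auto simp: mult_DirProd')
    have "continuous_map ?P ?P (\<lambda>z. (inv\<^bsub>G\<^esub> (fst z), inv\<^bsub>G'\<^esub> (snd z)))"
      using continuous_map_compose [OF continuous_map_fst inv] continuous_map_compose [OF continuous_map_snd inv']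
      by (intro continuous_map_pairedI) (simp_all add: o_def)
    then show "continuous_map ?P ?P (\<lambda>x. inv\<^bsub>G \<times>\<times> G'\<^esub> x)"
      by (rule continuous_map_eq) (use g g' in \<open>auto simp: inv_DirProd\<close>)
  qed
qed

text \<open>Instantiated later with \<open>X\<close> a closed stable subgroup of \<open>G\<close>
  under the subspace topology, so that \<open>X Mod K\<close> with \<open>quot_top\<close> is a
  subquotient.\<close>

locale topgroup_quotient = normal K X for K and X (structure) +
  fixes TX
  assumes topX: "topgroup X TX"
begin

abbreviation proj where "proj x \<equiv> K #> x"

lemma topspace_X: "topspace TX = carrier X"
  using topX by (simp add: topgroup_def)

lemma continuous_mult_X:
  assumes "continuous_map Z TX f" "continuous_map Z TX g"
  shows "continuous_map Z TX (\<lambda>x. f x \<otimes> g x)"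
proof -
  have 1: "continuous_map (prod_topology TX TX) TX (\<lambda>(x, y). x \<otimes> y)"
    using topX by (simp add: topgroup_def)
  have 2: "continuous_map Z (prod_topology TX TX) (\<lambda>x. (f x, g x))"
    using assms by (simp add: continuous_map_pairedI)
  show ?thesis
    using continuous_map_compose [OF 2 1] by (simp add: o_def)
qed

lemma proj_eq_iff: "x \<in> carrier X \<Longrightarrow> y \<in> carrier X \<Longrightarrow> proj x = proj y \<longleftrightarrow> x \<otimes> inv y \<in> K"
  by (metis is_group rcos_module rcos_self repr_independence subgroup_axioms)

lemma proj_eq_of_mem: "x \<in> carrier X \<Longrightarrow> y \<in> proj x \<Longrightarrow> proj y = proj x"
  using repr_independence subgroup_axioms by metis

lemma proj_subset: "x \<in> carrier X \<Longrightarrow> proj x \<subseteq> carrier X"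
  by (simp add: r_coset_subset_G subset)

lemma proj_self: "x \<in> carrier X \<Longrightarrow> x \<in> proj x"
  by (rule rcos_self [OF _ subgroup_axioms])

lemma carrier_Mod: "carrier (X Mod K) = proj ` carrier X"
  by (simp add: carrier_FactGroup)

lemma mult_proj: "x \<in> carrier X \<Longrightarrow> y \<in> carrier X \<Longrightarrow> proj x \<otimes>\<^bsub>X Mod K\<^esub> proj y = proj (x \<otimes> y)"
  by (simp add: rcos_sum)

lemma Union_eq_preimage:
  assumes U: "U \<subseteq> carrier (X Mod K)" shows "\<Union>U = {x \<in> carrier X. proj x \<in> U}"
proof
  show "\<Union>U \<subseteq> {x \<in> carrier X. proj x \<in> U}"
  proof clarify
    fix y C assume "y \<in> C" "C \<in> U"
    then obtain x where x: "x \<in> carrier X" "C = proj x" using U unfolding carrier_Mod by blast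
    then show "y \<in> carrier X \<and> proj y \<in> U"
      using proj_eq_of_mem [OF x(1)] proj_subset [OF x(1)] \<open>y \<in> C\<close> \<open>C \<in> U\<close> by auto
  qed
  show "{x \<in> carrier X. proj x \<in> U} \<subseteq> \<Union>U" using proj_self by auto
qed

text \<open>\<open>quot_top\<close> is \<open>topology\<close> applied to a predicate and says
  nothing until the predicate is known to describe a topology. Intersections are the delicate case:
  because cosets are disjoint, a set of cosets is recovered from its union as a preimage under
  \<open>proj\<close>.\<close>

lemma openin_quot_top:
  "openin (quot_top X TX K) U \<longleftrightarrow> U \<subseteq> carrier (X Mod K) \<and> openin TX {x \<in> carrier X. proj x \<in> U}"
proof -
  let ?o = "\<lambda>U. U \<subseteq> carrier (X Mod K) \<and> openin TX (\<Union>U)"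
  have "istopology ?o"
    unfolding istopology_def
  proof (rule conjI; clarify)
    fix S S' assume S: "S \<subseteq> carrier (X Mod K)" "openin TX (\<Union>S)" "S' \<subseteq> carrier (X Mod K)" "openin TX (\<Union>S')"
    have "\<Union>(S \<inter> S') = {x \<in> carrier X. proj x \<in> S \<inter> S'}"
      using S by (intro Union_eq_preimage) auto
    also have "\<dots> = \<Union>S \<inter> \<Union>S'" unfolding Union_eq_preimage [OF S(1)] Union_eq_preimage [OF S(3)] by auto
    finally show "S \<inter> S' \<subseteq> carrier (X Mod K) \<and> openin TX (\<Union>(S \<inter> S'))" using S by auto
  next
    fix F assume F: "\<forall>S\<in>F. S \<subseteq> carrier (X Mod K) \<and> openin TX (\<Union>S)"
    have "\<Union>(\<Union>F) = \<Union>(Union ` F)" by auto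
    moreover have "openin TX (\<Union>(Union ` F))" using F by (intro openin_Union) auto
    ultimately show "\<Union>F \<subseteq> carrier (X Mod K) \<and> openin TX (\<Union>(\<Union>F))" using F by auto
  qed
  then have "openin (quot_top X TX K) U \<longleftrightarrow> ?o U"
    unfolding quot_top_def by (simp add: topology_inverse')
  then show ?thesis using Union_eq_preimage by auto
qed

lemma topspace_quot_top: "topspace (quot_top X TX K) = carrier (X Mod K)"
proof -
  have "{x \<in> carrier X. proj x \<in> carrier (X Mod K)} = topspace TX"
    unfolding carrier_Mod topspace_X by auto
  then have "openin (quot_top X TX K) (carrier (X Mod K))"
    unfolding openin_quot_top by simp
  moreover have "U \<subseteq> carrier (X Mod K)" if "openin (quot_top X TX K) U" for U
    using that openin_quot_top by blast
  ultimately show ?thesis unfolding topspace_def by blast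
qed

lemma quotient_map_proj: "quotient_map TX (quot_top X TX K) proj"
  unfolding quotient_map_def topspace_X topspace_quot_top carrier_Mod
  using openin_quot_top unfolding carrier_Mod by auto

lemma continuous_proj: "continuous_map TX (quot_top X TX K) proj"
  by (rule quotient_imp_continuous_map [OF quotient_map_proj])

lemma closedin_quot_top:
  "closedin (quot_top X TX K) U \<longleftrightarrow> U \<subseteq> carrier (X Mod K) \<and> closedin TX {x \<in> carrier X. proj x \<in> U}"
proof -
  have "closedin (quot_top X TX K) U \<Longrightarrow> U \<subseteq> carrier (X Mod K)"
    using closedin_subset [of "quot_top X TX K" U] topspace_quot_top by simp
  then show ?thesis
    using quotient_map_proj unfolding quotient_map_closedin topspace_X topspace_quot_top by blast
qed

text \<open>The saturation of \<open>V\<close> is a union of translates of \<open>V\<close> by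
  elements of \<open>K\<close>, and translations are continuous.\<close>

lemma openin_proj_image:
  assumes V: "openin TX V" shows "openin (quot_top X TX K) (proj ` V)"
  unfolding openin_quot_top
proof
  have VX: "V \<subseteq> carrier X" using openin_subset [OF V] topspace_X by simp
  then show "proj ` V \<subseteq> carrier (X Mod K)" unfolding carrier_Mod by auto
  have "{x \<in> carrier X. proj x \<in> proj ` V} = (\<Union>k\<in>K. {x \<in> carrier X. k \<otimes> x \<in> V})"
  proof
    show "{x \<in> carrier X. proj x \<in> proj ` V} \<subseteq> (\<Union>k\<in>K. {x \<in> carrier X. k \<otimes> x \<in> V})"
    proof
      fix x assume "x \<in> {x \<in> carrier X. proj x \<in> proj ` V}"
      then obtain v where x: "x \<in> carrier X" "v \<in> V" "proj x = proj v" by auto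
      then have "v \<in> proj x" using VX proj_self by auto
      then obtain k where "k \<in> K" "v = k \<otimes> x" by (auto simp: r_coset_def)
      then show "x \<in> (\<Union>k\<in>K. {x \<in> carrier X. k \<otimes> x \<in> V})" using x by auto
    qed
    show "(\<Union>k\<in>K. {x \<in> carrier X. k \<otimes> x \<in> V}) \<subseteq> {x \<in> carrier X. proj x \<in> proj ` V}"
    proof
      fix x assume "x \<in> (\<Union>k\<in>K. {x \<in> carrier X. k \<otimes> x \<in> V})"
      then obtain k where x: "k \<in> K" "x \<in> carrier X" "k \<otimes> x \<in> V" by auto
      then have "k \<otimes> x \<in> proj x" by (auto simp: r_coset_def)
      then have "proj (k \<otimes> x) = proj x" by (rule proj_eq_of_mem [OF x(2)])
      then show "x \<in> {x \<in> carrier X. proj x \<in> proj ` V}" using x by (metis (mono_tags) imageI mem_Collect_eq)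
    qed
  qed
  moreover have "openin TX {x \<in> carrier X. k \<otimes> x \<in> V}" if k: "k \<in> K" for k
  proof -
    have "continuous_map TX TX (\<lambda>x. k \<otimes> x)"
      using mem_carrier [OF k] topspace_X by (intro continuous_mult_X) auto
    then show ?thesis using openin_continuous_map_preimage [OF _ V] topspace_X by fastforce
  qed
  then have "openin TX (\<Union>k\<in>K. {x \<in> carrier X. k \<otimes> x \<in> V})" by (intro openin_Union) auto
  ultimately show "openin TX {x \<in> carrier X. proj x \<in> proj ` V}" by simp
qed

text \<open>Two cosets \<open>proj x\<close> and \<open>proj y\<close> differ exactly when
  \<open>x \<otimes> inv y\<close> avoids the closed set \<open>K\<close>. An open box around
  \<open>(x, y)\<close> on which this persists has disjoint images, and these are open because
  \<open>proj\<close> is an open map.\<close>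

lemma Hausdorff_quot_top:
  assumes K: "closedin TX K" shows "Hausdorff_space (quot_top X TX K)"
  unfolding Hausdorff_space_def topspace_quot_top
proof (intro allI impI)
  fix C D assume CD: "C \<in> carrier (X Mod K) \<and> D \<in> carrier (X Mod K) \<and> C \<noteq> D"
  then obtain x y where x: "x \<in> carrier X" "C = proj x" and y: "y \<in> carrier X" "D = proj y"
    unfolding carrier_Mod by blast
  let ?P = "prod_topology TX TX"
  have cont: "continuous_map ?P TX (\<lambda>z. fst z \<otimes> inv (snd z))"
  proof (rule continuous_mult_X [OF continuous_map_fst])
    have "continuous_map TX TX (\<lambda>x. inv x)" using topX by (simp add: topgroup_def)
    then show "continuous_map ?P TX (\<lambda>z. inv (snd z))"
      using continuous_map_compose [OF continuous_map_snd] by (simp add: o_def)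
  qed
  have "openin TX (carrier X - K)" using K topspace_X openin_diff openin_topspace by metis
  then have "openin ?P {z \<in> topspace ?P. fst z \<otimes> inv (snd z) \<in> carrier X - K}"
    by (rule openin_continuous_map_preimage [OF cont])
  moreover have "(x, y) \<in> {z \<in> topspace ?P. fst z \<otimes> inv (snd z) \<in> carrier X - K}"
    using x y CD proj_eq_iff topspace_X by auto
  ultimately obtain U V where UV: "openin TX U" "openin TX V" "x \<in> U" "y \<in> V"
    "U \<times> V \<subseteq> {z \<in> topspace ?P. fst z \<otimes> inv (snd z) \<in> carrier X - K}"
    unfolding openin_prod_topology_alt by meson
  have "disjnt (proj ` U) (proj ` V)"
    unfolding disjnt_def
  proof (rule equals0I)
    fix E assume "E \<in> proj ` U \<inter> proj ` V"
    then obtain u v where uv: "u \<in> U" "v \<in> V" "proj u = proj v" by auto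
    then have "(u, v) \<in> {z \<in> topspace ?P. fst z \<otimes> inv (snd z) \<in> carrier X - K}" using UV by blast
    then show False using uv(3) proj_eq_iff topspace_X by auto
  qed
  then show "\<exists>U V. openin (quot_top X TX K) U \<and> openin (quot_top X TX K) V \<and> C \<in> U \<and> D \<in> V \<and> disjnt U V"
    using openin_proj_image UV x y by blast
qed

text \<open>A product of two quotient maps need not be a quotient map, so multiplication is checked
  on boxes, whose images are open by \<open>openin_proj_image\<close>. Inversion has a single
  argument and factors through the quotient map directly.\<close>

lemma topgroup_quot:
  assumes K: "closedin TX K" shows "topgroup (X Mod K) (quot_top X TX K)"
  unfolding topgroup_def
proof (intro conjI topspace_quot_top Hausdorff_quot_top [OF K] factorgroup_is_group)
  let ?Q = "quot_top X TX K"
  show "continuous_map (prod_topology ?Q ?Q) ?Q (\<lambda>(x, y). x \<otimes>\<^bsub>X Mod K\<^esub> y)"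
    unfolding continuous_map_def
  proof (intro conjI allI impI)
    show "(\<lambda>(x, y). x \<otimes>\<^bsub>X Mod K\<^esub> y) \<in> topspace (prod_topology ?Q ?Q) \<rightarrow> topspace ?Q"
      using monoid.m_closed [OF group.is_monoid [OF factorgroup_is_group]]
      by (auto simp: topspace_quot_top simp del: mult_FactGroup)
    fix W assume W: "openin ?Q W"
    show "openin (prod_topology ?Q ?Q) {z \<in> topspace (prod_topology ?Q ?Q). (case z of (x, y) \<Rightarrow> x \<otimes>\<^bsub>X Mod K\<^esub> y) \<in> W}"
      unfolding openin_prod_topology_alt
    proof (intro allI impI)
      fix C D assume "(C, D) \<in> {z \<in> topspace (prod_topology ?Q ?Q). (case z of (x, y) \<Rightarrow> x \<otimes>\<^bsub>X Mod K\<^esub> y) \<in> W}"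
      then obtain x y where x: "x \<in> carrier X" "C = proj x" and y: "y \<in> carrier X" "D = proj y"
        and W': "C \<otimes>\<^bsub>X Mod K\<^esub> D \<in> W"
        by (auto simp: topspace_quot_top carrier_Mod simp del: mult_FactGroup)
      let ?P = "prod_topology TX TX"
      let ?V = "{x \<in> carrier X. proj x \<in> W}"
      have cont: "continuous_map ?P TX (\<lambda>z. fst z \<otimes> snd z)"
        by (intro continuous_mult_X continuous_map_fst continuous_map_snd)
      have "openin TX ?V" using W openin_quot_top by blast
      then have "openin ?P {z \<in> topspace ?P. fst z \<otimes> snd z \<in> ?V}"
        by (rule openin_continuous_map_preimage [OF cont])
      moreover have "(x, y) \<in> {z \<in> topspace ?P. fst z \<otimes> snd z \<in> ?V}"
        using W' x y by (simp add: mult_proj topspace_X del: mult_FactGroup)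
      ultimately obtain U V where UV: "openin TX U" "openin TX V" "x \<in> U" "y \<in> V"
        "U \<times> V \<subseteq> {z \<in> topspace ?P. fst z \<otimes> snd z \<in> ?V}"
        unfolding openin_prod_topology_alt by meson
      have "proj ` U \<times> proj ` V \<subseteq> {z \<in> topspace (prod_topology ?Q ?Q). (case z of (x, y) \<Rightarrow> x \<otimes>\<^bsub>X Mod K\<^esub> y) \<in> W}"
      proof
        fix z assume "z \<in> proj ` U \<times> proj ` V"
        then obtain u v where uv: "z = (proj u, proj v)" "u \<in> U" "v \<in> V" by auto
        then have "(u, v) \<in> {z \<in> topspace ?P. fst z \<otimes> snd z \<in> ?V}" using UV by blast
        then show "z \<in> {z \<in> topspace (prod_topology ?Q ?Q). (case z of (x, y) \<Rightarrow> x \<otimes>\<^bsub>X Mod K\<^esub> y) \<in> W}"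
          by (simp add: uv(1) mult_proj topspace_X topspace_quot_top carrier_Mod del: mult_FactGroup)
      qed
      then show "\<exists>U V. openin ?Q U \<and> openin ?Q V \<and> C \<in> U \<and> D \<in> V \<and>
          U \<times> V \<subseteq> {z \<in> topspace (prod_topology ?Q ?Q). (case z of (x, y) \<Rightarrow> x \<otimes>\<^bsub>X Mod K\<^esub> y) \<in> W}"
        using openin_proj_image UV x y by (intro exI [of _ "proj ` U"] exI [of _ "proj ` V"]) auto
    qed
  qed
  have inv: "continuous_map TX TX (\<lambda>x. inv x)" using topX by (simp add: topgroup_def)
  have "continuous_map TX ?Q (\<lambda>x. proj (inv x))"
    using continuous_map_compose [OF inv continuous_proj] by (simp add: o_def)
  then have "continuous_map TX ?Q ((\<lambda>C. inv\<^bsub>X Mod K\<^esub> C) \<circ> proj)"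
    by (rule continuous_map_eq) (use inv_FactGroup in \<open>auto simp: topspace_X carrier_Mod rcos_inv\<close>)
  then show "continuous_map ?Q ?Q (\<lambda>C. inv\<^bsub>X Mod K\<^esub> C)"
    by (rule continuous_compose_quotient_map [OF quotient_map_proj])
qed

lemma compact_quot_top: "compact_space TX \<Longrightarrow> compact_space (quot_top X TX K)"
  using image_compactin [OF _ continuous_proj, of "carrier X"]
  unfolding compact_space_def topspace_quot_top carrier_Mod topspace_X by blast

end

section \<open>Automorphisms of compact groups\<close>

text \<open>A single integer exponent for both halves of \<open>orbit\<close>, so that shifts in
  time add up.\<close>

definition apow :: "('a, 'm) monoid_scheme \<Rightarrow> ('a \<Rightarrow> 'a) \<Rightarrow> int \<Rightarrow> 'a \<Rightarrow> 'a" where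
  "apow G a k x = (if 0 \<le> k then (a ^^ nat k) x else (aut_inv G a ^^ nat (- k)) x)"

lemma orbit_conv_apow: "orbit G a x = range (\<lambda>k. apow G a k x)"
proof
  show "orbit G a x \<subseteq> range (\<lambda>k. apow G a k x)"
  proof
    fix y assume "y \<in> orbit G a x"
    then consider n where "y = (a ^^ n) x" | n where "y = (aut_inv G a ^^ n) x"
      by (auto simp: orbit_def)
    then show "y \<in> range (\<lambda>k. apow G a k x)"
    proof cases
      case 1
      then have "y = apow G a (int n) x" by (simp add: apow_def)
      then show ?thesis by blast
    next
      case 2
      then have "y = apow G a (- int n) x" by (cases n) (simp_all add: apow_def nat_add_distrib)
      then show ?thesis by blast
    qed
  qed
qed (auto simp: orbit_def apow_def)

locale compact_group_aut = group G for G (structure) +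
  fixes T :: "'a topology" and a :: "'a \<Rightarrow> 'a"
  assumes topgroup: "topgroup G T" and compact: "compact_space T" and top_aut: "top_aut G T a"
begin

text \<open>Together with \<open>m_assoc\<close> and \<open>inv_mult_group\<close> these rules
  cancel neighbouring inverse factors in right-nested products, which settles most of the word
  identities below.\<close>

lemma inv_cancel [simp]:
  assumes "x \<in> carrier G" "y \<in> carrier G"
  shows "x \<otimes> (inv x \<otimes> y) = y" "inv x \<otimes> (x \<otimes> y) = y"
  using assms by (simp_all add: m_assoc [symmetric])

abbreviation A :: "int \<Rightarrow> 'a \<Rightarrow> 'a" where "A \<equiv> apow G a"

lemma topspace [simp]: "topspace T = carrier G"
  using topgroup by (simp add: topgroup_def)

lemma Hausdorff: "Hausdorff_space T"
  using topgroup by (simp add: topgroup_def)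

lemma continuous_mult:
  assumes "continuous_map X T f" "continuous_map X T g"
  shows "continuous_map X T (\<lambda>x. f x \<otimes> g x)"
proof -
  have 1: "continuous_map (prod_topology T T) T (\<lambda>(x, y). x \<otimes> y)"
    using topgroup by (simp add: topgroup_def)
  have 2: "continuous_map X (prod_topology T T) (\<lambda>x. (f x, g x))"
    using assms by (simp add: continuous_map_pairedI)
  show ?thesis
    using continuous_map_compose [OF 2 1] by (simp add: o_def)
qed

lemma continuous_inv:
  assumes "continuous_map X T f"
  shows "continuous_map X T (\<lambda>x. inv (f x))"
proof -
  have "continuous_map T T (\<lambda>x. inv x)"
    using topgroup by (simp add: topgroup_def)
  then show ?thesis
    using continuous_map_compose [OF assms] by (simp add: o_def)
qed

lemma bij_a: "bij_betw a (carrier G) (carrier G)"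
  using top_aut by (simp add: top_aut_def iso_def)

lemma aut_inv_closed: "x \<in> carrier G \<Longrightarrow> aut_inv G a x \<in> carrier G"
  using bij_a by (metis aut_inv_def bij_betw_def inv_into_into)

lemma a_closed: "x \<in> carrier G \<Longrightarrow> a x \<in> carrier G"
  using bij_a by (auto simp: bij_betw_def)

lemma a_aut_inv: "x \<in> carrier G \<Longrightarrow> a (aut_inv G a x) = x"
  using bij_a by (metis aut_inv_def bij_betw_def f_inv_into_f)

lemma aut_inv_a: "x \<in> carrier G \<Longrightarrow> aut_inv G a (a x) = x"
  using bij_a by (simp add: aut_inv_def bij_betw_def)

lemma apow_0 [simp]: "A 0 x = x"
  by (simp add: apow_def)

lemma funpow_aut_inv_closed: "x \<in> carrier G \<Longrightarrow> (aut_inv G a ^^ n) x \<in> carrier G"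
  by (induction n) (auto simp: aut_inv_closed)

lemma apow_closed [simp, intro]: "x \<in> carrier G \<Longrightarrow> A k x \<in> carrier G"
proof -
  assume "x \<in> carrier G"
  moreover from this have "(a ^^ n) x \<in> carrier G" for n
    by (induction n) (auto simp: a_closed)
  ultimately show ?thesis by (auto simp: apow_def funpow_aut_inv_closed)
qed

lemma apow_succ: "x \<in> carrier G \<Longrightarrow> A (k + 1) x = a (A k x)"
proof -
  assume x: "x \<in> carrier G"
  consider "k \<ge> 0" | "k < 0" by linarith
  then show ?thesis
  proof cases
    case 1
    then have "nat (k + 1) = Suc (nat k)" by simp
    then show ?thesis using 1 by (simp add: apow_def)
  next
    case 2
    then have "nat (- k) = Suc (nat (- (k + 1)))" by simp
    then have "a (A k x) = (aut_inv G a ^^ nat (- (k + 1))) x"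
      using 2 x by (simp add: apow_def a_aut_inv funpow_aut_inv_closed)
    also have "\<dots> = A (k + 1) x"
      using 2 by (auto simp: apow_def)
    finally show ?thesis by simp
  qed
qed

lemma apow_1: "x \<in> carrier G \<Longrightarrow> A 1 x = a x"
  using apow_succ [of x 0] by simp

lemma apow_pred: "x \<in> carrier G \<Longrightarrow> A (k - 1) x = aut_inv G a (A k x)"
  using apow_succ [of x "k - 1"] by (simp add: aut_inv_a)

lemma apow_add: "x \<in> carrier G \<Longrightarrow> A j (A k x) = A (j + k) x"
proof (induction j rule: int_induct [where k = 0])
  case (step1 i)
  then show ?case
    using apow_succ [of "A k x" i] apow_succ [of x "i + k"] by (simp add: algebra_simps)
next
  case (step2 i)
  then show ?case
    using apow_pred [of "A k x" i] apow_pred [of x "i + k"] by (simp add: algebra_simps)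
qed simp

lemma a_mult: "x \<in> carrier G \<Longrightarrow> y \<in> carrier G \<Longrightarrow> a (x \<otimes> y) = a x \<otimes> a y"
  using top_aut by (simp add: top_aut_def iso_def hom_def)

lemma aut_inv_mult:
  "x \<in> carrier G \<Longrightarrow> y \<in> carrier G \<Longrightarrow> aut_inv G a (x \<otimes> y) = aut_inv G a x \<otimes> aut_inv G a y"
  by (metis a_aut_inv a_mult aut_inv_a aut_inv_closed m_closed)

lemma apow_mult [simp]: "x \<in> carrier G \<Longrightarrow> y \<in> carrier G \<Longrightarrow> A k (x \<otimes> y) = A k x \<otimes> A k y"
proof (induction k rule: int_induct [where k = 0])
  case (step1 i)
  then show ?case by (simp add: apow_succ a_mult)
next
  case (step2 i)
  then show ?case by (simp add: apow_pred aut_inv_mult)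
qed simp

lemma apow_hom: "A k \<in> hom G G"
  by (simp add: hom_def)

lemma apow_one [simp]: "A k \<one> = \<one>"
  using apow_hom hom_one is_group by blast

lemma apow_inv [simp]: "x \<in> carrier G \<Longrightarrow> A k (inv x) = inv (A k x)"
  by (metis apow_closed apow_mult apow_one inv_closed inv_equality l_inv)

lemma continuous_a: "continuous_map T T a"
  using top_aut by (simp add: top_aut_def homeomorphic_imp_continuous_map)

text \<open>The inverse supplied by \<open>homeomorphic_map\<close> is identified with the
  \<open>inv_into\<close> of \<open>aut_inv\<close> on the carrier only, which is enough for
  continuity.\<close>

lemma continuous_aut_inv: "continuous_map T T (aut_inv G a)"
proof -
  obtain g where g: "homeomorphic_maps T T a g"
    using top_aut by (auto simp: top_aut_def homeomorphic_map_maps)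
  then have cg: "continuous_map T T g" and ag: "\<And>x. x \<in> carrier G \<Longrightarrow> a (g x) = x"
    by (auto simp: homeomorphic_maps_def)
  have "g x = aut_inv G a x" if x: "x \<in> carrier G" for x
  proof -
    have "g x \<in> carrier G"
      using cg x by (auto simp: continuous_map_def)
    then show ?thesis
      using aut_inv_a [of "g x"] ag [OF x] by simp
  qed
  then show ?thesis
    using continuous_map_eq [OF cg] by simp
qed

lemma continuous_apow [simp]: "continuous_map T T (A k)"
proof (induction k rule: int_induct [where k = 0])
  case base
  show ?case by (simp add: apow_def [abs_def] )
next
  case (step1 i)
  have "continuous_map T T (\<lambda>x. a (A i x))"
    using continuous_map_compose [OF step1(2) continuous_a] by (simp add: o_def)
  then show ?case
    by (rule continuous_map_eq) (simp add: apow_succ)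
next
  case (step2 i)
  have "continuous_map T T (\<lambda>x. aut_inv G a (A i x))"
    using continuous_map_compose [OF step2(2) continuous_aut_inv] by (simp add: o_def)
  then show ?case
    by (rule continuous_map_eq) (simp add: apow_pred)
qed

section \<open>Closed stable subgroups\<close>

definition stable_sub :: "'a set \<Rightarrow> bool" where
  "stable_sub D \<longleftrightarrow> subgroup D G \<and> closedin T D \<and> a ` D = D"

lemma stable_sub_subgroup: "stable_sub D \<Longrightarrow> subgroup D G"
  and stable_sub_closed: "stable_sub D \<Longrightarrow> closedin T D"
  and stable_sub_subset: "stable_sub D \<Longrightarrow> D \<subseteq> carrier G"
  by (auto simp: stable_sub_def subgroup.subset)

lemma stable_sub_apow: "stable_sub D \<Longrightarrow> x \<in> D \<Longrightarrow> A k x \<in> D"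
proof (induction k rule: int_induct [where k = 0])
  case (step1 i)
  then have "A (i + 1) x = a (A i x)" using stable_sub_subset apow_succ by blast
  moreover have "a (A i x) \<in> D" using step1 by (auto simp: stable_sub_def)
  ultimately show ?case by simp
next
  case (step2 i)
  then have "A i x \<in> a ` D" by (simp add: stable_sub_def)
  then obtain y where "y \<in> D" "A i x = a y" by blast
  moreover then have "aut_inv G a (a y) = y" using stable_sub_subset step2.prems aut_inv_a by blast
  ultimately show ?case using stable_sub_subset apow_pred step2.prems by (metis subsetD)
qed simp

lemma stable_from_apow:
  assumes "D \<subseteq> carrier G" "\<And>x k. x \<in> D \<Longrightarrow> A k x \<in> D"
  shows "a ` D = D"
proof
  show "a ` D \<subseteq> D" using assms apow_1 by (metis image_subsetI subsetD)
  show "D \<subseteq> a ` D"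
  proof
    fix x assume "x \<in> D"
    then have "x = a (A (-1) x)" "A (-1) x \<in> D"
      using assms apow_succ [of x "-1"] by auto
    then show "x \<in> a ` D" by blast
  qed
qed

lemma stable_subI:
  assumes "subgroup D G" "closedin T D" "\<And>x k. x \<in> D \<Longrightarrow> A k x \<in> D"
  shows "stable_sub D"
  using assms(1,2) stable_from_apow [OF subgroup.subset [OF assms(1)] assms(3)] by (simp add: stable_sub_def)

lemma closedin_preimage:
  "closedin T C \<Longrightarrow> continuous_map T T f \<Longrightarrow> closedin T {x \<in> carrier G. f x \<in> C}"
  using closedin_continuous_map_preimage by fastforce

lemma openin_preimage:
  "openin T C \<Longrightarrow> continuous_map T T f \<Longrightarrow> openin T {x \<in> carrier G. f x \<in> C}"
  using openin_continuous_map_preimage by fastforce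

lemma continuous_map_id' [simp]: "continuous_map T T (\<lambda>x. x)"
  by simp

lemma continuous_const: "g \<in> carrier G \<Longrightarrow> continuous_map T T (\<lambda>x. g)"
  by (simp )

section \<open>Cosets, open subgroups and compactness\<close>

lemma r_coset_conv_preimage:
  assumes "U \<subseteq> carrier G" "g \<in> carrier G"
  shows "U #> g = {x \<in> carrier G. x \<otimes> inv g \<in> U}"
proof
  show "U #> g \<subseteq> {x \<in> carrier G. x \<otimes> inv g \<in> U}"
    using assms by (auto simp: r_coset_def m_assoc subset_iff)
  show "{x \<in> carrier G. x \<otimes> inv g \<in> U} \<subseteq> U #> g"
  proof
    fix x assume "x \<in> {x \<in> carrier G. x \<otimes> inv g \<in> U}"
    then show "x \<in> U #> g"
      using assms by (auto simp: r_coset_def m_assoc intro!: bexI [of _ "x \<otimes> inv g"])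
  qed
qed

lemma openin_r_coset:
  assumes "openin T U" "g \<in> carrier G" shows "openin T (U #> g)"
  using assms openin_subset [OF assms(1)]
  by (auto simp: r_coset_conv_preimage intro!: openin_preimage continuous_mult continuous_const)

lemma closedin_r_coset:
  assumes "closedin T U" "g \<in> carrier G" shows "closedin T (U #> g)"
  using assms closedin_subset [OF assms(1)]
  by (auto simp: r_coset_conv_preimage intro!: closedin_preimage continuous_mult continuous_const)

lemma rcosets_disjoint: "subgroup V G \<Longrightarrow> x \<in> carrier G \<Longrightarrow> y \<in> carrier G \<Longrightarrow>
    (V #> x) \<inter> (V #> y) \<noteq> {} \<Longrightarrow> V #> x = V #> y"
  using rcos_disjoint by (auto simp: pairwise_def disjnt_def RCOSETS_def)

lemma r_coset_eq_iff:
  assumes "subgroup V G" "x \<in> carrier G" "y \<in> carrier G"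
  shows "V #> x = V #> y \<longleftrightarrow> x \<otimes> inv y \<in> V"
proof
  assume "V #> x = V #> y"
  then have "x \<in> V #> y" using rcos_self [OF assms(2,1)] by simp
  then show "x \<otimes> inv y \<in> V"
    by (rule subgroup.rcos_module_imp [OF assms(1) is_group assms(3)])
next
  assume "x \<otimes> inv y \<in> V"
  then have "x \<in> V #> y"
    by (rule subgroup.rcos_module_rev [OF assms(1) is_group assms(3,2)])
  then show "V #> x = V #> y"
    using repr_independence [OF _ assms(3,1)] by simp
qed

lemma closedin_open_subgroup:
  assumes V: "subgroup V G" "openin T V" shows "closedin T V"
proof -
  have "V \<subseteq> carrier G" using V subgroup.subset by blast
  have "carrier G - V = \<Union>((\<lambda>x. V #> x) ` (carrier G - V))"
  proof
    show "carrier G - V \<subseteq> \<Union>((\<lambda>x. V #> x) ` (carrier G - V))"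
      using V rcos_self by auto
    show "\<Union>((\<lambda>x. V #> x) ` (carrier G - V)) \<subseteq> carrier G - V"
    proof clarify
      fix x y assume x: "x \<in> carrier G" "x \<notin> V" "y \<in> V #> x"
      then have y: "y \<in> carrier G" using \<open>V \<subseteq> carrier G\<close> r_coset_subset_G by blast
      moreover have "y \<notin> V"
      proof
        assume "y \<in> V"
        then have "(V #> \<one>) \<inter> (V #> x) \<noteq> {}"
          using x \<open>V \<subseteq> carrier G\<close> by auto
        then have "V #> \<one> = V #> x" using V x rcosets_disjoint by blast
        then show False using x V \<open>V \<subseteq> carrier G\<close> rcos_self by auto
      qed
      ultimately show "y \<in> carrier G - V" by blast
    qed
  qed
  moreover have "openin T \<dots>"
    using V openin_r_coset by (intro openin_Union) auto
  ultimately show ?thesis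
    using \<open>V \<subseteq> carrier G\<close> by (simp add: closedin_def)
qed

lemma finite_cosets_open:
  assumes V: "subgroup V G" "openin T V" shows "finite ((\<lambda>x. V #> x) ` carrier G)"
proof -
  have "\<exists>F. finite F \<and> F \<subseteq> (\<lambda>x. V #> x) ` carrier G \<and> carrier G \<subseteq> \<Union>F"
  proof -
    have "\<forall>U \<in> (\<lambda>x. V #> x) ` carrier G. openin T U"
      using V openin_r_coset by blast
    moreover have "topspace T \<subseteq> \<Union>((\<lambda>x. V #> x) ` carrier G)"
      using V rcos_self by auto
    ultimately show ?thesis
      using compact [unfolded compact_space_alt, THEN spec, of "(\<lambda>x. V #> x) ` carrier G"] by simp
  qed
  then obtain F where F: "finite F" "F \<subseteq> (\<lambda>x. V #> x) ` carrier G" "carrier G \<subseteq> \<Union>F" by auto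
  have "(\<lambda>x. V #> x) ` carrier G \<subseteq> F"
  proof clarify
    fix x assume x: "x \<in> carrier G"
    then obtain C where C: "C \<in> F" "x \<in> C" using F(3) by auto
    then obtain y where y: "y \<in> carrier G" "C = V #> y" using F(2) by auto
    then have "(V #> x) \<inter> (V #> y) \<noteq> {}" using C x rcos_self [OF x V(1)] by auto
    then have "V #> x = V #> y" using rcosets_disjoint [OF V(1) x y(1)] by simp
    then show "V #> x \<in> F" using y C by simp
  qed
  then show ?thesis using finite_subset [OF _ F(1)] by simp
qed

lemma conj_mem_subgroup_iff:
  assumes V: "subgroup V G" and v: "v \<in> V" and y: "y \<in> carrier G"
  shows "v \<otimes> y \<otimes> inv v \<in> V \<longleftrightarrow> y \<in> V"
proof
  have vc: "v \<in> carrier G" using V v subgroup.mem_carrier by fast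
  have iv: "inv v \<in> V" by (rule subgroup.m_inv_closed [OF V v])
  {
    assume "v \<otimes> y \<otimes> inv v \<in> V"
    then have "inv v \<otimes> (v \<otimes> y \<otimes> inv v) \<otimes> v \<in> V"
      using subgroup.m_closed [OF V] iv v by simp
    moreover have "inv v \<otimes> (v \<otimes> y \<otimes> inv v) \<otimes> v = y"
      using vc y by (simp add: m_assoc)
    ultimately show "y \<in> V" by simp
  }
  show "y \<in> V \<Longrightarrow> v \<otimes> y \<otimes> inv v \<in> V"
    using subgroup.m_closed [OF V] iv v by simp
qed

text \<open>The conjugate of \<open>V\<close> by \<open>g\<close> depends only on the coset
  \<open>V #> g\<close>, and compactness leaves finitely many cosets. So the intersection of all
  conjugates is a finite one and stays open.\<close>

lemma normal_core:
  assumes V: "subgroup V G" "openin T V"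
  obtains N where "N \<lhd> G" "openin T N" "N \<subseteq> V"
proof
  let ?c = "\<lambda>g. {x \<in> carrier G. g \<otimes> x \<otimes> inv g \<in> V}"
  let ?N = "\<Inter>g\<in>carrier G. ?c g"
  have VG: "V \<subseteq> carrier G" using V subgroup.subset by blast
  have c_eq: "?c (v \<otimes> g) = ?c g" if "v \<in> V" "g \<in> carrier G" for v g
  proof -
    have v: "v \<in> carrier G" using that VG by blast
    have "v \<otimes> g \<otimes> x \<otimes> inv (v \<otimes> g) \<in> V \<longleftrightarrow> g \<otimes> x \<otimes> inv g \<in> V" if x: "x \<in> carrier G" for x
    proof -
      have *: "v \<otimes> g \<otimes> x \<otimes> inv (v \<otimes> g) = v \<otimes> (g \<otimes> x \<otimes> inv g) \<otimes> inv v"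
        using v x \<open>g \<in> carrier G\<close> by (simp add: m_assoc inv_mult_group)
      show ?thesis
        unfolding * using conj_mem_subgroup_iff [OF V(1) \<open>v \<in> V\<close>, of "g \<otimes> x \<otimes> inv g"] x \<open>g \<in> carrier G\<close> by simp
    qed
    then show ?thesis by auto
  qed
  \<comment> \<open>One representative per coset, so that the conjugates become indexed by the
    finite set of cosets.\<close>
  define r where "r C = (SOME g. g \<in> carrier G \<and> C = V #> g)" for C
  have r: "r (V #> g) \<in> carrier G \<and> V #> r (V #> g) = V #> g" if "g \<in> carrier G" for g
  proof -
    have "r (V #> g) \<in> carrier G \<and> V #> g = V #> r (V #> g)"
      unfolding r_def by (rule someI_ex) (use that in blast)
    then show ?thesis by simp
  qed
  have "?c g = ?c (r (V #> g))" if g: "g \<in> carrier G" for g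
  proof -
    have "g \<in> V #> r (V #> g)" using r [OF g] rcos_self [OF g V(1)] by simp
    then obtain v where "v \<in> V" "g = v \<otimes> r (V #> g)" by (auto simp: r_coset_def)
    then show ?thesis using c_eq [of v "r (V #> g)"] r [OF g] by simp
  qed
  then have "?c g \<in> (\<lambda>C. ?c (r C)) ` ((\<lambda>g. V #> g) ` carrier G)" if "g \<in> carrier G" for g
    using that by (intro image_eqI [of _ _ "V #> g"]) auto
  then have "?c ` carrier G \<subseteq> (\<lambda>C. ?c (r C)) ` ((\<lambda>g. V #> g) ` carrier G)"
    by blast
  then have fin: "finite (?c ` carrier G)"
    using finite_cosets_open [OF V] finite_surj by blast
  show "openin T ?N"
  proof (rule openin_Inter [OF fin])
    show "?c ` carrier G \<noteq> {}" by blast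
    fix X assume "X \<in> ?c ` carrier G"
    then obtain g where "g \<in> carrier G" "X = ?c g" by blast
    then show "openin T X"
      using V by (auto intro!: openin_preimage continuous_mult continuous_const)
  qed
  show "?N \<subseteq> V"
  proof
    fix x assume "x \<in> ?N"
    then have "x \<in> carrier G" "\<one> \<otimes> x \<otimes> inv \<one> \<in> V" by blast+
    then show "x \<in> V" by simp
  qed
  show "?N \<lhd> G"
    unfolding normal_inv_iff
  proof safe
    show "subgroup ?N G"
    proof
      fix x y assume xy: "x \<in> ?N" "y \<in> ?N"
      then have c: "x \<in> carrier G" "y \<in> carrier G" by auto
      have "g \<otimes> (x \<otimes> y) \<otimes> inv g \<in> V" if g: "g \<in> carrier G" for g
      proof -
        have "g \<otimes> (x \<otimes> y) \<otimes> inv g = (g \<otimes> x \<otimes> inv g) \<otimes> (g \<otimes> y \<otimes> inv g)"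
          using c g by (simp add: m_assoc)
        then show ?thesis using xy g V subgroup.m_closed by fastforce
      qed
      then show "x \<otimes> y \<in> ?N" using c by auto
    next
      fix x assume x: "x \<in> ?N"
      then have c: "x \<in> carrier G" by auto
      have "g \<otimes> inv x \<otimes> inv g \<in> V" if g: "g \<in> carrier G" for g
      proof -
        have "g \<otimes> inv x \<otimes> inv g = inv (g \<otimes> x \<otimes> inv g)"
          using c g by (simp add: m_assoc inv_mult_group)
        then show ?thesis using x g V subgroup.m_inv_closed by fastforce
      qed
      then show "inv x \<in> ?N" using c by auto
    qed (use V in \<open>auto simp: subgroup.one_closed\<close>)
  next
    fix x h g assume x: "x \<in> carrier G" "h \<in> ?N" "g \<in> carrier G"
    then have h: "h \<in> carrier G" by blast
    have "g \<otimes> (x \<otimes> h \<otimes> inv x) \<otimes> inv g = (g \<otimes> x) \<otimes> h \<otimes> inv (g \<otimes> x)"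
      using x h by (simp add: m_assoc inv_mult_group)
    then show "g \<otimes> (x \<otimes> h \<otimes> inv x) \<otimes> inv g \<in> V" using x by auto
  qed auto
qed

lemma closedin_imp_compactin: "closedin T C \<Longrightarrow> compactin T C"
  using compact closedin_compact_space by blast

text \<open>Compactness is what makes this work: the product is the image of the compact set
  \<open>B \<times> C\<close>.\<close>

lemma closedin_set_mult:
  assumes "closedin T B" "closedin T C" shows "closedin T (B <#> C)"
proof -
  have "compactin (prod_topology T T) (B \<times> C)"
    using assms closedin_imp_compactin by (simp add: compactin_Times)
  moreover have "continuous_map (prod_topology T T) T (\<lambda>(x, y). x \<otimes> y)"
    using topgroup by (simp add: topgroup_def)
  ultimately have "compactin T ((\<lambda>(x, y). x \<otimes> y) ` (B \<times> C))"
    using image_compactin by blast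
  moreover have "(\<lambda>(x, y). x \<otimes> y) ` (B \<times> C) = B <#> C"
    by (auto simp: set_mult_def image_iff)
  ultimately show ?thesis using Hausdorff compactin_imp_closedin by metis
qed

end

section \<open>Group shifts\<close>

text \<open>On \<open>S\<close> the function \<open>g\<close> factors through \<open>f\<close>. With
  coset maps for \<open>f\<close> and \<open>g\<close> this carries finiteness of an index from one
  subgroup to another.\<close>

lemma finite_image_factor:
  assumes "finite (f ` S)" "\<And>x y. x \<in> S \<Longrightarrow> y \<in> S \<Longrightarrow> f x = f y \<Longrightarrow> g x = g y"
  shows "finite (g ` S)"
proof -
  have "g ` S \<subseteq> (\<lambda>c. g (SOME x. x \<in> S \<and> f x = c)) ` (f ` S)"
  proof
    fix z assume "z \<in> g ` S"
    then obtain x where x: "x \<in> S" "z = g x" by blast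
    define y where "y = (SOME y. y \<in> S \<and> f y = f x)"
    have "y \<in> S \<and> f y = f x"
      unfolding y_def by (rule someI [of _ x]) (simp add: x)
    then have "z = g y" using assms(2) [of x y] x by simp
    then show "z \<in> (\<lambda>c. g (SOME x. x \<in> S \<and> f x = c)) ` (f ` S)"
      using x unfolding y_def by blast
  qed
  then show ?thesis using finite_surj [OF assms(1)] by blast
qed

lemma finite_uniform_bound:
  fixes P :: "'b \<Rightarrow> nat \<Rightarrow> bool"
  assumes fin: "finite S" and ex: "\<And>s. s \<in> S \<Longrightarrow> \<exists>n. P s n"
    and mono: "\<And>s m n. m \<le> n \<Longrightarrow> P s m \<Longrightarrow> P s n"
  shows "\<exists>n. \<forall>s\<in>S. P s n"
proof -
  obtain f where f: "\<And>s. s \<in> S \<Longrightarrow> P s (f s)" using ex by metis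
  \<comment> \<open>The sum dominates every \<open>f s\<close>, and an empty \<open>S\<close> needs
    no separate case.\<close>
  have "P s (sum f S)" if s: "s \<in> S" for s
  proof (rule mono [of "f s"])
    show "f s \<le> sum f S" using s fin by (simp add: member_le_sum)
    show "P s (f s)" by (rule f [OF s])
  qed
  then show ?thesis by blast
qed

locale expansive_group_aut = compact_group_aut +
  fixes N
  assumes N_normal: "N \<lhd> G" and N_open: "openin T N"
    and expansive: "\<And>x. x \<in> carrier G \<Longrightarrow> (\<And>k. A k x \<in> N) \<Longrightarrow> x = \<one>"
begin

lemma N_subgroup: "subgroup N G"
  using N_normal by (rule normal_imp_subgroup)

lemmas N_m_closed = subgroup.m_closed [OF N_subgroup]
  and N_inv_closed = subgroup.m_inv_closed [OF N_subgroup]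
  and N_one = subgroup.one_closed [OF N_subgroup]

lemma N_conj: "x \<in> carrier G \<Longrightarrow> h \<in> N \<Longrightarrow> x \<otimes> h \<otimes> inv x \<in> N"
  using N_normal by (simp add: normal_inv_iff)

lemma N_closed: "closedin T N"
  using N_subgroup N_open by (rule closedin_open_subgroup)

text \<open>The symbol of \<open>x\<close> at time \<open>k\<close> is the coset
  \<open>N #> A k x\<close>; these are the cylinder subgroups of the shift, given by trivial symbols
  at the times in \<open>I\<close>.\<close>

definition res :: "'a set \<Rightarrow> int set \<Rightarrow> 'a set" where
  "res D I = {x \<in> D. \<forall>k\<in>I. A k x \<in> N}"

lemma mem_res: "x \<in> res D I \<longleftrightarrow> x \<in> D \<and> (\<forall>k\<in>I. A k x \<in> N)"
  by (simp add: res_def)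

lemma subgroup_res: assumes D: "subgroup D G" shows "subgroup (res D I) G"
proof
  note DG = subgroup.mem_carrier [OF D]
  show "res D I \<subseteq> carrier G" using DG by (auto simp: res_def)
  show "x \<otimes> y \<in> res D I" if "x \<in> res D I" "y \<in> res D I" for x y
    using that DG by (auto simp: mem_res subgroup.m_closed [OF D] N_m_closed)
  show "inv x \<in> res D I" if "x \<in> res D I" for x
    using that DG by (auto simp: mem_res subgroup.m_inv_closed [OF D] N_inv_closed)
  show "\<one> \<in> res D I"
    using subgroup.one_closed [OF D] by (simp add: mem_res N_one)
qed

lemma closedin_res:
  assumes D: "closedin T D" shows "closedin T (res D I)"
proof -
  have "closedin T (D \<inter> (\<Inter>k\<in>I. {x \<in> carrier G. A k x \<in> N}))"
  proof (cases "I = {}")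
    case False
    then have "closedin T (\<Inter>k\<in>I. {x \<in> carrier G. A k x \<in> N})"
      using N_closed by (intro closedin_Inter) (auto intro: closedin_preimage)
    then show ?thesis using D by (rule_tac closedin_Int)
  qed (use D in simp)
  moreover have "D \<inter> (\<Inter>k\<in>I. {x \<in> carrier G. A k x \<in> N}) = res D I"
    using closedin_subset [OF D] by (auto simp: res_def)
  ultimately show ?thesis by simp
qed

lemma openin_res:
  assumes D: "openin T D" and I: "finite I" shows "openin T (res D I)"
proof -
  have "openin T (D \<inter> (\<Inter>k\<in>I. {x \<in> carrier G. A k x \<in> N}))"
  proof (cases "I = {}")
    case False
    then have "openin T (\<Inter>k\<in>I. {x \<in> carrier G. A k x \<in> N})"
      using N_open I by (intro openin_Inter) (auto intro: openin_preimage)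
    then show ?thesis using D by (rule_tac openin_Int)
  qed (use D in simp)
  moreover have "D \<inter> (\<Inter>k\<in>I. {x \<in> carrier G. A k x \<in> N}) = res D I"
    using openin_subset [OF D] by (auto simp: res_def)
  ultimately show ?thesis by simp
qed

lemma apow_mem_res:
  assumes "stable_sub D" "x \<in> D"
  shows "A j x \<in> res D I \<longleftrightarrow> (\<forall>k\<in>I. A (k + j) x \<in> N)"
  using assms stable_sub_subset stable_sub_apow by (auto simp: mem_res apow_add subset_iff)

lemma openin_carrier: "openin T (carrier G)"
  using openin_topspace [of T] by simp

lemma closedin_carrier: "closedin T (carrier G)"
  using closedin_topspace [of T] by simp

lemma stable_sub_carrier: "stable_sub (carrier G)"
  using closedin_carrier by (intro stable_subI subgroup_self) auto

section \<open>Cylinder neighbourhoods of the identity\<close>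

definition nb :: "nat \<Rightarrow> 'a set" where
  "nb n = res (carrier G) {- int n..int n}"

lemma mem_nb: "x \<in> nb n \<longleftrightarrow> x \<in> carrier G \<and> (\<forall>k. \<bar>k\<bar> \<le> int n \<longrightarrow> A k x \<in> N)"
  by (auto simp: nb_def mem_res abs_le_iff)

lemma nb_open: "openin T (nb n)"
  unfolding nb_def by (intro openin_res openin_carrier) simp

lemma nb_subgroup: "subgroup (nb n) G"
  unfolding nb_def by (intro subgroup_res subgroup_self)

lemma nb_antimono: "m \<le> n \<Longrightarrow> nb n \<subseteq> nb m"
  by (auto simp: mem_nb)

lemmas nb_m_closed = subgroup.m_closed [OF nb_subgroup]
  and nb_inv_closed = subgroup.m_inv_closed [OF nb_subgroup]
  and nb_one = subgroup.one_closed [OF nb_subgroup]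

lemma nb_conj: "x \<in> carrier G \<Longrightarrow> h \<in> nb n \<Longrightarrow> x \<otimes> h \<otimes> inv x \<in> nb n"
  using N_conj by (simp add: mem_nb)

text \<open>If no \<open>nb n\<close> were contained in \<open>U\<close>, the nested closed sets
  \<open>nb n - U\<close> would have a common point by compactness. All its symbols are trivial, so
  it is the identity, which lies in \<open>U\<close>.\<close>

lemma nb_base:
  assumes U: "openin T U" "\<one> \<in> U"
  obtains n where "nb n \<subseteq> U"
proof (rule ccontr)
  assume "\<not> thesis"
  then have ne: "nb n - U \<noteq> {}" for n using that by blast
  have "(\<Inter>n. nb n - U) \<noteq> {}"
  proof (rule compact_space_imp_nest [OF compact _ ne])
    show "closedin T (nb n - U)" for n
      using U nb_open nb_subgroup by (intro closedin_diff closedin_open_subgroup)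
    show "decseq (\<lambda>n. nb n - U)"
      using nb_antimono by (auto simp: decseq_def)
  qed
  then obtain x where x: "\<And>n. x \<in> nb n" "x \<notin> U" by blast
  have "A k x \<in> N" for k
    using x(1) [of "nat \<bar>k\<bar>"] by (simp add: mem_nb)
  then have "x = \<one>" using expansive x(1) [of 0] by (simp add: mem_nb)
  then show False using x U by simp
qed

text \<open>Turns statements about closures into word identities: since each \<open>nb n\<close> is
  normal in \<open>G\<close>, error terms can be conjugated past other factors.\<close>

lemma closure_iff:
  assumes S: "S \<subseteq> carrier G"
  shows "x \<in> T closure_of S \<longleftrightarrow> x \<in> carrier G \<and> (\<forall>n. \<exists>s\<in>S. x \<otimes> inv s \<in> nb n)"
proof (intro iffI conjI allI)
  assume x: "x \<in> T closure_of S"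
  then show xG: "x \<in> carrier G" by (simp add: in_closure_of)
  fix n
  have "openin T {y \<in> carrier G. x \<otimes> inv y \<in> nb n}"
    using xG nb_open by (intro openin_preimage continuous_mult continuous_inv continuous_const) auto
  moreover have "x \<in> {y \<in> carrier G. x \<otimes> inv y \<in> nb n}" using xG nb_one by simp
  ultimately obtain s where "s \<in> S" "s \<in> {y \<in> carrier G. x \<otimes> inv y \<in> nb n}"
    using x unfolding in_closure_of by meson
  then show "\<exists>s\<in>S. x \<otimes> inv s \<in> nb n" by blast
next
  assume x: "x \<in> carrier G \<and> (\<forall>n. \<exists>s\<in>S. x \<otimes> inv s \<in> nb n)"
  show "x \<in> T closure_of S"
    unfolding in_closure_of
  proof (intro conjI allI impI)
    show "x \<in> topspace T" using x by simp
    fix U assume U: "x \<in> U \<and> openin T U"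
    \<comment> \<open>The set is chosen so that its member \<open>z = x \<otimes> inv s\<close>
      returns \<open>inv z \<otimes> x = s\<close>.\<close>
    have "openin T {z \<in> carrier G. inv z \<otimes> x \<in> U}"
      using x U by (intro openin_preimage continuous_mult continuous_inv continuous_const) auto
    moreover have "\<one> \<in> {z \<in> carrier G. inv z \<otimes> x \<in> U}" using x U by simp
    ultimately obtain n where n: "nb n \<subseteq> {z \<in> carrier G. inv z \<otimes> x \<in> U}"
      using nb_base by blast
    obtain s where s: "s \<in> S" "x \<otimes> inv s \<in> nb n" using x by blast
    then have "inv (x \<otimes> inv s) \<otimes> x \<in> U" using n by blast
    moreover have "inv (x \<otimes> inv s) \<otimes> x = s"
      using x s S by (simp add: inv_mult_group m_assoc subset_iff)
    ultimately show "\<exists>y. y \<in> S \<and> y \<in> U" using s by auto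
  qed
qed

text \<open>The set E of the overview, with symbols written as cosets. If \<open>x\<close> and
  \<open>y\<close> in \<open>D\<close> agree at all negative times, then
  \<open>x \<otimes> inv y\<close> lies in \<open>res D {..<0}\<close>, so their symbols at time 0
  differ by an element of this set: it describes the continuations of every past, not only of the
  trivial one.\<close>

definition followers :: "'a set \<Rightarrow> 'a set set" where
  "followers D = (\<lambda>x. N #> x) ` res D {..<0}"

lemma finite_followers: "stable_sub D \<Longrightarrow> finite (followers D)"
  using finite_cosets_open [OF N_subgroup N_open] stable_sub_subset
  by (auto simp: followers_def res_def elim!: finite_subset [rotated])

lemma followers_mono: "K \<subseteq> H \<Longrightarrow> followers K \<subseteq> followers H"
  by (auto simp: followers_def res_def)

text \<open>A coset outside \<open>followers D\<close> cannot occur after arbitrarily long trivial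
  pasts: the elements of \<open>D\<close> in it that are trivial at the times \<open>- n..<0\<close>
  form nested closed sets, and a common point would make the coset a follower. There are finitely
  many cosets, so one \<open>m\<close> serves all.\<close>

lemma followers_stabilize:
  assumes D: "stable_sub D"
  obtains m :: nat where "\<And>x. x \<in> res D {- int m..<0} \<Longrightarrow> N #> x \<in> followers D"
proof -
  let ?P = "\<lambda>C n. \<forall>x\<in>res D {- int n..<0}. N #> x \<noteq> C"
  let ?S = "(\<lambda>x. N #> x) ` carrier G - followers D"
  have fin: "finite ?S"
    using finite_cosets_open [OF N_subgroup N_open] by simp
  have "\<exists>m. \<forall>C\<in>?S. ?P C m"
  proof (rule finite_uniform_bound [OF fin, of ?P])
    fix C assume "C \<in> ?S"
    then obtain g where g: "g \<in> carrier G" "C = N #> g" and C: "C \<notin> followers D" by blast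
    show "\<exists>n. ?P C n"
    proof (rule ccontr)
      assume "\<not> (\<exists>n. ?P C n)"
      then have ne: "\<exists>x\<in>res D {- int n..<0}. N #> x = C" for n by blast
      let ?C = "\<lambda>n. res D {- int n..<0} \<inter> (N #> g)"
      have "(\<Inter>n. ?C n) \<noteq> {}"
      proof (rule compact_space_imp_nest [OF compact])
        show "closedin T (?C n)" for n
          using D g by (intro closedin_Int closedin_res closedin_r_coset N_closed stable_sub_closed)
        show "?C n \<noteq> {}" for n
        proof -
          obtain x where x: "x \<in> res D {- int n..<0}" "N #> x = C" using ne by blast
          then have "x \<in> carrier G" using stable_sub_subset [OF D] by (auto simp: mem_res)
          then have "x \<in> N #> g" using x g rcos_self [OF _ N_subgroup] by metis
          then show ?thesis using x by blast
        qed
        show "decseq ?C" by (auto simp: decseq_def mem_res)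
      qed
      then obtain x where x: "\<And>n. x \<in> res D {- int n..<0}" "x \<in> N #> g" by blast
      have "A k x \<in> N" if "k < 0" for k
        using x(1) [of "nat \<bar>k\<bar>"] that by (simp add: mem_res)
      then have "x \<in> res D {..<0}" using x(1) [of 0] by (simp add: mem_res)
      moreover have "N #> g = N #> x"
        using repr_independence [OF x(2) g(1) N_subgroup] .
      ultimately have "C \<in> followers D" using g by (auto simp: followers_def)
      then show False using C by simp
    qed
  next
    fix C and m n :: nat assume "m \<le> n" "?P C m"
    then show "?P C n" by (auto simp: mem_res)
  qed
  then obtain m where m: "\<And>C. C \<in> ?S \<Longrightarrow> ?P C m" by blast
  show ?thesis
  proof
    fix x assume x: "x \<in> res D {- int m..<0}"
    then have "x \<in> carrier G" using stable_sub_subset [OF D] by (auto simp: mem_res)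
    then show "N #> x \<in> followers D" using m x by blast
  qed
qed

text \<open>For \<open>K = H\<close> this is the finite type property: an element that is trivial on a long enough interval
  splits into a part trivial to the left and a part trivial to the right of it.\<close>
lemma glue:
  assumes K: "stable_sub K" and H: "stable_sub H" and KH: "K \<subseteq> H" and fol: "followers H \<subseteq> followers K"
  obtains m :: nat where "\<And>p q x. p + int m \<le> q \<Longrightarrow> x \<in> res H {p..<q} \<Longrightarrow>
     \<exists>y\<in>res K {..<q}. x \<otimes> inv y \<in> res H {p..}"
proof -
  obtain m :: nat where m: "\<And>x. x \<in> res H {- int m..<0} \<Longrightarrow> N #> x \<in> followers H"
    using followers_stabilize [OF H] by blast
  note HG = subgroup.mem_carrier [OF stable_sub_subgroup [OF H]]
  note Hm = subgroup.m_closed [OF stable_sub_subgroup [OF H]]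
  note Hi = subgroup.m_inv_closed [OF stable_sub_subgroup [OF H]]
  note KmG = subgroup.m_closed [OF stable_sub_subgroup [OF K]]
  \<comment> \<open>\<open>y\<close> is built one symbol at a time. The symbol of
    \<open>x \<otimes> inv y\<close> at time \<open>q + int n\<close> follows at least
    \<open>m\<close> trivial ones, hence lies in \<open>followers K\<close>. An element
    \<open>v\<close> of \<open>K\<close> that realises it, shifted to that time, cancels it and is
    trivial at all earlier times.\<close>
  have fin: "\<exists>y\<in>res K {..<q}. x \<otimes> inv y \<in> res H {p..<q + int n}"
    if pq: "p + int m \<le> q" and x: "x \<in> res H {p..<q}" for p q x n
  proof (induction n)
    case 0
    have "\<one> \<in> res K {..<q}" using subgroup.one_closed [OF subgroup_res [OF stable_sub_subgroup [OF K]]] .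
    moreover have "x \<otimes> inv \<one> = x" using x HG by (simp add: mem_res)
    ultimately show ?case using x by (intro bexI [of _ \<one>]) auto
  next
    case (Suc n)
    let ?r = "q + int n"
    obtain y where y: "y \<in> K" "\<And>k. k < q \<Longrightarrow> A k y \<in> N"
      and z: "x \<otimes> inv y \<in> H" "\<And>k. p \<le> k \<Longrightarrow> k < ?r \<Longrightarrow> A k (x \<otimes> inv y) \<in> N"
      using Suc by (auto simp: mem_res)
    have "A ?r (x \<otimes> inv y) \<in> res H {- int m..<0}"
      using apow_mem_res [OF H z(1)] pq z by simp
    then have "N #> A ?r (x \<otimes> inv y) \<in> followers K" using m fol by blast
    then obtain v where v: "v \<in> K" "\<And>k. k < 0 \<Longrightarrow> A k v \<in> N" "N #> A ?r (x \<otimes> inv y) = N #> v"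
      by (auto simp: followers_def mem_res)
    let ?v = "A (- ?r) v"
    have vK: "?v \<in> K" by (rule stable_sub_apow [OF K v(1)])
    have c [simp]: "v \<in> carrier G" "y \<in> carrier G" "x \<in> carrier G"
      using v y x KH HG by (auto simp: mem_res)
    have vN: "A k ?v \<in> N" if "k < ?r" for k
      using v(2) that by (simp add: apow_add)
    have eq: "x \<otimes> inv (?v \<otimes> y) = (x \<otimes> inv y) \<otimes> inv ?v"
      by (simp add: inv_mult_group m_assoc)
    have last: "A ?r (x \<otimes> inv y) \<otimes> inv v \<in> N"
      using v(3) r_coset_eq_iff [OF N_subgroup] by simp
    show ?case
    proof (rule bexI [of _ "?v \<otimes> y"])
      show "?v \<otimes> y \<in> res K {..<q}"
        using vK y KmG vN by (auto simp: mem_res N_m_closed)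
      have "A k ((x \<otimes> inv y) \<otimes> inv ?v) \<in> N" if k: "p \<le> k" "k < ?r + 1" for k
      proof (cases "k < ?r")
        case True
        then have "A k (x \<otimes> inv y) \<otimes> inv (A k ?v) \<in> N"
          using z(2) [OF k(1)] vN by (intro N_m_closed N_inv_closed) auto
        then show ?thesis by simp
      next
        case False
        then have "k = ?r" using k by simp
        then show ?thesis using last by (simp add: apow_add)
      qed
      moreover have "(x \<otimes> inv y) \<otimes> inv ?v \<in> H"
        by (rule Hm [OF z(1) Hi [OF subsetD [OF KH vK]]])
      ultimately show "x \<otimes> inv (?v \<otimes> y) \<in> res H {p..<q + int (Suc n)}"
        unfolding eq by (simp add: mem_res)
    qed
  qed
  show ?thesis
  proof
    fix p q x assume pq: "p + int m \<le> q" and x: "x \<in> res H {p..<q}"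
    then have xG: "x \<in> carrier G" using HG by (simp add: mem_res)
    \<comment> \<open>The solutions for each \<open>n\<close> form a decreasing sequence of nonempty
      closed sets; a common point works on the whole half-line.\<close>
    let ?C = "\<lambda>n. res K {..<q} \<inter> {y \<in> carrier G. x \<otimes> inv y \<in> res H {p..<q + int n}}"
    have "(\<Inter>n. ?C n) \<noteq> {}"
    proof (rule compact_space_imp_nest [OF compact])
      show "closedin T (?C n)" for n
        using K H xG
        by (intro closedin_Int closedin_preimage closedin_res continuous_mult continuous_inv continuous_const)
           (auto simp: stable_sub_closed)
      show "?C n \<noteq> {}" for n
      proof -
        obtain y where y: "y\<in>res K {..<q}" "x \<otimes> inv y \<in> res H {p..<q + int n}"
          using fin [OF pq x] by blast
        then have "y \<in> carrier G" using KH HG by (auto simp: mem_res)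
        then show ?thesis using y by blast
      qed
      show "decseq ?C" by (auto simp: decseq_def mem_res)
    qed
    then obtain y where y: "y\<in>res K {..<q}" "\<And>n. x \<otimes> inv y \<in> res H {p..<q + int n}"
      by blast
    have "A k (x \<otimes> inv y) \<in> N" if "p \<le> k" for k
      using y(2) [of "nat (k - q + 1)"] that by (simp add: mem_res)
    then have "x \<otimes> inv y \<in> res H {p..}" using y(2) [of 0] by (simp add: mem_res)
    then show "\<exists>y\<in>res K {..<q}. x \<otimes> inv y \<in> res H {p..}" using y by blast
  qed
qed

text \<open>\<open>K\<close> need not be contained in \<open>H\<close>; the condition says that \<open>K \<inter> H\<close> has finite index in \<open>H\<close>.\<close>
definition fin_index :: "'a set \<Rightarrow> 'a set \<Rightarrow> bool" where
  "fin_index K H \<longleftrightarrow> finite ((\<lambda>h. K #> h) ` H)"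

text \<open>The index is bounded by the number of symbol patterns on a window of length
  \<open>m\<close>, with \<open>m\<close> from \<open>glue\<close>. Among more elements of
  \<open>H\<close> than that, two agree on a window far to the left; \<open>glue\<close> then
  corrects their quotient by an element of \<open>K\<close> so that it is trivial from there on. So
  the quotient is as close to \<open>K\<close> as desired, although \<open>K\<close> is closed and
  the cosets are distinct.\<close>

lemma fin_index_of_followers:
  assumes K: "stable_sub K" and H: "stable_sub H" and KH: "K \<subseteq> H" and fol: "followers H \<subseteq> followers K"
  shows "fin_index K H"
proof (rule ccontr)
  assume "\<not> fin_index K H"
  then have inf: "infinite ((\<lambda>h. K #> h) ` H)" by (simp add: fin_index_def)
  obtain m :: nat where m: "\<And>p q x. p + int m \<le> q \<Longrightarrow> x \<in> res H {p..<q} \<Longrightarrow>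
     \<exists>y\<in>res K {..<q}. x \<otimes> inv y \<in> res H {p..}"
    using glue [OF assms] by blast
  let ?W = "res (carrier G) {0..<int m}"
  have Wsub: "subgroup ?W G" by (intro subgroup_res subgroup_self)
  have finW: "finite ((\<lambda>h. ?W #> h) ` carrier G)"
    by (intro finite_cosets_open openin_res openin_carrier Wsub) simp
  let ?c = "card ((\<lambda>h. ?W #> h) ` carrier G)"
  \<comment> \<open>One coset of \<open>K\<close> more than there are patterns: cosets of
    \<open>?W\<close> record the symbols at the times \<open>0..<m\<close>.\<close>
  obtain F where F: "F \<subseteq> (\<lambda>h. K #> h) ` H" "finite F" "card F = Suc ?c"
    using infinite_arbitrarily_large [OF inf] by blast
  obtain S where S: "S \<subseteq> H" "inj_on (\<lambda>h. K #> h) S" "F = (\<lambda>h. K #> h) ` S"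
    using subset_image_inj [THEN iffD1, OF F(1)] by blast
  have finS: "finite S" using F S finite_image_iff by metis
  have cS: "card S = Suc ?c" using F S card_image by metis
  have HG: "H \<subseteq> carrier G" and KG: "K \<subseteq> carrier G" using H K stable_sub_subset by auto
  let ?P = "\<lambda>(x, y) n. \<not> (\<exists>k\<in>K. x \<otimes> inv y \<otimes> inv k \<in> nb n)"
  let ?S = "{(x, y). x \<in> S \<and> y \<in> S \<and> x \<noteq> y}"
  have "?S \<subseteq> S \<times> S" by auto
  then have finS2: "finite ?S" using finS finite_subset by blast
  have "\<exists>n. \<forall>s\<in>?S. ?P s n"
  proof (rule finite_uniform_bound [OF finS2, of ?P])
    fix s assume "s \<in> ?S"
    then obtain x y where s: "s = (x, y)" "x \<in> S" "y \<in> S" "x \<noteq> y" by blast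
    then have xy: "x \<in> carrier G" "y \<in> carrier G" using S HG by auto
    have "K #> x \<noteq> K #> y" using s S(2) by (auto simp: inj_on_def)
    then have "x \<otimes> inv y \<notin> K" using r_coset_eq_iff [OF stable_sub_subgroup [OF K] xy] by simp
    moreover have "T closure_of K = K" using K by (simp add: closure_of_eq stable_sub_closed)
    ultimately have "\<not> (\<forall>n. \<exists>k\<in>K. x \<otimes> inv y \<otimes> inv k \<in> nb n)"
      using closure_iff [OF KG, of "x \<otimes> inv y"] xy by simp
    then show "\<exists>n. ?P s n" using s by simp
  next
    fix s and m n :: nat assume "m \<le> n" "?P s m"
    then show "?P s n" using nb_antimono [of m n] by (auto split: prod.splits)
  qed
  then obtain n where n: "\<And>s. s \<in> ?S \<Longrightarrow> ?P s n" by blast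
  \<comment> \<open>The shift by \<open>- n\<close> moves the window of length \<open>m\<close> to
    the left end of the symmetric window that defines \<open>nb n\<close>.\<close>
  have "\<not> inj_on (\<lambda>x. ?W #> A (- int n) x) S"
  proof
    assume "inj_on (\<lambda>x. ?W #> A (- int n) x) S"
    then have "card S = card ((\<lambda>x. ?W #> A (- int n) x) ` S)" by (simp add: card_image)
    also have "\<dots> \<le> ?c"
      using S HG by (intro card_mono finW) auto
    finally show False using cS by simp
  qed
  then obtain x y where xy: "x \<in> S" "y \<in> S" "x \<noteq> y" "?W #> A (- int n) x = ?W #> A (- int n) y"
    by (auto simp: inj_on_def)
  then have c: "x \<in> H" "y \<in> H" "x \<in> carrier G" "y \<in> carrier G" using S HG by auto
  have "A (- int n) x \<otimes> inv (A (- int n) y) \<in> ?W"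
    using xy(4) r_coset_eq_iff [OF Wsub] c by simp
  then have W: "A (- int n) (x \<otimes> inv y) \<in> ?W"
    using c by simp
  have "x \<otimes> inv y \<in> res H {- int n..< - int n + int m}"
    unfolding mem_res
  proof (intro conjI ballI)
    show "x \<otimes> inv y \<in> H" using c H stable_sub_subgroup subgroup.m_closed subgroup.m_inv_closed by metis
    fix k assume k: "k \<in> {- int n..< - int n + int m}"
    then have "A (k + int n) (A (- int n) (x \<otimes> inv y)) \<in> N"
      using W unfolding mem_res by simp
    then show "A k (x \<otimes> inv y) \<in> N" using c by (simp add: apow_add del: apow_mult apow_inv)
  qed
  then obtain k where k: "k \<in> res K {..< - int n + int m}" "x \<otimes> inv y \<otimes> inv k \<in> res H {- int n..}"
    using m [of "- int n" "- int n + int m" "x \<otimes> inv y"] by auto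
  then have "x \<otimes> inv y \<otimes> inv k \<in> nb n" using HG by (auto simp: mem_res mem_nb)
  moreover have "k \<in> K" using k by (simp add: mem_res)
  ultimately show False using n [of "(x, y)"] xy by auto
qed


section \<open>The closure of the homoclinic subgroup\<close>

text \<open>Since the sets \<open>nb n\<close> form a neighbourhood base at the identity, eventual
  triviality of the symbols in both directions amounts to convergence of \<open>A k x\<close> to the
  identity as \<open>k\<close> tends to both infinities.\<close>

definition homoclinic :: "'a set \<Rightarrow> 'a set" where
  "homoclinic D = {x \<in> D. \<exists>M. \<forall>k. M \<le> \<bar>k\<bar> \<longrightarrow> A k x \<in> N}"

definition nub :: "'a set \<Rightarrow> 'a set" where
  "nub D = T closure_of (homoclinic D)"

definition trans :: "'a set \<Rightarrow> bool" where
  "trans H \<longleftrightarrow> (\<exists>x\<in>H. T closure_of (range (\<lambda>k. A k x)) = H)"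

section \<open>Homoclinic points and their closure\<close>

lemma subgroup_closure:
  assumes S: "subgroup S G"
  shows "subgroup (T closure_of S) G"
proof
  note SG = subgroup.subset [OF S] and SmG = subgroup.mem_carrier [OF S]
  note iff = closure_iff [OF SG]
  show "T closure_of S \<subseteq> carrier G" using closure_of_subset_topspace [of T S] by simp
  show "\<one> \<in> T closure_of S"
    unfolding iff using subgroup.one_closed [OF S] by (auto intro!: bexI [of _ \<one>] simp: nb_one)
  fix x assume x: "x \<in> T closure_of S"
  then have xG: "x \<in> carrier G" by (simp add: iff)
  have "\<exists>s\<in>S. inv x \<otimes> inv s \<in> nb n" for n
  proof -
    obtain s where s: "s \<in> S" "x \<otimes> inv s \<in> nb n" using x iff by blast
    have "inv x \<otimes> inv (x \<otimes> inv s) \<otimes> inv (inv x) \<in> nb n"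
      using xG nb_inv_closed [OF s(2)] by (intro nb_conj) auto
    moreover have "inv x \<otimes> inv (x \<otimes> inv s) \<otimes> inv (inv x) = inv x \<otimes> inv (inv s)"
      using xG SmG [OF s(1)] by (simp add: inv_mult_group m_assoc)
    ultimately have "inv x \<otimes> inv (inv s) \<in> nb n" by simp
    then show ?thesis using subgroup.m_inv_closed [OF S s(1)] by blast
  qed
  then show "inv x \<in> T closure_of S" unfolding iff using xG by simp
  fix y assume y: "y \<in> T closure_of S"
  then have yG: "y \<in> carrier G" by (simp add: iff)
  have "\<exists>s\<in>S. x \<otimes> y \<otimes> inv s \<in> nb n" for n
  proof -
    obtain s t where s: "s \<in> S" "x \<otimes> inv s \<in> nb n" and t: "t \<in> S" "y \<otimes> inv t \<in> nb n"
      using x y iff by meson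
    have "(x \<otimes> (y \<otimes> inv t) \<otimes> inv x) \<otimes> (x \<otimes> inv s) \<in> nb n"
      by (rule nb_m_closed [OF nb_conj [OF xG t(2)] s(2)])
    moreover have "(x \<otimes> (y \<otimes> inv t) \<otimes> inv x) \<otimes> (x \<otimes> inv s) = x \<otimes> y \<otimes> inv (s \<otimes> t)"
      using xG yG SmG [OF s(1)] SmG [OF t(1)] by (simp add: inv_mult_group m_assoc)
    ultimately have "x \<otimes> y \<otimes> inv (s \<otimes> t) \<in> nb n" by simp
    then show ?thesis using subgroup.m_closed [OF S s(1) t(1)] by blast
  qed
  then show "x \<otimes> y \<in> T closure_of S" unfolding iff using xG yG by simp
qed

lemma homoclinic_subset: "homoclinic D \<subseteq> D"
  by (auto simp: homoclinic_def)

lemma homoclinicI: "x \<in> D \<Longrightarrow> (\<And>k. M \<le> \<bar>k\<bar> \<Longrightarrow> A k x \<in> N) \<Longrightarrow> x \<in> homoclinic D"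
  by (auto simp: homoclinic_def)

lemma subgroup_homoclinic:
  assumes D: "stable_sub D" shows "subgroup (homoclinic D) G"
proof
  note S = stable_sub_subgroup [OF D]
  note DG = subgroup.mem_carrier [OF S]
  show "homoclinic D \<subseteq> carrier G" using DG by (auto simp: homoclinic_def)
  show "\<one> \<in> homoclinic D"
    using subgroup.one_closed [OF S] by (intro homoclinicI) (auto simp: N_one)
  fix x assume "x \<in> homoclinic D"
  then obtain M where x: "x \<in> D" "\<And>k. M \<le> \<bar>k\<bar> \<Longrightarrow> A k x \<in> N" by (auto simp: homoclinic_def)
  show "inv x \<in> homoclinic D"
    using x DG subgroup.m_inv_closed [OF S] N_inv_closed by (intro homoclinicI [where M = M]) auto
  fix y assume "y \<in> homoclinic D"
  then obtain M' where y: "y \<in> D" "\<And>k. M' \<le> \<bar>k\<bar> \<Longrightarrow> A k y \<in> N" by (auto simp: homoclinic_def)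
  show "x \<otimes> y \<in> homoclinic D"
    using x y DG subgroup.m_closed [OF S] N_m_closed by (intro homoclinicI [where M = "max M M'"]) auto
qed

lemma homoclinic_apow:
  assumes D: "stable_sub D" and x: "x \<in> homoclinic D" shows "A j x \<in> homoclinic D"
proof -
  obtain M where x: "x \<in> D" "\<And>k. M \<le> \<bar>k\<bar> \<Longrightarrow> A k x \<in> N" using x by (auto simp: homoclinic_def)
  show ?thesis
  proof (rule homoclinicI [where M = "M + \<bar>j\<bar>"])
    show "A j x \<in> D" using stable_sub_apow [OF D] x by blast
    fix k assume "M + \<bar>j\<bar> \<le> \<bar>k\<bar>"
    then have "M \<le> \<bar>k + j\<bar>" by linarith
    then show "A k (A j x) \<in> N"
      using x stable_sub_subset [OF D] by (auto simp: apow_add)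
  qed
qed

lemma nub_subset: "stable_sub D \<Longrightarrow> nub D \<subseteq> D"
  unfolding nub_def using homoclinic_subset stable_sub_closed closure_of_minimal by metis

lemma homoclinic_subset_nub: "stable_sub D \<Longrightarrow> homoclinic D \<subseteq> nub D"
  unfolding nub_def using homoclinic_subset stable_sub_subset
  by (intro closure_of_subset) force

lemma stable_sub_nub:
  assumes D: "stable_sub D" shows "stable_sub (nub D)"
proof (rule stable_subI)
  show "subgroup (nub D) G"
    unfolding nub_def by (intro subgroup_closure subgroup_homoclinic D)
  show "closedin T (nub D)" by (simp add: nub_def)
  fix x k assume "x \<in> nub D"
  then have "A k x \<in> A k ` (T closure_of homoclinic D)" by (simp add: nub_def)
  also have "\<dots> \<subseteq> T closure_of (A k ` homoclinic D)"
    by (rule continuous_map_image_closure_subset [OF continuous_apow])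
  also have "\<dots> \<subseteq> T closure_of (homoclinic D)"
    using homoclinic_apow [OF D] by (intro closure_of_mono) auto
  finally show "A k x \<in> nub D" by (simp add: nub_def)
qed

text \<open>As \<open>N\<close> is normal in \<open>G\<close>, conjugation by \<open>g\<close> keeps
  every trivial symbol trivial and so maps homoclinic points of \<open>D\<close> to homoclinic
  points. The element \<open>g\<close> may lie outside \<open>D\<close>, which is how normality of
  \<open>D\<close> in a larger group passes to \<open>nub D\<close>.\<close>

lemma nub_conj:
  assumes g: "g \<in> carrier G" and D: "stable_sub D"
    and conj: "\<And>x. x \<in> D \<Longrightarrow> g \<otimes> x \<otimes> inv g \<in> D"
    and x: "x \<in> nub D"
  shows "g \<otimes> x \<otimes> inv g \<in> nub D"
proof -
  have DG: "homoclinic D \<subseteq> carrier G" using homoclinic_subset stable_sub_subset [OF D] by blast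
  have h: "g \<otimes> s \<otimes> inv g \<in> homoclinic D" if s: "s \<in> homoclinic D" for s
  proof -
    obtain M where M: "\<And>k. M \<le> \<bar>k\<bar> \<Longrightarrow> A k s \<in> N" and "s \<in> D" using s by (auto simp: homoclinic_def)
    moreover have "s \<in> carrier G" using s DG by blast
    ultimately show ?thesis
      using conj g N_conj by (intro homoclinicI [where M = M]) auto
  qed
  have xG: "x \<in> carrier G" using x stable_sub_subset [OF stable_sub_nub [OF D]] by blast
  have "\<exists>s\<in>homoclinic D. g \<otimes> x \<otimes> inv g \<otimes> inv s \<in> nb n" for n
  proof -
    obtain s where s: "s \<in> homoclinic D" "x \<otimes> inv s \<in> nb n"
      using x unfolding nub_def closure_iff [OF DG] by blast
    have "g \<otimes> (x \<otimes> inv s) \<otimes> inv g \<in> nb n" using g s by (intro nb_conj)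
    moreover have "s \<in> carrier G" using s DG by blast
    then have "g \<otimes> (x \<otimes> inv s) \<otimes> inv g = g \<otimes> x \<otimes> inv g \<otimes> inv (g \<otimes> s \<otimes> inv g)"
      using g xG by (simp add: inv_mult_group m_assoc)
    ultimately show ?thesis using h [OF s(1)] by auto
  qed
  then show ?thesis
    unfolding nub_def closure_iff [OF DG] using g xG by simp
qed

text \<open>With \<open>\<beta>\<close> for \<open>A L\<close>, this is
  \<open>x \<beta>(x) \<cdots> \<beta>\<^sup>l(x)\<close>. The recursion splits off the first
  factor, because \<open>walk_agrees\<close> compares the whole product with
  \<open>x\<close>.\<close>

primrec walk :: "int \<Rightarrow> 'a \<Rightarrow> nat \<Rightarrow> 'a" where
  "walk L x 0 = x"
| "walk L x (Suc l) = x \<otimes> A L (walk L x l)"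

lemma walk_closed:
  assumes D: "stable_sub D" and x: "x \<in> D" shows "walk L x l \<in> D"
  using x stable_sub_apow [OF D] subgroup.m_closed [OF stable_sub_subgroup [OF D]] by (induction l) auto

lemma walk_mem_N:
  assumes x: "x \<in> carrier G" and N: "\<And>i::nat. A (k + int i * L) x \<in> N"
  shows "A k (walk L x l) \<in> N"
  using N
proof (induction l arbitrary: k)
  case 0
  then show ?case using "0" [of 0] by simp
next
  case (Suc l)
  have w: "walk L x l \<in> carrier G" using walk_closed [OF stable_sub_carrier x] .
  have "A (k + L) (walk L x l) \<in> N"
  proof (rule Suc.IH)
    fix i :: nat
    show "A (k + L + int i * L) x \<in> N" using Suc.prems [of "Suc i"] by (simp add: algebra_simps)
  qed
  moreover have "A k x \<in> N" using Suc.prems [of 0] by simp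
  ultimately show ?case using x w by (simp add: apow_add N_m_closed)
qed

text \<open>The quotient is the conjugate by \<open>x\<close> of the inverse of \<open>A L\<close>
  applied to a shorter walk. At time \<open>k\<close> that walk only involves the symbols of
  \<open>x\<close> at the times \<open>k + L\<close>, \<open>k + 2L\<close> and so on.\<close>

lemma walk_agrees:
  assumes x: "x \<in> carrier G" and N: "\<And>i::nat. A (k + int (Suc i) * L) x \<in> N"
  shows "A k (x \<otimes> inv (walk L x l)) \<in> N"
proof (cases l)
  case 0
  then show ?thesis using x by (simp add: N_one)
next
  case (Suc n)
  have w: "walk L x n \<in> carrier G" using walk_closed [OF stable_sub_carrier x] .
  have "A (k + L) (walk L x n) \<in> N"
  proof (rule walk_mem_N [OF x])
    fix i :: nat
    show "A (k + L + int i * L) x \<in> N" using N [of i] by (simp add: algebra_simps)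
  qed
  then have "A k x \<otimes> inv (A (k + L) (walk L x n)) \<otimes> inv (A k x) \<in> N"
    using x by (intro N_conj N_inv_closed) auto
  moreover have "A k (x \<otimes> inv (walk L x l)) = A k x \<otimes> inv (A (k + L) (walk L x n)) \<otimes> inv (A k x)"
    using x w Suc by (simp add: inv_mult_group m_assoc apow_add)
  ultimately show ?thesis by simp
qed

text \<open>Pigeonhole applied to the cosets of the products \<open>\<beta>\<^sup>-\<^sup>n(x) \<cdots> \<beta>\<^sup>-\<^sup>1(x)\<close>, where \<open>\<beta>\<close> is the power \<open>A L\<close>:
  the quotient of two of them is a power of \<open>\<beta>\<close> applied to a product \<open>x \<beta>(x) \<cdots> \<beta>\<^sup>l(x)\<close>. This takes the place
  of Poincare recurrence.\<close>
lemma walk_recurrent: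
  assumes x: "x \<in> carrier G" and W: "subgroup W G" "openin T W"
  obtains n l :: nat where "n \<ge> 1" "A (- (int n * L)) (walk L x l) \<in> W"
proof -
  define q where "q = rec_nat \<one> (\<lambda>n y. A (- (int (Suc n) * L)) x \<otimes> y)"
  have q0: "q 0 = \<one>" and qS: "q (Suc n) = A (- (int (Suc n) * L)) x \<otimes> q n" for n
    by (simp_all add: q_def)
  have qG: "q n \<in> carrier G" for n by (induction n) (use x in \<open>auto simp: q0 qS\<close>)
  have wG: "walk L x l \<in> carrier G" for l using walk_closed [OF stable_sub_carrier x] .
  \<comment> \<open>The factors of \<open>q (Suc (n + l))\<close> that come before
    \<open>q n\<close> are consecutive powers of \<open>A L\<close> applied to \<open>x\<close>; the
    first of these powers can be pulled out, and a walk remains.\<close>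
  have q: "q (Suc (n + l)) = A (- (int (Suc (n + l)) * L)) (walk L x l) \<otimes> q n" for n l
  proof (induction l)
    case 0
    then show ?case by (simp add: qS)
  next
    case (Suc l)
    have "A (- (int (Suc (n + Suc l)) * L)) (walk L x (Suc l))
        = A (- (int (Suc (n + Suc l)) * L)) x \<otimes> A (- (int (Suc (n + l)) * L)) (walk L x l)"
      using x wG by (simp add: apow_add algebra_simps)
    then have "A (- (int (Suc (n + Suc l)) * L)) (walk L x (Suc l)) \<otimes> q n
        = A (- (int (Suc (n + Suc l)) * L)) x \<otimes> q (Suc (n + l))"
      using x wG qG Suc by (simp add: m_assoc)
    then show ?case using qS [of "Suc (n + l)"] by simp
  qed
  have "\<not> inj (\<lambda>n. W #> q n)"
  proof
    assume "inj (\<lambda>n. W #> q n)"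
    moreover have "finite (range (\<lambda>n. W #> q n))"
      using qG by (intro finite_subset [OF _ finite_cosets_open [OF W]]) auto
    ultimately show False using finite_imageD infinite_UNIV_nat by blast
  qed
  then obtain n n' where "n < n'" "W #> q n' = W #> q n"
    unfolding inj_def by (metis linorder_neqE_nat)
  moreover then obtain l where l: "n' = Suc (n + l)" using less_iff_Suc_add by auto
  ultimately have "q (Suc (n + l)) \<otimes> inv (q n) \<in> W"
    using r_coset_eq_iff [OF W(1) qG qG] by simp
  then have "A (- (int (Suc (n + l)) * L)) (walk L x l) \<in> W"
    unfolding q using wG qG by (simp add: m_assoc)
  then show ?thesis using that [of "Suc (n + l)"] by simp
qed

text \<open>If \<open>x\<close> is trivial at all times \<open>k \<ge> 0\<close>, then a product \<open>x \<beta>(x) \<cdots> \<beta>\<^sup>l(x)\<close> with \<open>\<beta>\<close> a large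
  positive power agrees with \<open>x\<close> from a given negative time onwards; by recurrence it is trivial on some interval
  further left, where it can be cut off to yield a homoclinic point close to \<open>x\<close>. The other half-line is
  treated with a negative power.\<close>
lemma res_subset_nub:
  assumes D: "stable_sub D"
  shows "res D {0..} \<subseteq> nub D" "res D {..<0} \<subseteq> nub D"
proof -
  note S = stable_sub_subgroup [OF D]
  note DG = subgroup.mem_carrier [OF S]
  have HG: "homoclinic D \<subseteq> carrier G" using homoclinic_subset stable_sub_subset [OF D] by blast
  obtain m :: nat where m: "\<And>p q x. p + int m \<le> q \<Longrightarrow> x \<in> res D {p..<q} \<Longrightarrow>
     \<exists>y\<in>res D {..<q}. x \<otimes> inv y \<in> res D {p..}"
    using glue [OF D D] by blast
  let ?W = "res (carrier G) {0..<int m}"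
  have W: "subgroup ?W G" "openin T ?W"
    by (auto intro!: subgroup_res subgroup_self openin_res openin_carrier)
  \<comment> \<open>The walk moves by \<open>- L\<close>, so the trivial window lies at
    \<open>j * L\<close>, while agreement with \<open>x\<close> at time \<open>k\<close> depends on
    the symbols of \<open>x\<close> at the times \<open>k - L\<close>, \<open>k - 2L\<close> and so
    on.\<close>
  have recur: "\<exists>(j::nat) z. j \<ge> 1 \<and> z \<in> res D {int j * L..<int j * L + int m} \<and>
      (\<forall>k. (\<forall>i::nat. A (k - int (Suc i) * L) x \<in> N) \<longrightarrow> A k (x \<otimes> inv z) \<in> N)"
    if x: "x \<in> D" for x L
  proof -
    obtain j l :: nat where j: "j \<ge> 1" "A (- (int j * - L)) (walk (- L) x l) \<in> ?W"
      using walk_recurrent [OF DG [OF x] W, of "- L"] by blast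
    have w: "walk (- L) x l \<in> D" using walk_closed [OF D x] .
    have "A k (walk (- L) x l) \<in> N" if "k \<in> {int j * L..<int j * L + int m}" for k
    proof -
      have "A (k - int j * L) (A (- (int j * - L)) (walk (- L) x l)) \<in> N"
        using j(2) that unfolding mem_res by simp
      then show ?thesis using DG [OF w] by (simp add: apow_add)
    qed
    then have "walk (- L) x l \<in> res D {int j * L..<int j * L + int m}" using w by (simp add: mem_res)
    moreover have "A k (x \<otimes> inv (walk (- L) x l)) \<in> N"
      if "\<forall>i::nat. A (k - int (Suc i) * L) x \<in> N" for k
      using that by (intro walk_agrees DG [OF x]) simp
    ultimately show ?thesis using j(1) by blast
  qed
  show "res D {0..} \<subseteq> nub D"
  proof
    fix x assume x: "x \<in> res D {0..}"
    then have xD: "x \<in> D" and xN: "\<And>k. 0 \<le> k \<Longrightarrow> A k x \<in> N" by (auto simp: mem_res)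
    have "\<exists>s\<in>homoclinic D. x \<otimes> inv s \<in> nb n" for n
    proof -
      \<comment> \<open>Since \<open>x\<close> is trivial from time 0 on,
        \<open>x \<otimes> inv z\<close> is trivial from time \<open>- L\<close> on. As
        \<open>L\<close> is at least \<open>n\<close>, these times include the window of
        \<open>nb n\<close>.\<close>
      define L where "L = int n + int m + 1"
      obtain j z where j: "j \<ge> (1::nat)" and z: "z \<in> res D {int j * - L..<int j * - L + int m}"
        and xz: "\<forall>k. (\<forall>i::nat. A (k - int (Suc i) * - L) x \<in> N) \<longrightarrow> A k (x \<otimes> inv z) \<in> N"
        using recur [OF xD, of "- L"] by blast
      let ?p = "- (int j * L)"
      have jL: "L \<le> int j * L"
        using j mult_right_mono [of 1 "int j" L] by (simp add: L_def)
      obtain y where y: "y \<in> res D {..< ?p + int m}" "z \<otimes> inv y \<in> res D {?p..}"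
        using m [of ?p "?p + int m" z] z by auto
      have c: "x \<in> carrier G" "y \<in> carrier G" "z \<in> carrier G" using xD y z DG by (auto simp: mem_res)
      have xy: "A k (x \<otimes> inv y) \<in> N" if "- L \<le> k" for k
      proof -
        have "A k (x \<otimes> inv z) \<in> N"
        proof (intro xz [rule_format] xN)
          fix i :: nat
          have "L \<le> int (Suc i) * L" by (simp add: L_def)
          then show "0 \<le> k - int (Suc i) * - L" using that by (simp add: algebra_simps)
        qed
        moreover have "A k (z \<otimes> inv y) \<in> N" using y(2) jL that by (simp add: mem_res)
        ultimately have "A k (x \<otimes> inv z) \<otimes> A k (z \<otimes> inv y) \<in> N" by (rule N_m_closed)
        then show ?thesis using c by (simp add: m_assoc)
      qed
      have "y \<in> homoclinic D"
      proof (rule homoclinicI [where M = "int j * L + 1"])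
        show "y \<in> D" using y by (simp add: mem_res)
        fix k assume k: "int j * L + 1 \<le> \<bar>k\<bar>"
        show "A k y \<in> N"
        proof (cases "0 \<le> k")
          case True
          then have "A k x \<in> N" "A k (x \<otimes> inv y) \<in> N" using xN xy by (auto simp: L_def)
          then have "inv (A k (x \<otimes> inv y)) \<otimes> A k x \<in> N" by (intro N_m_closed N_inv_closed)
          then show ?thesis using c by (simp add: inv_mult_group m_assoc)
        next
          case False
          then have "k < ?p + int m" using k by linarith
          then show ?thesis using y by (simp add: mem_res)
        qed
      qed
      moreover have "x \<otimes> inv y \<in> nb n" using xy c by (auto simp: mem_nb L_def)
      ultimately show ?thesis by blast
    qed
    then show "x \<in> nub D" unfolding nub_def closure_iff [OF HG] using DG xD by blast
  qed
  show "res D {..<0} \<subseteq> nub D"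
  proof
    fix x assume x: "x \<in> res D {..<0}"
    then have xD: "x \<in> D" and xN: "\<And>k. k < 0 \<Longrightarrow> A k x \<in> N" by (auto simp: mem_res)
    have "\<exists>s\<in>homoclinic D. x \<otimes> inv s \<in> nb n" for n
    proof -
      \<comment> \<open>Here \<open>x \<otimes> inv z\<close> is trivial at all times below
        \<open>L\<close>, a strict bound; \<open>n < L\<close> puts the window of
        \<open>nb n\<close> among these times.\<close>
      define L where "L = int n + 1"
      obtain j z where j: "j \<ge> (1::nat)" and z: "z \<in> res D {int j * L..<int j * L + int m}"
        and xz: "\<forall>k. (\<forall>i::nat. A (k - int (Suc i) * L) x \<in> N) \<longrightarrow> A k (x \<otimes> inv z) \<in> N"
        using recur [OF xD, of L] by blast
      let ?p = "int j * L"
      have jL: "L \<le> int j * L"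
        using j mult_right_mono [of 1 "int j" L] by (simp add: L_def)
      obtain y where y: "y \<in> res D {..< ?p + int m}" "z \<otimes> inv y \<in> res D {?p..}"
        using m [of ?p "?p + int m" z] z by auto
      have c: "x \<in> carrier G" "y \<in> carrier G" "z \<in> carrier G" using xD y z DG by (auto simp: mem_res)
      \<comment> \<open>Of the two parts of \<open>z\<close> the other one is kept: \<open>y\<close>
        is trivial before the window, so \<open>?u\<close> agrees with \<open>z\<close> there, and
        \<open>?u\<close> is trivial from \<open>?p\<close> on.\<close>
      let ?u = "z \<otimes> inv y"
      have xu: "A k (x \<otimes> inv ?u) \<in> N" if "k < L" for k
      proof -
        have "A k (x \<otimes> inv z) \<in> N"
        proof (intro xz [rule_format] xN)
          fix i :: nat
          have "L \<le> int (Suc i) * L" by (simp add: L_def)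
          then show "k - int (Suc i) * L < 0" using that by linarith
        qed
        moreover have "A k y \<in> N" using y(1) jL that by (simp add: mem_res)
        then have "A k z \<otimes> A k y \<otimes> inv (A k z) \<in> N" using c by (intro N_conj) auto
        ultimately have "A k (x \<otimes> inv z) \<otimes> (A k z \<otimes> A k y \<otimes> inv (A k z)) \<in> N" by (rule N_m_closed)
        then show ?thesis using c by (simp add: m_assoc inv_mult_group)
      qed
      have "?u \<in> homoclinic D"
      proof (rule homoclinicI [where M = "?p"])
        show "?u \<in> D" using y by (simp add: mem_res)
        fix k assume k: "?p \<le> \<bar>k\<bar>"
        show "A k ?u \<in> N"
        proof (cases "0 \<le> k")
          case False
          then have "A k x \<in> N" "A k (x \<otimes> inv ?u) \<in> N" using xN xu by (auto simp: L_def)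
          then have "inv (A k (x \<otimes> inv ?u)) \<otimes> A k x \<in> N" by (intro N_m_closed N_inv_closed)
          then show ?thesis using c by (simp add: inv_mult_group m_assoc)
        next
          case True
          then show ?thesis using y k by (simp add: mem_res)
        qed
      qed
      moreover have "x \<otimes> inv ?u \<in> nb n" using xu c by (auto simp: mem_nb L_def)
      ultimately show ?thesis by blast
    qed
    then show "x \<in> nub D" unfolding nub_def closure_iff [OF HG] using DG xD by blast
  qed
qed

text \<open>By \<open>glue\<close>, an element of \<open>D\<close> that is trivial on a window of
  length \<open>m\<close> is a product of two elements, each trivial on a half-line. Both lie in
  \<open>nub D\<close> by \<open>res_subset_nub\<close>, so \<open>nub D\<close> contains the
  intersection of \<open>D\<close> with an open subgroup of \<open>G\<close>.\<close>

lemma fin_index_nub: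
  assumes D: "stable_sub D" shows "fin_index (nub D) D"
proof -
  note S = stable_sub_subgroup [OF D]
  note DG = subgroup.mem_carrier [OF S]
  note nubD = stable_sub_nub [OF D]
  obtain m :: nat where m: "\<And>p q x. p + int m \<le> q \<Longrightarrow> x \<in> res D {p..<q} \<Longrightarrow>
     \<exists>y\<in>res D {..<q}. x \<otimes> inv y \<in> res D {p..}"
    using glue [OF D D] by blast
  have sub: "x \<in> nub D" if x: "x \<in> res D {0..<int m}" for x
  proof -
    obtain y where y: "y \<in> res D {..<int m}" "x \<otimes> inv y \<in> res D {0..}"
      using m [of 0 "int m" x] x by auto
    then have yD: "y \<in> D" by (simp add: mem_res)
    \<comment> \<open>\<open>res_subset_nub\<close> speaks of half-lines ending at time 0, so
      \<open>y\<close> is shifted there and back.\<close>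
    have "A (int m) y \<in> res D {..<0}"
      using y(1) apow_mem_res [OF D yD] by (simp add: mem_res)
    then have "A (- int m) (A (int m) y) \<in> nub D"
      by (rule stable_sub_apow [OF nubD subsetD [OF res_subset_nub(2) [OF D]]])
    then have "y \<in> nub D" using DG [OF yD] by (simp add: apow_add)
    moreover have "x \<otimes> inv y \<in> nub D" using y res_subset_nub [OF D] by blast
    ultimately have "x \<otimes> inv y \<otimes> y \<in> nub D"
      using subgroup.m_closed [OF stable_sub_subgroup [OF nubD]] by blast
    then show ?thesis using x DG [OF yD] DG [of x] by (simp add: m_assoc mem_res)
  qed
  let ?W = "res (carrier G) {0..<int m}"
  have W: "subgroup ?W G" "openin T ?W"
    by (auto intro!: subgroup_res subgroup_self openin_res openin_carrier)
  have "finite ((\<lambda>x. nub D #> x) ` D)"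
  proof (rule finite_image_factor)
    show "finite ((\<lambda>x. ?W #> x) ` D)"
      using DG by (intro finite_subset [OF _ finite_cosets_open [OF W]]) auto
    fix x y assume xy: "x \<in> D" "y \<in> D" "?W #> x = ?W #> y"
    then have "x \<otimes> inv y \<in> ?W" using r_coset_eq_iff [OF W(1)] DG by simp
    moreover have "x \<otimes> inv y \<in> D"
      using xy subgroup.m_closed [OF S] subgroup.m_inv_closed [OF S] by blast
    ultimately have "x \<otimes> inv y \<in> nub D" by (intro sub) (auto simp: mem_res)
    then show "nub D #> x = nub D #> y"
      using r_coset_eq_iff [OF stable_sub_subgroup [OF nubD]] DG xy by simp
  qed
  then show ?thesis by (simp add: fin_index_def)
qed

text \<open>For homoclinic \<open>s\<close>, the points of \<open>nub D\<close> whose orbit comes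
  close to \<open>s\<close> form an open set. It is dense, because a far shift of \<open>s\<close>
  can be multiplied onto any homoclinic \<open>t\<close> without changing \<open>t\<close> near time
  0. A point in the intersection of countably many such sets has a dense orbit.\<close>

lemma trans_nub:
  assumes D: "stable_sub D" shows "trans (nub D)"
proof -
  let ?H = "nub D"
  note S = stable_sub_subgroup [OF D]
  note H = stable_sub_nub [OF D]
  note HG = subgroup.mem_carrier [OF stable_sub_subgroup [OF H]]
  have ZG: "homoclinic D \<subseteq> carrier G" using homoclinic_subset stable_sub_subset [OF D] by blast
  have ZH: "homoclinic D \<subseteq> ?H" by (rule homoclinic_subset_nub [OF D])
  \<comment> \<open>For each \<open>n\<close> only finitely many targets are kept, one homoclinic
    representative per coset of \<open>nb n\<close>. This makes the family for Baire's theorem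
    countable without counting the homoclinic points.\<close>
  define c where "c n C = (SOME s. s \<in> homoclinic D \<and> nb n #> s = C)" for n C
  have c: "c n (nb n #> s) \<in> homoclinic D \<and> nb n #> c n (nb n #> s) = nb n #> s"
    if "s \<in> homoclinic D" for n s
    unfolding c_def by (rule someI [of _ s]) (simp add: that)
  let ?I = "\<lambda>n. (\<lambda>s. c n (nb n #> s)) ` homoclinic D"
  have finI: "finite (?I n)" for n
  proof (rule finite_image_factor)
    show "finite ((\<lambda>s. nb n #> s) ` homoclinic D)"
      using ZG by (intro finite_subset [OF _ finite_cosets_open [OF nb_subgroup nb_open]]) auto
  qed simp
  let ?U = "\<lambda>n s. ?H \<inter> (\<Union>k. {x \<in> carrier G. A k x \<otimes> inv s \<in> nb n})"
  let ?F = "\<Union>n. ?U n ` ?I n"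
  let ?X = "subtopology T ?H"
  have topX: "topspace ?X = ?H" using HG by (auto simp: topspace_subtopology)
  have IZ: "s \<in> homoclinic D" if "s \<in> ?I n" for n s using c that by blast
  have dense: "?X closure_of \<Inter>?F = topspace ?X"
  proof (rule Baire_category)
    have "compact_space ?X"
      using closedin_imp_compactin [OF stable_sub_closed [OF H]] by (simp add: compact_space_subtopology)
    moreover have "Hausdorff_space ?X" using Hausdorff by (rule Hausdorff_space_subtopology)
    ultimately show "completely_metrizable_space ?X \<or> locally_compact_space ?X \<and> regular_space ?X"
      by (simp add: compact_imp_locally_compact_space compact_Hausdorff_imp_regular_space)
    show "countable ?F"
      using finI by (intro countable_UN countable_image countable_finite countableI_type)
    fix U assume "U \<in> ?F"
    then obtain n s where s: "s \<in> homoclinic D" and U: "U = ?U n s" using IZ by blast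
    have sG: "s \<in> carrier G" using s ZG by blast
    show "openin ?X U \<and> ?X closure_of U = topspace ?X"
    proof
      have "openin T (\<Union>k. {x \<in> carrier G. A k x \<otimes> inv s \<in> nb n})"
        using sG nb_open by (intro openin_Union) (auto intro!: openin_preimage continuous_mult continuous_const continuous_apow)
      then show "openin ?X U"
        unfolding U by (simp add: openin_subtopology_Int2)
      have "h \<in> T closure_of U" if h: "h \<in> ?H" for h
      proof -
        have "\<exists>y\<in>U. h \<otimes> inv y \<in> nb j" for j
        proof -
          obtain t where t: "t \<in> homoclinic D" "h \<otimes> inv t \<in> nb j"
            using h unfolding nub_def closure_iff [OF ZG] by blast
          have tG: "t \<in> carrier G" using t ZG by blast
          obtain Ms where Ms: "\<And>k. Ms \<le> \<bar>k\<bar> \<Longrightarrow> A k s \<in> N" using s by (auto simp: homoclinic_def)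
          obtain Mt where Mt: "\<And>k. Mt \<le> \<bar>k\<bar> \<Longrightarrow> A k t \<in> N" using t by (auto simp: homoclinic_def)
          \<comment> \<open>for large \<open>k\<close>, the product \<open>A (- k) s \<otimes> t\<close> is close to \<open>t\<close>, and its image under \<open>A k\<close> is close to \<open>s\<close>\<close>
          define k where "k = int n + int j + \<bar>Ms\<bar> + \<bar>Mt\<bar>"
          let ?y = "A (- k) s \<otimes> t"
          have "A (- k) s \<in> homoclinic D" using homoclinic_apow [OF D s] .
          then have yZ: "?y \<in> homoclinic D"
            using t subgroup.m_closed [OF subgroup_homoclinic [OF D]] by blast
          have "A k t \<in> nb n"
            using tG Mt by (auto simp: mem_nb apow_add k_def)
          then have "s \<otimes> A k t \<otimes> inv s \<in> nb n" using sG by (intro nb_conj)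
          then have "A k ?y \<otimes> inv s \<in> nb n" using sG tG by (simp add: apow_add)
          then have "?y \<in> U" unfolding U using yZ ZH ZG by blast
          moreover have "A (- k) s \<in> nb j"
            using sG Ms by (auto simp: mem_nb apow_add k_def)
          then have "(h \<otimes> inv t) \<otimes> inv (A (- k) s) \<in> nb j"
            by (rule nb_m_closed [OF t(2) nb_inv_closed])
          then have "h \<otimes> inv ?y \<in> nb j" using tG sG HG [OF h] by (simp add: inv_mult_group m_assoc)
          ultimately show ?thesis by blast
        qed
        moreover have "U \<subseteq> carrier G" unfolding U by blast
        ultimately show ?thesis using closure_iff [of U h] HG [OF h] by blast
      qed
      moreover have "U \<subseteq> ?H" unfolding U by blast
      ultimately show "?X closure_of U = topspace ?X"
        unfolding topX by (auto simp: closure_of_subtopology Int_absorb1)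
    qed
  qed
  have "\<Inter>?F \<noteq> {}"
  proof
    assume "\<Inter>?F = {}"
    then have "?H = {}" using dense unfolding topX by (simp only: closure_of_empty)
    then show False using subgroup.one_closed [OF stable_sub_subgroup [OF H]] by simp
  qed
  then obtain x where xF: "x \<in> \<Inter>?F" by (auto simp only: ex_in_conv [symmetric])
  have x: "x \<in> ?U n s" if "s \<in> ?I n" for n s
    by (rule InterD [OF xF]) (use that in blast)
  have "\<one> \<in> homoclinic D" using subgroup.one_closed [OF subgroup_homoclinic [OF D]] .
  \<comment> \<open>Any member of the family would show that \<open>x\<close> lies in
    \<open>?H\<close>; index 0 and the coset of the identity provide one.\<close>
  then have xH: "x \<in> ?H" using x [of "c 0 (nb 0 #> \<one>)" 0] by blast
  have "T closure_of (range (\<lambda>k. A k x)) = ?H"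
  proof
    show "T closure_of (range (\<lambda>k. A k x)) \<subseteq> ?H"
      using stable_sub_apow [OF H xH] stable_sub_closed [OF H] by (intro closure_of_minimal) auto
    show "?H \<subseteq> T closure_of (range (\<lambda>k. A k x))"
    proof
      fix h assume h: "h \<in> ?H"
      have "\<exists>y\<in>range (\<lambda>k. A k x). h \<otimes> inv y \<in> nb n" for n
      proof -
        obtain t where t: "t \<in> homoclinic D" "h \<otimes> inv t \<in> nb n"
          using h unfolding nub_def closure_iff [OF ZG] by blast
        let ?s = "c n (nb n #> t)"
        have s: "?s \<in> homoclinic D" "nb n #> ?s = nb n #> t" using c [OF t(1)] by auto
        have cc: "t \<in> carrier G" "?s \<in> carrier G" "h \<in> carrier G" "x \<in> carrier G"
          using t s ZG HG [OF h] HG [OF xH] by auto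
        obtain k where k: "A k x \<otimes> inv ?s \<in> nb n" using x [of ?s n] t by blast
        have ts: "t \<otimes> inv ?s \<in> nb n" using s r_coset_eq_iff [OF nb_subgroup] cc by metis
        have "(h \<otimes> inv t) \<otimes> (t \<otimes> inv ?s) \<otimes> inv (A k x \<otimes> inv ?s) \<in> nb n"
          by (rule nb_m_closed [OF nb_m_closed [OF t(2) ts] nb_inv_closed [OF k]])
        then have "h \<otimes> inv (A k x) \<in> nb n" using cc by (simp add: inv_mult_group m_assoc)
        then show ?thesis by blast
      qed
      moreover have "range (\<lambda>k. A k x) \<subseteq> carrier G" using HG [OF xH] by auto
      ultimately show "h \<in> T closure_of (range (\<lambda>k. A k x))"
        using closure_iff HG [OF h] by blast
    qed
  qed
  then show ?thesis unfolding trans_def using xH by blast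
qed

text \<open>No inclusion of \<open>K\<close> in \<open>H\<close> is presupposed, so this turns mere
  commensurability into containment. A point of dense orbit outside \<open>K\<close> would keep its
  orbit in the finitely many cosets \<open>K #> h\<close> with \<open>h\<close> in
  \<open>H - K\<close>, a closed union that misses the identity.\<close>

lemma trans_subset_of_fin_index:
  assumes H: "stable_sub H" and K: "stable_sub K" and tr: "trans H" and fin_index: "fin_index K H"
  shows "H \<subseteq> K"
proof -
  note HG = subgroup.mem_carrier [OF stable_sub_subgroup [OF H]]
  obtain x where x: "x \<in> H" and cl: "T closure_of (range (\<lambda>k. A k x)) = H"
    using tr by (auto simp: trans_def)
  have "x \<in> K"
  proof (rule ccontr)
    assume xK: "x \<notin> K"
    let ?F = "\<Union>((\<lambda>h. K #> h) ` (H - K))"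
    have "closedin T ?F"
    proof (rule closedin_Union)
      show "finite ((\<lambda>h. K #> h) ` (H - K))"
        using fin_index unfolding fin_index_def by (rule rev_finite_subset) auto
      show "\<And>S. S \<in> (\<lambda>h. K #> h) ` (H - K) \<Longrightarrow> closedin T S"
        using closedin_r_coset [OF stable_sub_closed [OF K]] HG by blast
    qed
    moreover have "range (\<lambda>k. A k x) \<subseteq> ?F"
    proof clarify
      fix k
      have "A k x \<notin> K"
      proof
        assume "A k x \<in> K"
        then have "A (- k) (A k x) \<in> K" using stable_sub_apow [OF K] by blast
        then show False using xK HG [OF x] by (simp add: apow_add)
      qed
      then have "A k x \<in> H - K" using stable_sub_apow [OF H x] by simp
      moreover have "A k x \<in> K #> A k x" using HG [OF x] rcos_self [OF _ stable_sub_subgroup [OF K]] by simp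
      ultimately show "A k x \<in> ?F" by blast
    qed
    ultimately have "H \<subseteq> ?F" using cl closure_of_minimal by metis
    then have "\<one> \<in> ?F" using subgroup.one_closed [OF stable_sub_subgroup [OF H]] by blast
    then obtain h where h: "h \<in> H" "h \<notin> K" "\<one> \<in> K #> h" by blast
    have "K #> h = K #> \<one>" using repr_independence [OF h(3) HG [OF h(1)] stable_sub_subgroup [OF K]] .
    then have "h \<otimes> inv \<one> \<in> K" using r_coset_eq_iff [OF stable_sub_subgroup [OF K]] HG [OF h(1)] by simp
    then show False using h HG by simp
  qed
  then have "range (\<lambda>k. A k x) \<subseteq> K" using stable_sub_apow [OF K] by blast
  then show ?thesis using cl closure_of_minimal stable_sub_closed [OF K] by metis
qed

definition trans_sub :: "'a set \<Rightarrow> bool" where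
  "trans_sub H \<longleftrightarrow> stable_sub H \<and> trans H"

lemma trans_sub_stable_sub: "trans_sub H \<Longrightarrow> stable_sub H" and trans_sub_trans: "trans_sub H \<Longrightarrow> trans H"
  by (simp_all add: trans_sub_def)

lemma trans_sub_nub: "stable_sub D \<Longrightarrow> trans_sub (nub D)"
  by (simp add: trans_sub_def stable_sub_nub trans_nub)

lemma trans_sub_eq_of_fin_index: "trans_sub H \<Longrightarrow> stable_sub K \<Longrightarrow> K \<subseteq> H \<Longrightarrow> fin_index K H \<Longrightarrow> K = H"
  using trans_subset_of_fin_index by (auto simp: trans_sub_def)

lemma card_followers_less:
  assumes H: "trans_sub H" and K: "stable_sub K" and KH: "K \<subset> H"
  shows "card (followers K) < card (followers H)"
proof (rule psubset_card_mono)
  show "finite (followers H)" using H by (intro finite_followers trans_sub_stable_sub)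
  have "followers K \<subseteq> followers H" using KH by (intro followers_mono) auto
  moreover have "\<not> followers H \<subseteq> followers K"
    using fin_index_of_followers [OF K trans_sub_stable_sub [OF H]] trans_sub_eq_of_fin_index [OF H K] KH by blast
  ultimately show "followers K \<subset> followers H" by blast
qed

section \<open>The Jordan-Hoelder argument\<close>

text \<open>Written out on elements, so that the inductions need no group with a restricted carrier;
  \<open>normal_in_iff_normal\<close> connects it with normal subgroups.\<close>

definition normal_in :: "'a set \<Rightarrow> 'a set \<Rightarrow> bool" where
  "normal_in K H \<longleftrightarrow> K \<subseteq> H \<and> (\<forall>h\<in>H. \<forall>x\<in>K. h \<otimes> x \<otimes> inv h \<in> K)"

lemma normal_in_subset: "normal_in K H \<Longrightarrow> K \<subseteq> H"
  and normal_in_conj: "normal_in K H \<Longrightarrow> h \<in> H \<Longrightarrow> x \<in> K \<Longrightarrow> h \<otimes> x \<otimes> inv h \<in> K"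
  by (auto simp: normal_in_def)

text \<open>With \<open>r\<close> the chosen representative of \<open>L #> x\<close>, write
  \<open>x\<close> as \<open>(x \<otimes> inv r) \<otimes> r\<close>. The first factor lies in
  \<open>L\<close>, so \<open>K #> x\<close> is determined by its coset of \<open>K\<close> and by
  \<open>L #> x\<close>.\<close>

lemma fin_index_trans:
  assumes K: "subgroup K G" and L: "subgroup L G" and M: "M \<subseteq> carrier G"
    and KL: "fin_index K L" and LM: "fin_index L M"
  shows "fin_index K M"
proof -
  define r where "r C = (SOME x. x \<in> M \<and> L #> x = C)" for C
  have r: "r (L #> x) \<in> M \<and> L #> r (L #> x) = L #> x" if "x \<in> M" for x
    unfolding r_def by (rule someI [of _ x]) (simp add: that)
  note KG = subgroup.subset [OF K] and LG = subgroup.mem_carrier [OF L]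
  have "(\<lambda>x. K #> x) ` M \<subseteq> (\<lambda>(C, D). C #> r D) ` ((\<lambda>x. K #> x) ` L \<times> (\<lambda>x. L #> x) ` M)"
  proof clarify
    fix x assume x: "x \<in> M"
    have xG: "x \<in> carrier G" and rG: "r (L #> x) \<in> carrier G" using r [OF x] x M by auto
    have "x \<otimes> inv (r (L #> x)) \<in> L"
      using r [OF x] r_coset_eq_iff [OF L xG rG] by simp
    moreover have "K #> x = (K #> (x \<otimes> inv (r (L #> x)))) #> r (L #> x)"
      using xG rG KG by (simp add: coset_mult_assoc m_assoc)
    ultimately show "K #> x \<in> (\<lambda>(C, D). C #> r D) ` ((\<lambda>x. K #> x) ` L \<times> (\<lambda>x. L #> x) ` M)"
      using x by (intro image_eqI [of _ _ "(K #> (x \<otimes> inv (r (L #> x))), L #> x)"]) auto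
  qed
  then show ?thesis
    using KL LM unfolding fin_index_def by (meson finite_SigmaI finite_surj)
qed

lemma fin_index_mono: "fin_index K L \<Longrightarrow> M \<subseteq> L \<Longrightarrow> fin_index K M"
  unfolding fin_index_def by (meson finite_subset image_mono)

lemma fin_index_larger:
  assumes "subgroup K G" "subgroup K' G" "K \<subseteq> K'" "L \<subseteq> carrier G" "fin_index K L"
  shows "fin_index K' L"
  using assms(5) unfolding fin_index_def
proof (rule finite_image_factor)
  fix x y assume xy: "x \<in> L" "y \<in> L" "K #> x = K #> y"
  then have "x \<in> carrier G" "y \<in> carrier G" using assms by auto
  then show "K' #> x = K' #> y" using xy(3) assms r_coset_eq_iff by blast
qed

lemma fin_index_Int:
  assumes "subgroup K G" "subgroup H G" "fin_index K H"
  shows "fin_index (K \<inter> H) H"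
  using assms(3) unfolding fin_index_def
proof (rule finite_image_factor)
  fix x y assume xy: "x \<in> H" "y \<in> H" "K #> x = K #> y"
  then have c: "x \<in> carrier G" "y \<in> carrier G" using assms subgroup.mem_carrier by metis+
  have "x \<otimes> inv y \<in> K" using xy(3) r_coset_eq_iff [OF assms(1) c] by simp
  moreover have "x \<otimes> inv y \<in> H"
    using xy subgroup.m_closed [OF assms(2)] subgroup.m_inv_closed [OF assms(2)] by blast
  ultimately show "(K \<inter> H) #> x = (K \<inter> H) #> y"
    using r_coset_eq_iff [OF subgroups_Inter_pair [OF assms(1,2)] c] by simp
qed

lemma fin_index_refl:
  assumes "subgroup K G" shows "fin_index K K"
proof -
  have "(\<lambda>x. K #> x) ` K \<subseteq> {K}"
    using coset_join2 [OF subgroup.mem_carrier [OF assms] assms] by auto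
  then show ?thesis unfolding fin_index_def by (rule finite_subset) simp
qed

lemma fin_index_set_mult:
  assumes B: "subgroup B G" and P: "P \<subseteq> carrier G" and fin_index: "fin_index B P"
  shows "fin_index B (B <#> P)"
proof -
  have "(\<lambda>x. B #> x) ` (B <#> P) \<subseteq> (\<lambda>x. B #> x) ` P"
  proof clarify
    fix x assume "x \<in> B <#> P"
    then obtain b y where yb: "b \<in> B" "y \<in> P" "x = b \<otimes> y" by (auto simp: set_mult_def)
    then have c: "b \<in> carrier G" "y \<in> carrier G" using P subgroup.mem_carrier [OF B] by auto
    then have "x \<otimes> inv y = b" using yb by (simp add: m_assoc)
    then have "B #> x = B #> y" using r_coset_eq_iff [OF B _ c(2), of x] yb c by simp
    then show "B #> x \<in> (\<lambda>x. B #> x) ` P" using yb by blast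
  qed
  then show ?thesis using fin_index unfolding fin_index_def by (rule finite_subset)
qed

lemma set_mult_upper:
  assumes "subgroup H G" "subgroup K G" shows "H \<subseteq> H <#> K" "K \<subseteq> H <#> K"
proof -
  show "H \<subseteq> H <#> K"
  proof
    fix x assume x: "x \<in> H"
    then have "x = x \<otimes> \<one>" using subgroup.mem_carrier [OF assms(1)] by simp
    then show "x \<in> H <#> K" unfolding set_mult_def using x subgroup.one_closed [OF assms(2)] by blast
  qed
  show "K \<subseteq> H <#> K"
  proof
    fix x assume x: "x \<in> K"
    then have "x = \<one> \<otimes> x" using subgroup.mem_carrier [OF assms(2)] by simp
    then show "x \<in> H <#> K" unfolding set_mult_def using x subgroup.one_closed [OF assms(1)] by blast
  qed
qed

section \<open>Intersections and products of stable and of normal subgroups\<close>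

lemma stable_sub_Int:
  assumes "stable_sub H" "stable_sub K" shows "stable_sub (H \<inter> K)"
  using assms stable_sub_apow [OF assms(1)] stable_sub_apow [OF assms(2)]
  by (intro stable_subI subgroups_Inter_pair closedin_Int) (auto simp: stable_sub_subgroup stable_sub_closed)

lemma stable_sub_set_mult:
  assumes H: "stable_sub H" and K: "stable_sub K" and conj: "\<And>h x. h \<in> H \<Longrightarrow> x \<in> K \<Longrightarrow> h \<otimes> x \<otimes> inv h \<in> K"
  shows "stable_sub (K <#> H)"
proof (rule stable_subI)
  note HG = subgroup.mem_carrier [OF stable_sub_subgroup [OF H]]
    and KG = subgroup.mem_carrier [OF stable_sub_subgroup [OF K]]
  note Hm = subgroup.m_closed [OF stable_sub_subgroup [OF H]] subgroup.m_inv_closed [OF stable_sub_subgroup [OF H]]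
    and Km = subgroup.m_closed [OF stable_sub_subgroup [OF K]] subgroup.m_inv_closed [OF stable_sub_subgroup [OF K]]
  have mem: "z \<in> K <#> H \<longleftrightarrow> (\<exists>k\<in>K. \<exists>h\<in>H. z = k \<otimes> h)" for z by (simp add: set_mult_def)
  show "closedin T (K <#> H)" by (rule closedin_set_mult [OF stable_sub_closed [OF K] stable_sub_closed [OF H]])
  show "A j z \<in> K <#> H" if zm: "z \<in> K <#> H" for j z
  proof -
    obtain k h where z: "k \<in> K" "h \<in> H" "z = k \<otimes> h" using zm unfolding mem by blast
    then have "A j z = A j k \<otimes> A j h" using HG KG by simp
    then show ?thesis unfolding mem using stable_sub_apow [OF H z(2)] stable_sub_apow [OF K z(1)] by blast
  qed
  show "subgroup (K <#> H) G"
  proof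
    show "K <#> H \<subseteq> carrier G" using HG KG by (auto simp: set_mult_def)
    show "\<one> \<in> K <#> H"
      using subgroup.one_closed [OF stable_sub_subgroup [OF H]] subgroup.one_closed [OF stable_sub_subgroup [OF K]]
      unfolding mem by (metis l_one one_closed)
    fix x assume "x \<in> K <#> H"
    then obtain k h where x: "k \<in> K" "h \<in> H" "x = k \<otimes> h" unfolding mem by blast
    have "inv x = (inv h \<otimes> inv k \<otimes> inv (inv h)) \<otimes> inv h"
      using x HG KG by (simp add: inv_mult_group m_assoc)
    moreover have "inv h \<otimes> inv k \<otimes> inv (inv h) \<in> K" by (rule conj [OF Hm(2) [OF x(2)] Km(2) [OF x(1)]])
    ultimately show "inv x \<in> K <#> H" unfolding mem using Hm(2) [OF x(2)] by blast
    fix y assume "y \<in> K <#> H"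
    then obtain k' h' where y: "k' \<in> K" "h' \<in> H" "y = k' \<otimes> h'" unfolding mem by blast
    have "x \<otimes> y = (k \<otimes> (h \<otimes> k' \<otimes> inv h)) \<otimes> (h \<otimes> h')"
      using x y HG KG by (simp add: m_assoc)
    moreover have "k \<otimes> (h \<otimes> k' \<otimes> inv h) \<in> K" by (rule Km(1) [OF x(1) conj [OF x(2) y(1)]])
    ultimately show "x \<otimes> y \<in> K <#> H" unfolding mem using Hm(1) [OF x(2) y(2)] by blast
  qed
qed

lemma normal_in_set_mult:
  assumes P: "normal_in P H" and B: "normal_in B H" and H: "stable_sub H"
  shows "normal_in (P <#> B) H"
  unfolding normal_in_def
proof (intro conjI ballI)
  note HG = subgroup.mem_carrier [OF stable_sub_subgroup [OF H]]
  show "P <#> B \<subseteq> H"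
    using normal_in_subset [OF P] normal_in_subset [OF B] subgroup.m_closed [OF stable_sub_subgroup [OF H]]
    by (auto simp: set_mult_def subset_iff)
  fix h x assume h: "h \<in> H" and "x \<in> P <#> B"
  then obtain y z where x: "y \<in> P" "z \<in> B" "x = y \<otimes> z" by (auto simp: set_mult_def)
  then have "y \<in> H" "z \<in> H" using normal_in_subset [OF P] normal_in_subset [OF B] by auto
  then have "h \<otimes> x \<otimes> inv h = (h \<otimes> y \<otimes> inv h) \<otimes> (h \<otimes> z \<otimes> inv h)"
    using x h HG by (simp add: m_assoc)
  then show "h \<otimes> x \<otimes> inv h \<in> P <#> B"
    using normal_in_conj [OF P h x(1)] normal_in_conj [OF B h x(2)] by (auto simp: set_mult_def)
qed

lemma normal_in_nub:
  assumes H: "stable_sub H" and K: "stable_sub K" and n: "normal_in K H" shows "normal_in (nub K) H"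
  using normal_in_subset [OF n] nub_subset [OF K] nub_conj [OF _ K normal_in_conj [OF n]] stable_sub_subset [OF H]
  by (auto simp: normal_in_def subset_iff)

lemma normal_in_Int: "normal_in P H \<Longrightarrow> normal_in B H \<Longrightarrow> normal_in (P \<inter> B) H"
  by (auto simp: normal_in_def)

lemma normal_in_within: "normal_in P H \<Longrightarrow> P \<subseteq> K \<Longrightarrow> K \<subseteq> H \<Longrightarrow> normal_in P K"
  by (auto simp: normal_in_def)

text \<open>Irreducibility of \<open>H/K\<close> expressed in \<open>G\<close>: the subgroups of the
  quotient correspond to the \<open>M\<close> between \<open>K\<close> and \<open>H\<close>, and
  \<open>fin_index K M\<close> says that \<open>M/K\<close> is finite.\<close>

definition irred :: "'a set \<Rightarrow> 'a set \<Rightarrow> bool" where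
  "irred H K \<longleftrightarrow> \<not> fin_index K H \<and> (\<forall>M. stable_sub M \<and> K \<subseteq> M \<and> normal_in M H \<and> M \<noteq> H \<longrightarrow> fin_index K M)"

lemma irred_fin_index: "irred H K \<Longrightarrow> stable_sub M \<Longrightarrow> K \<subseteq> M \<Longrightarrow> normal_in M H \<Longrightarrow> M \<noteq> H \<Longrightarrow> fin_index K M"
  and irred_not_fin_index: "irred H K \<Longrightarrow> \<not> fin_index K H"
  by (auto simp: irred_def)

text \<open>Co-commensurability of \<open>P/Q\<close> and \<open>P'/Q'\<close>, with the witness given as a relation lifted to \<open>G \<times> G\<close>; transitivity
  is then composition of relations.\<close>
fun commens :: "'a set \<times> 'a set \<Rightarrow> 'a set \<times> 'a set \<Rightarrow> bool" where
  "commens (P, Q) (P', Q') \<longleftrightarrow> (\<exists>R. subgroup R (G \<times>\<times> G) \<and> closedin (prod_topology T T) R \<and>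
     (\<forall>x y k. (x, y) \<in> R \<longrightarrow> (A k x, A k y) \<in> R) \<and> fst ` R = P \<and> snd ` R = P' \<and> Q \<times> Q' \<subseteq> R \<and>
     fin_index Q {x. \<exists>y\<in>Q'. (x, y) \<in> R} \<and> fin_index Q' {y. \<exists>x\<in>Q. (x, y) \<in> R})"

section \<open>Closed stable relations as witnesses of co-commensurability\<close>

lemma subgroup_DirProd_iff:
  "subgroup R (G \<times>\<times> G) \<longleftrightarrow> R \<subseteq> carrier G \<times> carrier G \<and> (\<one>, \<one>) \<in> R \<and>
     (\<forall>x y x' y'. (x, y) \<in> R \<longrightarrow> (x', y') \<in> R \<longrightarrow> (x \<otimes> x', y \<otimes> y') \<in> R) \<and>
     (\<forall>x y. (x, y) \<in> R \<longrightarrow> (inv x, inv y) \<in> R)"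
  (is "_ \<longleftrightarrow> ?R")
proof
  assume R: "subgroup R (G \<times>\<times> G)"
  note sub = subgroup.subset [OF R, unfolded carrier_DirProd]
  show ?R
  proof (intro conjI allI impI)
    show "R \<subseteq> carrier G \<times> carrier G" by (rule sub)
    show "(\<one>, \<one>) \<in> R" using subgroup.one_closed [OF R] by simp
    show "(x \<otimes> x', y \<otimes> y') \<in> R" if "(x, y) \<in> R" "(x', y') \<in> R" for x y x' y'
      using subgroup.m_closed [OF R that] by simp
    show "(inv x, inv y) \<in> R" if "(x, y) \<in> R" for x y
      using subgroup.m_inv_closed [OF R that] inv_DirProd [OF is_group is_group, of x y] sub that by auto
  qed
next
  assume R: ?R
  show "subgroup R (G \<times>\<times> G)"
  proof
    show "R \<subseteq> carrier (G \<times>\<times> G)" using R by simp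
    show "\<one>\<^bsub>G \<times>\<times> G\<^esub> \<in> R" using R by simp
    show "x \<otimes>\<^bsub>G \<times>\<times> G\<^esub> y \<in> R" if "x \<in> R" "y \<in> R" for x y
      using R that by (cases x; cases y) simp
    show "inv\<^bsub>G \<times>\<times> G\<^esub> x \<in> R" if "x \<in> R" for x
      using R that inv_DirProd [OF is_group is_group] by (cases x) auto
  qed
qed

lemma subgroup_DirProdD:
  assumes "subgroup R (G \<times>\<times> G)"
  shows "(x, y) \<in> R \<Longrightarrow> x \<in> carrier G" "(x, y) \<in> R \<Longrightarrow> y \<in> carrier G" "(\<one>, \<one>) \<in> R"
    "(x, y) \<in> R \<Longrightarrow> (x', y') \<in> R \<Longrightarrow> (x \<otimes> x', y \<otimes> y') \<in> R"
    "(x, y) \<in> R \<Longrightarrow> (inv x, inv y) \<in> R"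
  using assms unfolding subgroup_DirProd_iff by auto

lemma subgroup_converse:
  assumes R: "subgroup R (G \<times>\<times> G)" shows "subgroup (R\<inverse>) (G \<times>\<times> G)"
  unfolding subgroup_DirProd_iff
  by (auto simp: subgroup_DirProdD [OF R])

lemma compact_square: "compact_space (prod_topology T T)"
  using compact by (simp add: compact_space_prod_topology)

lemma commens_sym:
  assumes "commens (P, Q) (P', Q')" shows "commens (P', Q') (P, Q)"
proof -
  obtain R where R: "subgroup R (G \<times>\<times> G)" "closedin (prod_topology T T) R"
     "\<And>x y k. (x, y) \<in> R \<Longrightarrow> (A k x, A k y) \<in> R" "fst ` R = P" "snd ` R = P'" "Q \<times> Q' \<subseteq> R"
     "fin_index Q {x. \<exists>y\<in>Q'. (x, y) \<in> R}" "fin_index Q' {y. \<exists>x\<in>Q. (x, y) \<in> R}"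
    using assms unfolding commens.simps by blast
  have "closedin (prod_topology T T) {z \<in> topspace (prod_topology T T). prod.swap z \<in> R}"
    by (rule closedin_continuous_map_preimage [OF _ R(2)])
       (simp add: prod.swap_def continuous_map_pairedI continuous_map_fst continuous_map_snd)
  moreover have "{z \<in> topspace (prod_topology T T). prod.swap z \<in> R} = R\<inverse>"
    using subgroup.subset [OF R(1)] by auto
  ultimately have "closedin (prod_topology T T) (R\<inverse>)" by simp
  moreover have "subgroup (R\<inverse>) (G \<times>\<times> G)" by (rule subgroup_converse [OF R(1)])
  moreover have "fst ` (R\<inverse>) = snd ` R" "snd ` (R\<inverse>) = fst ` R" by force+
  moreover have "Q' \<times> Q \<subseteq> R\<inverse>" using R(6) by blast
  moreover have "\<forall>x y k. (x, y) \<in> R\<inverse> \<longrightarrow> (A k x, A k y) \<in> R\<inverse>" using R(3) by simp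
  moreover have "fin_index Q' {y. \<exists>x\<in>Q. (y, x) \<in> R\<inverse>}" "fin_index Q {x. \<exists>y\<in>Q'. (y, x) \<in> R\<inverse>}" using R(7,8) by simp_all
  ultimately show ?thesis
    unfolding commens.simps using R(4,5) by blast
qed

text \<open>The second isomorphism theorem with a finite error: \<open>P/(P \<inter> Q')\<close> is
  isomorphic to \<open>PQ'/Q'\<close>, and \<open>Q\<close> has finite index in
  \<open>P \<inter> Q'\<close>. The relation is the lifted graph of the induced map from
  \<open>P/Q\<close> to \<open>P'/Q'\<close>. Reflexivity is the case of equal pairs.\<close>

lemma commens_base:
  assumes P: "stable_sub P" and P': "stable_sub P'" and Q: "stable_sub Q" and Q': "stable_sub Q'"
    and n: "normal_in Q' P'" and eq: "P' = P <#> Q'" and QQ: "Q \<subseteq> P \<inter> Q'" and fin_index: "fin_index Q (P \<inter> Q')"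
  shows "commens (P, Q) (P', Q')"
proof -
  let ?R = "{(x, y). x \<in> P \<and> y \<in> P' \<and> inv x \<otimes> y \<in> Q'}"
  have sub: "P \<subseteq> carrier G" "P' \<subseteq> carrier G" "Q \<subseteq> carrier G" "Q' \<subseteq> carrier G"
    using P P' Q Q' stable_sub_subset by auto
  note Pm = subgroup.m_closed [OF stable_sub_subgroup [OF P]] subgroup.m_inv_closed [OF stable_sub_subgroup [OF P]]
    subgroup.one_closed [OF stable_sub_subgroup [OF P]]
  note P'm = subgroup.m_closed [OF stable_sub_subgroup [OF P']] subgroup.m_inv_closed [OF stable_sub_subgroup [OF P']]
    subgroup.one_closed [OF stable_sub_subgroup [OF P']]
  note Q'm = subgroup.m_closed [OF stable_sub_subgroup [OF Q']] subgroup.m_inv_closed [OF stable_sub_subgroup [OF Q']]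
    subgroup.one_closed [OF stable_sub_subgroup [OF Q']]
  have PP': "P \<subseteq> P'"
    unfolding eq by (rule set_mult_upper [OF stable_sub_subgroup [OF P] stable_sub_subgroup [OF Q']])
  show ?thesis
    unfolding commens.simps
  proof (intro exI [of _ ?R] conjI allI impI)
    show "subgroup ?R (G \<times>\<times> G)"
      unfolding subgroup_DirProd_iff
    proof (intro conjI allI impI)
      show "?R \<subseteq> carrier G \<times> carrier G" using sub by auto
      show "(\<one>, \<one>) \<in> ?R" using Pm P'm Q'm by simp
      fix x y assume xy: "(x, y) \<in> ?R"
      then have c: "x \<in> carrier G" "y \<in> carrier G" using sub by auto
      have "y \<in> P'" "inv x \<otimes> y \<in> Q'" using xy by auto
      then have "y \<otimes> inv (inv x \<otimes> y) \<otimes> inv y \<in> Q'"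
        using normal_in_conj [OF n] Q'm by blast
      then have "inv (inv x) \<otimes> inv y \<in> Q'" using c by (simp add: inv_mult_group m_assoc)
      then show "(inv x, inv y) \<in> ?R" using xy Pm P'm by simp
      fix x' y' assume xy': "(x', y') \<in> ?R"
      then have c': "x' \<in> carrier G" "y' \<in> carrier G" using sub by auto
      have "inv x' \<in> P'" using xy' PP' Pm by blast
      then have "inv x' \<otimes> (inv x \<otimes> y) \<otimes> inv (inv x') \<in> Q'"
        using xy by (intro normal_in_conj [OF n]) auto
      then have "(inv x' \<otimes> (inv x \<otimes> y) \<otimes> inv (inv x')) \<otimes> (inv x' \<otimes> y') \<in> Q'"
        using xy' Q'm by blast
      then have "inv (x \<otimes> x') \<otimes> (y \<otimes> y') \<in> Q'"
        using c c' by (simp add: inv_mult_group m_assoc)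
      then show "(x \<otimes> x', y \<otimes> y') \<in> ?R" using xy xy' Pm P'm by simp
    qed
    have "continuous_map (prod_topology T T) T (\<lambda>z. inv (fst z) \<otimes> snd z)"
      by (intro continuous_mult continuous_inv continuous_map_fst continuous_map_snd)
    then have "closedin (prod_topology T T) {z \<in> topspace (prod_topology T T). inv (fst z) \<otimes> snd z \<in> Q'}"
      by (rule closedin_continuous_map_preimage [OF _ stable_sub_closed [OF Q']])
    moreover have "closedin (prod_topology T T) (P \<times> P')"
      using P P' by (simp add: closedin_prod_Times_iff stable_sub_closed)
    ultimately have "closedin (prod_topology T T)
        (P \<times> P' \<inter> {z \<in> topspace (prod_topology T T). inv (fst z) \<otimes> snd z \<in> Q'})"
      by (rule closedin_Int [rotated])
    moreover have "P \<times> P' \<inter> {z \<in> topspace (prod_topology T T). inv (fst z) \<otimes> snd z \<in> Q'} = ?R"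
      using sub by auto
    ultimately show "closedin (prod_topology T T) ?R" by simp
    show "(A k x, A k y) \<in> ?R" if xy: "(x, y) \<in> ?R" for x y k
    proof -
      have c: "x \<in> carrier G" "y \<in> carrier G" using sub xy by auto
      have "A k (inv x \<otimes> y) \<in> Q'" using xy stable_sub_apow [OF Q'] by blast
      then show ?thesis using xy c stable_sub_apow [OF P] stable_sub_apow [OF P'] by simp
    qed
    show "fst ` ?R = P"
    proof
      show "P \<subseteq> fst ` ?R"
      proof
        fix x assume x: "x \<in> P"
        then have "(x, x) \<in> ?R" using PP' Q'm sub by auto
        then show "x \<in> fst ` ?R" by force
      qed
    qed auto
    show "snd ` ?R = P'"
    proof
      show "P' \<subseteq> snd ` ?R"
      proof
        fix y assume y: "y \<in> P'"
        then obtain x z where xz: "x \<in> P" "z \<in> Q'" "y = x \<otimes> z" unfolding eq by (auto simp: set_mult_def)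
        then have "x \<in> carrier G" "z \<in> carrier G" using sub by auto
        then have "inv x \<otimes> y = z" using xz(3) by simp
        then have "(x, y) \<in> ?R" using xz y by simp
        then show "y \<in> snd ` ?R" by force
      qed
    qed auto
    show "Q \<times> Q' \<subseteq> ?R" using QQ normal_in_subset [OF n] Q'm by auto
    have "{x. \<exists>y\<in>Q'. (x, y) \<in> ?R} \<subseteq> P \<inter> Q'"
    proof
      fix x assume "x \<in> {x. \<exists>y\<in>Q'. (x, y) \<in> ?R}"
      then obtain y where xy: "y \<in> Q'" "x \<in> P" "y \<in> P'" "inv x \<otimes> y \<in> Q'" by auto
      then have "y \<otimes> inv (inv x \<otimes> y) \<in> Q'" using Q'm by blast
      moreover have "x \<in> carrier G" "y \<in> carrier G" using xy sub by auto
      ultimately show "x \<in> P \<inter> Q'" using xy by (simp add: inv_mult_group)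
    qed
    then show "fin_index Q {x. \<exists>y\<in>Q'. (x, y) \<in> ?R}" using fin_index fin_index_mono by blast
    have "{y. \<exists>x\<in>Q. (x, y) \<in> ?R} \<subseteq> Q'"
    proof
      fix y assume "y \<in> {y. \<exists>x\<in>Q. (x, y) \<in> ?R}"
      then obtain x where xy: "x \<in> Q" "x \<in> P" "y \<in> P'" "inv x \<otimes> y \<in> Q'" by auto
      then have "x \<otimes> (inv x \<otimes> y) \<in> Q'" using Q'm QQ by blast
      moreover have "x \<in> carrier G" "y \<in> carrier G" using xy sub by auto
      ultimately show "y \<in> Q'" by simp
    qed
    then show "fin_index Q' {y. \<exists>x\<in>Q. (x, y) \<in> ?R}" using fin_index_mono [OF fin_index_refl [OF stable_sub_subgroup [OF Q']]] by blast
  qed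
qed

lemma commens_refl:
  assumes P: "stable_sub P" and Q: "stable_sub Q" and n: "normal_in Q P" shows "commens (P, Q) (P, Q)"
proof (rule commens_base [OF P P Q Q n])
  show "P = P <#> Q"
  proof
    show "P \<subseteq> P <#> Q" by (rule set_mult_upper [OF stable_sub_subgroup [OF P] stable_sub_subgroup [OF Q]])
    show "P <#> Q \<subseteq> P"
      using normal_in_subset [OF n] subgroup.m_closed [OF stable_sub_subgroup [OF P]] by (auto simp: set_mult_def)
  qed
  show "Q \<subseteq> P \<inter> Q" using normal_in_subset [OF n] by simp
  show "fin_index Q (P \<inter> Q)" using fin_index_mono [OF fin_index_refl [OF stable_sub_subgroup [OF Q]]] by simp
qed

text \<open>The composition is the image of the pairs in \<open>R \<times> S\<close> with equal
  middle coordinates. These form a closed set since the diagonal of a Hausdorff space is closed, and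
  compactness makes the image closed.\<close>

lemma closedin_relcomp:
  assumes R: "closedin (prod_topology T T) R" and S: "closedin (prod_topology T T) S"
  shows "closedin (prod_topology T T) (R O S)"
proof -
  let ?X = "prod_topology (prod_topology T T) (prod_topology T T)"
  have cX: "compact_space ?X" using compact_square by (simp add: compact_space_prod_topology)
  have "closedin ?X (R \<times> S)" using R S by (simp add: closedin_prod_Times_iff)
  moreover have "closedin ?X {z \<in> topspace ?X. (snd (fst z), fst (snd z)) \<in> {(x, x) |x. x \<in> topspace T}}"
  proof (rule closedin_continuous_map_preimage)
    have "closedin (prod_topology T T) ((\<lambda>x. (x, x)) ` topspace T)"
      using Hausdorff Hausdorff_space_closedin_diagonal by blast
    moreover have "(\<lambda>x. (x, x)) ` topspace T = {(x, x) |x. x \<in> topspace T}" by auto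
    ultimately show "closedin (prod_topology T T) {(x, x) |x. x \<in> topspace T}" by simp
    show "continuous_map ?X (prod_topology T T) (\<lambda>z. (snd (fst z), fst (snd z)))"
      by (intro continuous_map_pairedI continuous_map_fst' [OF continuous_map_fst] continuous_map_snd' [OF continuous_map_snd]
        continuous_map_fst' [OF continuous_map_snd] continuous_map_snd' [OF continuous_map_fst])
  qed
  ultimately have "closedin ?X (R \<times> S \<inter> {z \<in> topspace ?X. (snd (fst z), fst (snd z)) \<in> {(x, x) |x. x \<in> topspace T}})"
    (is "closedin ?X ?Z") by (rule closedin_Int)
  then have "compactin ?X ?Z" by (rule closedin_compact_space [OF cX])
  moreover have "continuous_map ?X (prod_topology T T) (\<lambda>z. (fst (fst z), snd (snd z)))"
    by (intro continuous_map_pairedI continuous_map_fst' [OF continuous_map_fst] continuous_map_snd' [OF continuous_map_snd]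
        continuous_map_fst' [OF continuous_map_snd] continuous_map_snd' [OF continuous_map_fst])
  ultimately have "compactin (prod_topology T T) ((\<lambda>z. (fst (fst z), snd (snd z))) ` ?Z)"
    by (rule image_compactin)
  moreover have "(\<lambda>z. (fst (fst z), snd (snd z))) ` ?Z = R O S"
  proof
    show "R O S \<subseteq> (\<lambda>z. (fst (fst z), snd (snd z))) ` ?Z"
    proof clarify
      fix x y z assume "(x, y) \<in> R" "(y, z) \<in> S"
      moreover from this have "x \<in> carrier G" "y \<in> carrier G" "z \<in> carrier G"
        using closedin_subset [OF R] closedin_subset [OF S] by auto
      ultimately have "((x, y), (y, z)) \<in> ?Z" by simp
      then show "(x, z) \<in> (\<lambda>z. (fst (fst z), snd (snd z))) ` ?Z" by force
    qed
  qed auto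
  ultimately have "compactin (prod_topology T T) (R O S)" by simp
  then show ?thesis
    using Hausdorff by (intro compactin_imp_closedin) (simp_all add: Hausdorff_space_prod_topology)
qed

text \<open>Bounds the kernels for a composite relation, with \<open>X\<close> the corresponding set
  for the other factor. If \<open>R\<close> relates \<open>x\<close> to \<open>y\<close> and
  \<open>x'\<close> to \<open>y'\<close> with \<open>y\<close>, \<open>y'\<close> in one coset of
  \<open>Q'\<close>, then \<open>x \<otimes> inv x'\<close> is related to an element of
  \<open>Q'\<close>. So the preimage of \<open>Q'\<close> has finite index in that of
  \<open>X\<close>, and \<open>Q\<close> has finite index in the former.\<close>

lemma fin_index_relcomp:
  assumes R: "subgroup R (G \<times>\<times> G)" and Q: "subgroup Q G" and Q': "subgroup Q' G"
    and QR: "Q' \<subseteq> X" "X \<subseteq> carrier G"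
    and fin_index: "fin_index Q {x. \<exists>y\<in>Q'. (x, y) \<in> R}" and fi': "fin_index Q' X"
  shows "fin_index Q {x. \<exists>y\<in>X. (x, y) \<in> R}"
proof -
  note R' = subgroup_DirProdD [OF R]
  let ?L = "{x. \<exists>y\<in>Q'. (x, y) \<in> R}"
  have RG: "\<And>x y. (x, y) \<in> R \<Longrightarrow> x \<in> carrier G \<and> y \<in> carrier G" using R'(1,2) by blast
  have L: "subgroup ?L G"
  proof
    show "?L \<subseteq> carrier G" using RG by auto
    show "\<one> \<in> ?L" using R'(3) subgroup.one_closed [OF Q'] by blast
    show "x \<otimes> x' \<in> ?L" if "x \<in> ?L" "x' \<in> ?L" for x x'
      using that R'(4) subgroup.m_closed [OF Q'] by blast
    show "inv x \<in> ?L" if "x \<in> ?L" for x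
      using that R'(5) subgroup.m_inv_closed [OF Q'] by blast
  qed
  define f where "f x = (SOME y. y \<in> X \<and> (x, y) \<in> R)" for x
  have f: "f x \<in> X \<and> (x, f x) \<in> R" if "\<exists>y\<in>X. (x, y) \<in> R" for x
    unfolding f_def by (rule someI_ex) (use that in blast)
  have "fin_index ?L {x. \<exists>y\<in>X. (x, y) \<in> R}"
    unfolding fin_index_def
  proof (rule finite_image_factor [where f = "\<lambda>x. Q' #> f x"])
    have "(\<lambda>x. Q' #> f x) ` {x. \<exists>y\<in>X. (x, y) \<in> R} \<subseteq> (\<lambda>y. Q' #> y) ` X" using f by auto
    then show "finite ((\<lambda>x. Q' #> f x) ` {x. \<exists>y\<in>X. (x, y) \<in> R})"
      using fi' unfolding fin_index_def by (rule finite_subset)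
    fix x x' assume "x \<in> {x. \<exists>y\<in>X. (x, y) \<in> R}" "x' \<in> {x. \<exists>y\<in>X. (x, y) \<in> R}"
      and eq: "Q' #> f x = Q' #> f x'"
    then have xx: "(x, f x) \<in> R" "(x', f x') \<in> R" using f by auto
    then have c: "x \<in> carrier G" "x' \<in> carrier G" "f x \<in> carrier G" "f x' \<in> carrier G" using RG by blast+
    have "(x \<otimes> inv x', f x \<otimes> inv (f x')) \<in> R" by (rule R'(4) [OF xx(1) R'(5) [OF xx(2)]])
    moreover have "f x \<otimes> inv (f x') \<in> Q'" using eq r_coset_eq_iff [OF Q'] c by simp
    ultimately show "?L #> x = ?L #> x'" unfolding r_coset_eq_iff [OF L c(1,2)] by blast
  qed
  moreover have "{x. \<exists>y\<in>X. (x, y) \<in> R} \<subseteq> carrier G" using RG by blast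
  ultimately show ?thesis using fin_index_trans [OF Q L _ fin_index] by blast
qed

lemma commens_trans:
  assumes PQ: "commens (P, Q) (P', Q')" and PQ': "commens (P', Q') (P'', Q'')"
    and sub: "stable_sub Q" "stable_sub Q'" "stable_sub Q''"
  shows "commens (P, Q) (P'', Q'')"
proof -
  obtain R where R: "subgroup R (G \<times>\<times> G)" "closedin (prod_topology T T) R"
     "\<And>x y k. (x, y) \<in> R \<Longrightarrow> (A k x, A k y) \<in> R" "fst ` R = P" "snd ` R = P'" "Q \<times> Q' \<subseteq> R"
     "fin_index Q {x. \<exists>y\<in>Q'. (x, y) \<in> R}" "fin_index Q' {y. \<exists>x\<in>Q. (x, y) \<in> R}"
    using PQ unfolding commens.simps by blast
  obtain S where S: "subgroup S (G \<times>\<times> G)" "closedin (prod_topology T T) S"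
     "\<And>x y k. (x, y) \<in> S \<Longrightarrow> (A k x, A k y) \<in> S" "fst ` S = P'" "snd ` S = P''" "Q' \<times> Q'' \<subseteq> S"
     "fin_index Q' {x. \<exists>y\<in>Q''. (x, y) \<in> S}" "fin_index Q'' {y. \<exists>x\<in>Q'. (x, y) \<in> S}"
    using PQ' unfolding commens.simps by blast
  note one = subgroup.one_closed [OF stable_sub_subgroup [OF sub(1)]] subgroup.one_closed [OF stable_sub_subgroup [OF sub(2)]]
    subgroup.one_closed [OF stable_sub_subgroup [OF sub(3)]]
  note R' = subgroup_DirProdD [OF R(1)] and S' = subgroup_DirProdD [OF S(1)]
  have conv: "subgroup (R\<inverse>) (G \<times>\<times> G)" "subgroup (S\<inverse>) (G \<times>\<times> G)"
    by (rule subgroup_converse [OF R(1)], rule subgroup_converse [OF S(1)])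
  show ?thesis
    unfolding commens.simps
  proof (intro exI [of _ "R O S"] conjI allI impI)
    show "subgroup (R O S) (G \<times>\<times> G)"
      unfolding subgroup_DirProd_iff
    proof (intro conjI allI impI)
      show "R O S \<subseteq> carrier G \<times> carrier G" using R'(1) S'(2) by auto
      show "(\<one>, \<one>) \<in> R O S" using R'(3) S'(3) by blast
      show "(x \<otimes> x', y \<otimes> y') \<in> R O S" if "(x, y) \<in> R O S" "(x', y') \<in> R O S" for x y x' y'
      proof -
        obtain z where z: "(x, z) \<in> R" "(z, y) \<in> S" using \<open>(x, y) \<in> R O S\<close> by blast
        obtain z' where z': "(x', z') \<in> R" "(z', y') \<in> S" using \<open>(x', y') \<in> R O S\<close> by blast
        show ?thesis by (rule relcompI [OF R'(4) [OF z(1) z'(1)] S'(4) [OF z(2) z'(2)]])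
      qed
      show "(inv x, inv y) \<in> R O S" if "(x, y) \<in> R O S" for x y
        using that R'(5) S'(5) by blast
    qed
    show "closedin (prod_topology T T) (R O S)" by (rule closedin_relcomp [OF R(2) S(2)])
    show "(A k x, A k y) \<in> R O S" if "(x, y) \<in> R O S" for x y k
      using that R(3) S(3) by blast
    show "fst ` (R O S) = P"
    proof
      show "fst ` (R O S) \<subseteq> P" using R(4) by force
      show "P \<subseteq> fst ` (R O S)"
      proof
        fix x assume "x \<in> P"
        then obtain y where "(x, y) \<in> R" using R(4) by force
        moreover then have "y \<in> P'" using R(5) by force
        then obtain z where "(y, z) \<in> S" using S(4) by force
        ultimately have "(x, z) \<in> R O S" by blast
        then show "x \<in> fst ` (R O S)" by force
      qed
    qed
    show "snd ` (R O S) = P''"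
    proof
      show "snd ` (R O S) \<subseteq> P''" using S(5) by force
      show "P'' \<subseteq> snd ` (R O S)"
      proof
        fix z assume "z \<in> P''"
        then obtain y where "(y, z) \<in> S" using S(5) by force
        moreover then have "y \<in> P'" using S(4) by force
        then obtain x where "(x, y) \<in> R" using R(5) by force
        ultimately have "(x, z) \<in> R O S" by blast
        then show "z \<in> snd ` (R O S)" by force
      qed
    qed
    show "Q \<times> Q'' \<subseteq> R O S" using R(6) S(6) one by blast
    have "fin_index Q {x. \<exists>y\<in>{y. \<exists>z\<in>Q''. (y, z) \<in> S}. (x, y) \<in> R}"
      using S(6) S'(1) one(3)
      by (intro fin_index_relcomp [OF R(1) stable_sub_subgroup [OF sub(1)] stable_sub_subgroup [OF sub(2)] _ _ R(7) S(7)]) auto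
    then show "fin_index Q {x. \<exists>y\<in>Q''. (x, y) \<in> R O S}" by (rule fin_index_mono) auto
    have "fin_index Q'' {z. \<exists>y\<in>{y. \<exists>x\<in>Q. (x, y) \<in> R}. (z, y) \<in> S\<inverse>}"
    proof (rule fin_index_relcomp [OF conv(2) stable_sub_subgroup [OF sub(3)] stable_sub_subgroup [OF sub(2)]])
      show "fin_index Q'' {x. \<exists>y\<in>Q'. (x, y) \<in> S\<inverse>}" using S(8) by simp
    qed (use R(6,8) R'(2) one(1) in auto)
    then show "fin_index Q'' {z. \<exists>x\<in>Q. (x, z) \<in> R O S}" by (rule fin_index_mono) auto
  qed
qed

text \<open>A composition series read from the top, each entry pairing a term with the next lower
  one. Without indices the inductions can remove or prepend a top factor freely.\<close>

inductive cseries :: "'a set \<Rightarrow> ('a set \<times> 'a set) list \<Rightarrow> bool" where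
  cseries_Nil: "cseries {\<one>} []"
| cseries_Cons: "cseries K l \<Longrightarrow> trans_sub H \<Longrightarrow> normal_in K H \<Longrightarrow> irred H K \<Longrightarrow> cseries H ((H, K) # l)"

lemma closedin_one: "closedin T {\<one>}"
  using Hausdorff by (simp add: closedin_Hausdorff_singleton)

lemma trans_sub_one: "trans_sub {\<one>}"
  using closedin_one
  by (auto simp: trans_sub_def trans_def closure_of_eq image_constant_conv intro!: stable_subI triv_subgroup)

lemma cseries_trans_sub: "cseries H l \<Longrightarrow> trans_sub H"
  by (induction rule: cseries.induct) (auto simp: trans_sub_one)

text \<open>Maximality of \<open>K\<close> is tested against \<open>nub M\<close>, since
  \<open>M\<close> itself need not be transitive. As \<open>K\<close> is transitive and
  \<open>nub M \<inter> K\<close> has finite index in it, \<open>K\<close> lies in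
  \<open>nub M\<close>; maximality forces equality, and \<open>nub M\<close> has finite index in
  \<open>M\<close>.\<close>

lemma cseries_exists:
  assumes "trans_sub H" shows "\<exists>l. cseries H l"
  using assms
proof (induction "card (followers H)" arbitrary: H rule: less_induct)
  case less
  note H = trans_sub_stable_sub [OF less.prems]
  note HG = subgroup.mem_carrier [OF stable_sub_subgroup [OF H]]
  show ?case
  proof (cases "H = {\<one>}")
    case True
    then show ?thesis using cseries_Nil by blast
  next
    case False
    let ?P = "\<lambda>K. trans_sub K \<and> normal_in K H \<and> K \<noteq> H"
    have "normal_in {\<one>} H"
      using HG subgroup.one_closed [OF stable_sub_subgroup [OF H]] by (auto simp: normal_in_def)
    then have P1: "?P {\<one>}" using False trans_sub_one by blast
    have bound: "\<forall>K. ?P K \<longrightarrow> card (followers K) < card (followers H)"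
      using card_followers_less [OF less.prems] normal_in_subset trans_sub_stable_sub by blast
    obtain K where K: "?P K" and max: "\<And>L. ?P L \<Longrightarrow> card (followers L) \<le> card (followers K)"
      using ex_has_greatest_nat [of ?P, OF P1 bound] by blast
    have cK: "stable_sub K" using K trans_sub_stable_sub by blast
    have "irred H K"
      unfolding irred_def
    proof (intro conjI allI impI)
      show "\<not> fin_index K H" using trans_sub_eq_of_fin_index [OF less.prems cK] K normal_in_subset by blast
      fix M assume M: "stable_sub M \<and> K \<subseteq> M \<and> normal_in M H \<and> M \<noteq> H"
      then have cM: "stable_sub M" by blast
      have "fin_index (nub M) K" using fin_index_mono [OF fin_index_nub [OF cM]] M by blast
      then have KM: "K \<subseteq> nub M"
        using trans_subset_of_fin_index [OF cK stable_sub_nub [OF cM]] K trans_sub_trans by blast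
      have "nub M \<noteq> H" using nub_subset [OF cM] M normal_in_subset by blast
      then have "?P (nub M)" using trans_sub_nub [OF cM] normal_in_nub [OF H cM] M by blast
      then have "K = nub M"
        using max [of "nub M"] card_followers_less [OF trans_sub_nub [OF cM] cK] KM by fastforce
      then show "fin_index K M" using fin_index_nub [OF cM] by simp
    qed
    moreover obtain l where "cseries K l" using less.hyps [of K] bound K by blast
    ultimately have "cseries H ((H, K) # l)" using K less.prems by (intro cseries_Cons) auto
    then show ?thesis by blast
  qed
qed

text \<open>If \<open>KL\<close> were proper, irreducibility of \<open>H/K\<close> would give
  \<open>K\<close> finite index in \<open>KL\<close>, whence \<open>L \<subseteq> K\<close> by
  transitivity of \<open>L\<close>. Then \<open>K\<close> is a proper candidate over
  \<open>L\<close>, so \<open>L\<close> has finite index in \<open>K\<close>, and transitivity of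
  \<open>K\<close> gives equality.\<close>

lemma irred_cases:
  assumes H: "trans_sub H" and K: "trans_sub K" and L: "trans_sub L" and nK: "normal_in K H" and nL: "normal_in L H"
    and iK: "irred H K" and iL: "irred H L" and ne: "K \<noteq> L"
  shows "H = K <#> L"
proof (rule ccontr)
  assume neq: "H \<noteq> K <#> L"
  note cK = trans_sub_stable_sub [OF K] and cL = trans_sub_stable_sub [OF L] and cH = trans_sub_stable_sub [OF H]
  note sK = stable_sub_subgroup [OF cK] and sL = stable_sub_subgroup [OF cL]
  have M: "stable_sub (K <#> L)"
    using normal_in_conj [OF nK] normal_in_subset [OF nL] by (intro stable_sub_set_mult cK cL) auto
  have "K \<subseteq> K <#> L" "L \<subseteq> K <#> L" by (rule set_mult_upper [OF sK sL])+
  then have "fin_index K L"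
    using irred_fin_index [OF iK M _ normal_in_set_mult [OF nK nL cH]] neq fin_index_mono by metis
  then have "L \<subseteq> K" using trans_subset_of_fin_index [OF cL cK trans_sub_trans [OF L]] by blast
  moreover have "K \<noteq> H" using irred_not_fin_index [OF iK] fin_index_refl [OF sK] by blast
  ultimately have "fin_index L K" using irred_fin_index [OF iL cK _ nK] by blast
  then have "K \<subseteq> L" using trans_subset_of_fin_index [OF cK cL trans_sub_trans [OF K]] by blast
  then show False using \<open>L \<subseteq> K\<close> ne by blast
qed

lemma set_mult_commute_normal_in:
  assumes H: "stable_sub H" and nK: "normal_in K H" and nL: "normal_in L H" shows "K <#> L \<subseteq> L <#> K"
proof
  note HG = subgroup.mem_carrier [OF stable_sub_subgroup [OF H]]
  fix x assume "x \<in> K <#> L"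
  then obtain y z where x: "y \<in> K" "z \<in> L" "x = y \<otimes> z" by (auto simp: set_mult_def)
  then have yz: "y \<in> H" "z \<in> H" using normal_in_subset [OF nK] normal_in_subset [OF nL] by auto
  have "x = (y \<otimes> z \<otimes> inv y) \<otimes> y" using x HG [OF yz(1)] HG [OF yz(2)] by (simp add: m_assoc)
  then show "x \<in> L <#> K"
    unfolding set_mult_def using normal_in_conj [OF nL yz(1) x(2)] x(1) by blast
qed

text \<open>For \<open>M\<close> normal in \<open>K\<close> and containing
  \<open>nub (K \<inter> L)\<close>, the product \<open>LM\<close> is normal in
  \<open>H = LK\<close>. If it is proper, \<open>L\<close> has finite index in it, and intersecting
  with \<open>M\<close> gives the claim. If it is all of \<open>H\<close>, then \<open>M\<close> has
  finite index in \<open>K\<close>, so \<open>M = K\<close> because \<open>K\<close> is transitive.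
  The index in \<open>K\<close> itself is infinite, since otherwise \<open>L\<close> would have
  finite index in \<open>LK = H\<close>.\<close>

lemma irred_swap:
  assumes H: "trans_sub H" and K: "trans_sub K" and L: "trans_sub L" and nK: "normal_in K H" and nL: "normal_in L H"
    and iL: "irred H L" and HKL: "H = K <#> L"
  shows "irred K (nub (K \<inter> L))" "normal_in (nub (K \<inter> L)) K" "commens (K, nub (K \<inter> L)) (H, L)"
proof -
  note cK = trans_sub_stable_sub [OF K] and cL = trans_sub_stable_sub [OF L] and cH = trans_sub_stable_sub [OF H]
  note sK = stable_sub_subgroup [OF cK] and sL = stable_sub_subgroup [OF cL]
  note KG = stable_sub_subset [OF cK] and LG = stable_sub_subset [OF cL]
  let ?D = "nub (K \<inter> L)"
  have cI: "stable_sub (K \<inter> L)" by (rule stable_sub_Int [OF cK cL])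
  note cD = stable_sub_nub [OF cI]
  note sD = stable_sub_subgroup [OF cD]
  have DI: "?D \<subseteq> K \<inter> L" by (rule nub_subset [OF cI])
  have fiD: "fin_index ?D (K \<inter> L)" by (rule fin_index_nub [OF cI])
  have HLK: "H = L <#> K"
    using set_mult_commute_normal_in [OF cH nK nL] set_mult_commute_normal_in [OF cH nL nK] HKL by blast
  show nD: "normal_in ?D K"
    using normal_in_within [OF normal_in_nub [OF cH cI normal_in_Int [OF nK nL]]] DI normal_in_subset [OF nK] by blast
  show "commens (K, ?D) (H, L)" by (rule commens_base [OF cK cH cD cL nL HKL DI fiD])
  show "irred K ?D"
    unfolding irred_def
  proof (intro conjI allI impI notI)
    assume "fin_index ?D K"
    then have "fin_index L K" using fin_index_larger [OF sD sL _ KG] DI by blast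
    then have "fin_index L H" unfolding HLK by (rule fin_index_set_mult [OF sL KG])
    then show False using irred_not_fin_index [OF iL] by blast
  next
    fix M assume M: "stable_sub M \<and> ?D \<subseteq> M \<and> normal_in M K \<and> M \<noteq> K"
    then have cM: "stable_sub M" and DM: "?D \<subseteq> M" and nM: "normal_in M K" and MK: "M \<subseteq> K"
      using normal_in_subset by auto
    note sM = stable_sub_subgroup [OF cM]
    have MG: "M \<subseteq> carrier G" and MH: "M \<subseteq> H" using MK KG normal_in_subset [OF nK] by auto
    have cLM: "stable_sub (L <#> M)"
      using normal_in_conj [OF nL] MH by (intro stable_sub_set_mult cL cM) auto
    have nLM: "normal_in (L <#> M) H"
      unfolding normal_in_def
    proof (intro conjI ballI)
      show "L <#> M \<subseteq> H"
        using normal_in_subset [OF nL] MH subgroup.m_closed [OF stable_sub_subgroup [OF cH]]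
        by (auto simp: set_mult_def subset_iff)
      fix h x assume h: "h \<in> H" and x: "x \<in> L <#> M"
      obtain b k where h': "b \<in> L" "k \<in> K" "h = b \<otimes> k" using h unfolding HLK by (auto simp: set_mult_def)
      obtain l m where x': "l \<in> L" "m \<in> M" "x = l \<otimes> m" using x by (auto simp: set_mult_def)
      have kH: "k \<in> H" using h' normal_in_subset [OF nK] by blast
      have c: "b \<in> carrier G" "k \<in> carrier G" "l \<in> carrier G" "m \<in> carrier G"
        using h' x' LG KG MG by auto
      let ?y = "(k \<otimes> l \<otimes> inv k) \<otimes> (k \<otimes> m \<otimes> inv k)"
      have klk: "k \<otimes> l \<otimes> inv k \<in> L" using normal_in_conj [OF nL kH x'(1)] .
      have kmk: "k \<otimes> m \<otimes> inv k \<in> M" using normal_in_conj [OF nM h'(2) x'(2)] .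
      note L_sub = set_mult_upper(1) [OF sL sM]
      have "?y \<in> L <#> M" unfolding set_mult_def using klk kmk by blast
      moreover have "b \<in> L <#> M" using L_sub h' by blast
      ultimately have "b \<otimes> ?y \<otimes> inv b \<in> L <#> M"
        using stable_sub_subgroup [OF cLM] subgroup.m_closed subgroup.m_inv_closed by metis
      moreover have "h \<otimes> x \<otimes> inv h = b \<otimes> ?y \<otimes> inv b"
        using c h' x' by (simp add: m_assoc inv_mult_group)
      ultimately show "h \<otimes> x \<otimes> inv h \<in> L <#> M" by simp
    qed
    show "fin_index ?D M"
    proof (cases "L <#> M = H")
      case False
      have "L \<subseteq> L <#> M" by (rule set_mult_upper [OF sL sM])
      then have "fin_index L (L <#> M)" using irred_fin_index [OF iL cLM _ nLM] False by blast
      moreover have "M \<subseteq> L <#> M" by (rule set_mult_upper [OF sL sM])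
      ultimately have "fin_index L M" by (rule fin_index_mono)
      then have "fin_index (L \<inter> M) M" by (rule fin_index_Int [OF sL sM])
      moreover have "fin_index ?D (L \<inter> M)" by (rule fin_index_mono [OF fiD]) (use MK in auto)
      ultimately show ?thesis
        using fin_index_trans [OF sD stable_sub_subgroup [OF stable_sub_Int [OF cL cM]] MG] by blast
    next
      case True
      have "fin_index M (K \<inter> L)"
        by (rule fin_index_larger [OF sD sM DM _ fiD]) (use KG in blast)
      then have "fin_index M (M <#> (K \<inter> L))"
        using KG by (intro fin_index_set_mult [OF sM]) auto
      \<comment> \<open>Dedekind's modular law. The inverse of \<open>k\<close> is factored because
        \<open>L <#> M\<close> has its factors in the opposite order.\<close>
      moreover have "K \<subseteq> M <#> (K \<inter> L)"
      proof
        fix k assume k: "k \<in> K"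
        then have "inv k \<in> K" using subgroup.m_inv_closed [OF sK] by blast
        then have "inv k \<in> L <#> M" using True normal_in_subset [OF nK] by blast
        then obtain l m where lm: "l \<in> L" "m \<in> M" "inv k = l \<otimes> m" by (auto simp: set_mult_def)
        have c: "k \<in> carrier G" "l \<in> carrier G" "m \<in> carrier G" using k lm KG LG MG by auto
        have "inv (inv k) = inv m \<otimes> inv l" unfolding lm(3) using c by (simp add: inv_mult_group)
        then have k_eq: "k = inv m \<otimes> inv l" using c by simp
        have "inv l = m \<otimes> k" using c by (simp add: k_eq)
        moreover have "m \<otimes> k \<in> K" using lm MK k subgroup.m_closed [OF sK] by blast
        moreover have "inv l \<in> L" by (rule subgroup.m_inv_closed [OF sL lm(1)])
        ultimately have "inv l \<in> K \<inter> L" by simp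
        then show "k \<in> M <#> (K \<inter> L)"
          unfolding set_mult_def using k_eq subgroup.m_inv_closed [OF sM lm(2)] by blast
      qed
      ultimately have "fin_index M K" by (rule fin_index_mono)
      then have "M = K" using trans_sub_eq_of_fin_index [OF K cM MK] by blast
      then show ?thesis using M by blast
    qed
  qed
qed

lemma cseries_sections: "cseries H l \<Longrightarrow> (P, Q) \<in> set l \<Longrightarrow> stable_sub P \<and> stable_sub Q \<and> normal_in Q P"
  by (induction rule: cseries.induct) (auto simp: trans_sub_stable_sub dest: cseries_trans_sub)

section \<open>Jordan-Hoelder for multisets of factors\<close>

abbreviation commens_mset where "commens_mset \<equiv> rel_mset commens"

lemma commens_mset_refl: "cseries H l \<Longrightarrow> commens_mset (mset l) (mset l)"
proof (rule multiset.rel_refl_strong)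
  fix z assume "cseries H l" "z \<in># mset l"
  then show "commens z z"
    using cseries_sections commens_refl by (cases z) auto
qed

text \<open>\<open>commens_trans\<close> asks for stable second components, so this condition is
  built into the relation before the multiset relators are composed, and dropped afterwards.\<close>

lemma commens_mset_trans:
  assumes X: "commens_mset X Y" and Y: "commens_mset Y Z"
    and cX: "\<And>P Q. (P, Q) \<in># X \<Longrightarrow> stable_sub Q" and cY: "\<And>P Q. (P, Q) \<in># Y \<Longrightarrow> stable_sub Q"
    and cZ: "\<And>P Q. (P, Q) \<in># Z \<Longrightarrow> stable_sub Q"
  shows "commens_mset X Z"
proof -
  let ?c = "\<lambda>z. stable_sub (snd z)"
  from X obtain xs ys where 1: "mset xs = X" "mset ys = Y" "list_all2 commens xs ys" by (auto simp: rel_mset_def)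
  have l1: "list_all2 (\<lambda>x y. commens x y \<and> ?c x \<and> ?c y) xs ys"
    using 1 cX cY by (auto simp: list_all2_conv_all_nth) (metis nth_mem prod.collapse set_mset_mset)+
  then have X': "rel_mset (\<lambda>x y. commens x y \<and> ?c x \<and> ?c y) X Y" using 1 by (auto simp: rel_mset_def)
  from Y obtain xs ys where 2: "mset xs = Y" "mset ys = Z" "list_all2 commens xs ys" by (auto simp: rel_mset_def)
  have l2: "list_all2 (\<lambda>x y. commens x y \<and> ?c x \<and> ?c y) xs ys"
    using 2 cY cZ by (auto simp: list_all2_conv_all_nth) (metis nth_mem prod.collapse set_mset_mset)+
  then have Y': "rel_mset (\<lambda>x y. commens x y \<and> ?c x \<and> ?c y) Y Z" using 2 by (auto simp: rel_mset_def)
  have "(rel_mset (\<lambda>x y. commens x y \<and> ?c x \<and> ?c y) OO rel_mset (\<lambda>x y. commens x y \<and> ?c x \<and> ?c y)) X Z"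
    using X' Y' by blast
  then have "rel_mset ((\<lambda>x y. commens x y \<and> ?c x \<and> ?c y) OO (\<lambda>x y. commens x y \<and> ?c x \<and> ?c y)) X Z"
    by (simp add: multiset.rel_compp)
  then show ?thesis
    by (rule multiset.rel_mono_strong) (auto intro: commens_trans)
qed

theorem jordan_hoelder:
  assumes "cseries H l" "cseries H l'" shows "commens_mset (mset l) (mset l')"
  using assms
proof (induction "card (followers H)" arbitrary: H l l' rule: less_induct)
  case less
  have H: "trans_sub H" using cseries_trans_sub less.prems by blast
  have not_one: "H \<noteq> {\<one>}" if "cseries H ((H, K) # k)" "irred H K" "normal_in K H" for K k
  proof
    assume "H = {\<one>}"
    then have "fin_index K H" by (simp add: fin_index_def)
    then show False using that irred_not_fin_index by blast
  qed
  from less.prems(1) show ?case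
  proof (cases rule: cseries.cases)
    case cseries_Nil
    from less.prems(2) show ?thesis
    proof (cases rule: cseries.cases)
      case cseries_Nil
      then show ?thesis using \<open>l = []\<close> by (simp add: rel_mset_Zero)
    next
      case (cseries_Cons K k)
      then show ?thesis using not_one [of K k] less.prems \<open>H = {\<one>}\<close> by simp
    qed
  next
    case (cseries_Cons K k)
    note K = this
    from less.prems(2) show ?thesis
    proof (cases rule: cseries.cases)
      case cseries_Nil
      then show ?thesis using not_one [of K k] less.prems K by simp
    next
      case (cseries_Cons L k')
      note L = this
      have tK: "trans_sub K" and tL: "trans_sub L" using K L cseries_trans_sub by blast+
      note cK = trans_sub_stable_sub [OF tK] and cL = trans_sub_stable_sub [OF tL] and cH = trans_sub_stable_sub [OF H]
      have "K \<noteq> H" using irred_not_fin_index [OF \<open>irred H K\<close>] fin_index_refl [OF stable_sub_subgroup [OF cK]] by blast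
      then have lessK: "card (followers K) < card (followers H)"
        using card_followers_less [OF H cK] normal_in_subset [OF \<open>normal_in K H\<close>] by blast
      have "L \<noteq> H" using irred_not_fin_index [OF \<open>irred H L\<close>] fin_index_refl [OF stable_sub_subgroup [OF cL]] by blast
      then have lessL: "card (followers L) < card (followers H)"
        using card_followers_less [OF H cL] normal_in_subset [OF \<open>normal_in L H\<close>] by blast
      show ?thesis
      proof (cases "K = L")
        case True
        then have "commens_mset (mset k) (mset k')"
          using less.hyps [OF lessK] K L by blast
        moreover have "commens (H, K) (H, L)"
          using commens_refl [OF cH cK \<open>normal_in K H\<close>] True by simp
        ultimately show ?thesis using K L by (simp add: rel_mset_Plus)
      next
        case False
        have HKL: "H = K <#> L"
          using irred_cases [OF H tK tL \<open>normal_in K H\<close> \<open>normal_in L H\<close> \<open>irred H K\<close> \<open>irred H L\<close> False] .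
        have HLK: "H = L <#> K"
          using irred_cases [OF H tL tK \<open>normal_in L H\<close> \<open>normal_in K H\<close> \<open>irred H L\<close> \<open>irred H K\<close>] False by blast
        let ?D = "nub (K \<inter> L)"
        have tD: "trans_sub ?D" by (rule trans_sub_nub [OF stable_sub_Int [OF cK cL]])
        note cD = trans_sub_stable_sub [OF tD]
        note sw1 = irred_swap [OF H tK tL \<open>normal_in K H\<close> \<open>normal_in L H\<close> \<open>irred H L\<close> HKL]
        note sw2 = irred_swap [OF H tL tK \<open>normal_in L H\<close> \<open>normal_in K H\<close> \<open>irred H K\<close> HLK, unfolded Int_commute [of L K]]
        \<comment> \<open>One series of \<open>?D\<close> continues to both \<open>K\<close> and
          \<open>L\<close>. The induction hypothesis compares these continuations with the given
          series below \<open>K\<close> and below \<open>L\<close>.\<close>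
        obtain d where d: "cseries ?D d" using cseries_exists [OF tD] by blast
        have csK: "cseries K ((K, ?D) # d)" by (rule cseries.cseries_Cons [OF d tK sw1(2,1)])
        have csL: "cseries L ((L, ?D) # d)" by (rule cseries.cseries_Cons [OF d tL sw2(2,1)])
        have refl: "commens (H, K) (H, K)" "commens (H, L) (H, L)"
          using commens_refl cH cK cL \<open>normal_in K H\<close> \<open>normal_in L H\<close> by blast+
        have 1: "commens_mset (mset l) (mset ((H, K) # (K, ?D) # d))"
          using less.hyps [OF lessK _ csK, of k] K refl(1) by (simp add: rel_mset_Plus)
        have 3: "commens_mset (mset ((H, L) # (L, ?D) # d)) (mset l')"
          using less.hyps [OF lessL csL, of k'] L refl(2) by (simp add: rel_mset_Plus)
        \<comment> \<open>The top two factors cross over: \<open>H/K\<close> matches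
          \<open>L/?D\<close>, and \<open>K/?D\<close> matches \<open>H/L\<close>.\<close>
        have "commens_mset (add_mset (H, K) (add_mset (K, ?D) (mset d))) (add_mset (L, ?D) (add_mset (H, L) (mset d)))"
          by (intro rel_mset_Plus commens_sym [OF sw2(3)] sw1(3) commens_mset_refl [OF d])
        then have 2: "commens_mset (mset ((H, K) # (K, ?D) # d)) (mset ((H, L) # (L, ?D) # d))"
          by (simp add: add_mset_commute)
        have c: "stable_sub Q" if "(P, Q) \<in># mset l \<or> (P, Q) \<in># mset l' \<or> (P, Q) \<in># mset d
           \<or> (P, Q) \<in> {(H, K), (K, ?D), (H, L), (L, ?D)}" for P Q
          using that cseries_sections [OF less.prems(1)] cseries_sections [OF less.prems(2)] cseries_sections [OF d] cK cL cD
          by auto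
        have 12: "commens_mset (mset l) (mset ((H, L) # (L, ?D) # d))"
          by (rule commens_mset_trans [OF 1 2]) (use c in auto)
        show ?thesis
          by (rule commens_mset_trans [OF 12 3]) (use c in auto)
      qed
    qed
  qed
qed

section \<open>Subquotients\<close>

lemma normal_in_iff_normal:
  assumes H: "subgroup H G" and K: "subgroup K G" and KH: "K \<subseteq> H"
  shows "normal_in K H \<longleftrightarrow> K \<lhd> G\<lparr>carrier := H\<rparr>"
proof -
  have "subgroup K (G\<lparr>carrier := H\<rparr>)" by (rule subgroup_incl [OF K H KH])
  then show ?thesis
    unfolding group.normal_inv_iff [OF subgroup.subgroup_is_group [OF H is_group]] normal_in_def
    using H KH by simp
qed

text \<open>The restricted group has its own \<open>aut_inv\<close>, an \<open>inv_into\<close> of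
  \<open>H\<close> in place of the whole carrier. The two agree on \<open>H\<close> since
  \<open>a\<close> is injective and \<open>H\<close> is stable, so the orbits coincide.\<close>

lemma sub_top_transitive_iff:
  assumes H: "stable_sub H" shows "sub_top_transitive G T a H \<longleftrightarrow> trans H"
proof -
  have inj: "inj_on a (carrier G)" using bij_a by (simp add: bij_betw_def)
  have HG: "H \<subseteq> carrier G" by (rule stable_sub_subset [OF H])
  have inv: "aut_inv (G\<lparr>carrier := H\<rparr>) a x = aut_inv G a x" if x: "x \<in> H" for x
  proof -
    have "A (-1) x \<in> H" by (rule stable_sub_apow [OF H x])
    moreover have "A (-1) x = aut_inv G a x" using apow_pred [of x 0] x HG by auto
    ultimately have y: "aut_inv G a x \<in> H" by simp
    show ?thesis
      unfolding aut_inv_def [of "G\<lparr>carrier := H\<rparr>"]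
      by (rule inv_into_f_eq) (use y x HG in \<open>auto intro: inj_on_subset [OF inj] a_aut_inv\<close>)
  qed
  have "(aut_inv (G\<lparr>carrier := H\<rparr>) a ^^ n) x = (aut_inv G a ^^ n) x \<and> (aut_inv G a ^^ n) x \<in> H" if x: "x \<in> H" for n x
  proof (induction n)
    case (Suc n)
    have "A (-1) ((aut_inv G a ^^ n) x) \<in> H" by (rule stable_sub_apow [OF H]) (use Suc in simp)
    moreover have "(aut_inv G a ^^ n) x \<in> carrier G" using Suc HG by blast
    ultimately have "aut_inv G a ((aut_inv G a ^^ n) x) \<in> H"
      using apow_pred [of "(aut_inv G a ^^ n) x" 0] by simp
    then show ?case using Suc inv by simp
  qed (use x in simp)
  then have "orbit (G\<lparr>carrier := H\<rparr>) a x = orbit G a x" if "x \<in> H" for x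
    using that by (simp add: orbit_def)
  then have orb: "orbit (G\<lparr>carrier := H\<rparr>) a x = range (\<lambda>k. A k x)" if "x \<in> H" for x
    using that by (simp add: orbit_conv_apow)
  have "subtopology T H closure_of (range (\<lambda>k. A k x)) = T closure_of (range (\<lambda>k. A k x))" if x: "x \<in> H" for x
  proof -
    have r: "range (\<lambda>k. A k x) \<subseteq> H" using stable_sub_apow [OF H x] by blast
    then have "T closure_of (range (\<lambda>k. A k x)) \<subseteq> H" using stable_sub_closed [OF H] by (rule closure_of_minimal)
    then show ?thesis using r by (simp add: closure_of_subtopology Int_absorb1)
  qed
  then show ?thesis
    unfolding sub_top_transitive_def top_transitive_def trans_def by (simp add: orb cong: bex_cong)
qed

section \<open>Subquotients as topological groups with automorphism\<close>

definition csection :: "'a set \<Rightarrow> 'a set \<Rightarrow> bool" where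
  "csection H K \<longleftrightarrow> stable_sub H \<and> stable_sub K \<and> normal_in K H"

lemma section_stable_sub: "csection H K \<Longrightarrow> stable_sub H" "csection H K \<Longrightarrow> stable_sub K"
  and section_normal_in: "csection H K \<Longrightarrow> normal_in K H"
  by (auto simp: csection_def)

lemma section_subset: "csection H K \<Longrightarrow> K \<subseteq> H" "csection H K \<Longrightarrow> H \<subseteq> carrier G"
  using normal_in_subset stable_sub_subset by (auto simp: csection_def)

lemma topgroup_quotient:
  assumes "csection H K"
  shows "topgroup_quotient K (G\<lparr>carrier := H\<rparr>) (subtopology T H)"
proof -
  have "K \<lhd> G\<lparr>carrier := H\<rparr>"
    using normal_in_iff_normal [OF stable_sub_subgroup [OF section_stable_sub(1) [OF assms]]
        stable_sub_subgroup [OF section_stable_sub(2) [OF assms]] section_subset(1) [OF assms]] section_normal_in [OF assms] by simp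
  moreover have "topgroup (G\<lparr>carrier := H\<rparr>) (subtopology T H)"
    using assms by (intro topgroup_subgroup topgroup stable_sub_subgroup) (simp add: csection_def)
  ultimately show ?thesis by (simp add: topgroup_quotient_def topgroup_quotient_axioms_def)
qed

lemma closedin_section: "csection H K \<Longrightarrow> closedin (subtopology T H) K"
  using section_subset(1) by (intro closedin_subset_topspace stable_sub_closed) (auto simp: csection_def)

lemma carrier_subquot: "carrier (subquot G H K) = (\<lambda>x. K #> x) ` H"
  by (simp add: subquot_def carrier_FactGroup)

lemma topgroup_subquot: "csection H K \<Longrightarrow> topgroup (subquot G H K) (subquot_top G T H K)"
  unfolding subquot_def subquot_top_def
  by (rule topgroup_quotient.topgroup_quot [OF topgroup_quotient closedin_section])

lemma compact_subquot_top:
  assumes "csection H K" shows "compact_space (subquot_top G T H K)"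
proof -
  have "compact_space (subtopology T H)"
    using assms by (intro compact_space_subtopology closedin_imp_compactin stable_sub_closed section_stable_sub)
  then show ?thesis
    unfolding subquot_top_def by (rule topgroup_quotient.compact_quot_top [OF topgroup_quotient [OF assms]])
qed

lemma continuous_map_coset:
  assumes "csection H K" shows "continuous_map (subtopology T H) (subquot_top G T H K) (\<lambda>x. K #> x)"
  using topgroup_quotient.continuous_proj [OF topgroup_quotient [OF assms]]
  by (simp add: subquot_top_def)

lemma closedin_subquot_top:
  assumes "csection H K"
  shows "closedin (subquot_top G T H K) U \<longleftrightarrow>
    U \<subseteq> carrier (subquot G H K) \<and> closedin (subtopology T H) {x \<in> H. K #> x \<in> U}"
  using topgroup_quotient.closedin_quot_top [OF topgroup_quotient [OF assms]]
  by (simp add: subquot_top_def subquot_def)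

lemma mult_subquot:
  assumes "csection H K" "x \<in> H" "y \<in> H"
  shows "(K #> x) \<otimes>\<^bsub>subquot G H K\<^esub> (K #> y) = K #> (x \<otimes> y)"
  using topgroup_quotient.mult_proj [OF topgroup_quotient [OF assms(1)], of x y] assms
  by (simp add: subquot_def)

lemma one_subquot: "\<one>\<^bsub>subquot G H K\<^esub> = K"
  by (simp add: subquot_def)

lemma group_subquot: "csection H K \<Longrightarrow> group (subquot G H K)"
  using topgroup_subquot by (simp add: topgroup_def)

lemma induced_coset:
  assumes K: "stable_sub K" and x: "x \<in> carrier G"
  shows "induced_aut a (K #> x) = K #> a x"
proof -
  have aK: "a ` K = K" using K by (simp add: stable_sub_def)
  have "a ` (K #> x) = (\<lambda>k. a k \<otimes> a x) ` K"
    using x stable_sub_subset [OF K] by (auto simp: r_coset_def a_mult image_iff subset_iff)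
  also have "\<dots> = (\<lambda>k. k \<otimes> a x) ` (a ` K)" by (simp only: image_image)
  also have "\<dots> = K #> a x" unfolding aK by (auto simp: r_coset_def)
  finally show ?thesis by (simp add: induced_aut_def)
qed

lemma coset_eq_iff: "stable_sub K \<Longrightarrow> x \<in> carrier G \<Longrightarrow> y \<in> carrier G \<Longrightarrow> K #> x = K #> y \<longleftrightarrow> x \<otimes> inv y \<in> K"
  by (intro r_coset_eq_iff stable_sub_subgroup)

lemma coset_apow_cong:
  assumes K: "stable_sub K" and x: "x \<in> carrier G" and y: "y \<in> carrier G" and eq: "K #> A j x = K #> A j y"
  shows "K #> x = K #> y"
proof -
  have "A j (x \<otimes> inv y) \<in> K" using eq coset_eq_iff [OF K] x y by simp
  then have "A (- j) (A j (x \<otimes> inv y)) \<in> K" by (rule stable_sub_apow [OF K])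
  then have "x \<otimes> inv y \<in> K" using x y by (simp add: apow_add del: apow_mult apow_inv)
  then show ?thesis using coset_eq_iff [OF K x y] by simp
qed

lemma inj_induced:
  assumes "csection H K" shows "inj_on (induced_aut a) (carrier (subquot G H K))"
proof (rule inj_onI)
  note K = section_stable_sub(2) [OF assms]
  fix C D assume "C \<in> carrier (subquot G H K)" "D \<in> carrier (subquot G H K)"
    and eq: "induced_aut a C = induced_aut a D"
  then obtain x y where xy: "x \<in> H" "C = K #> x" "y \<in> H" "D = K #> y" by (auto simp: carrier_subquot)
  then have c: "x \<in> carrier G" "y \<in> carrier G" using section_subset [OF assms] by auto
  have "K #> A 1 x = K #> A 1 y" using eq xy induced_coset [OF K] c apow_1 by simp
  then show "C = D" using coset_apow_cong [OF K c] xy by simp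
qed

text \<open>For negative exponents the left side is an \<open>inv_into\<close> on the set of cosets;
  injectivity of the induced map identifies it, so orbits in the quotient are images of orbits in
  \<open>H\<close>.\<close>

lemma apow_induced:
  assumes S: "csection H K" and x: "x \<in> H"
  shows "apow (subquot G H K) (induced_aut a) k (K #> x) = K #> A k x"
proof -
  note K = section_stable_sub(2) [OF S] and H = section_stable_sub(1) [OF S]
  let ?b = "aut_inv (subquot G H K) (induced_aut a)"
  have HG: "y \<in> carrier G" if "y \<in> H" for y using that section_subset(2) [OF S] by blast
  have b: "?b (K #> y) = K #> aut_inv G a y \<and> aut_inv G a y \<in> H" if y: "y \<in> H" for y
  proof -
    have "A (-1) y \<in> H" by (rule stable_sub_apow [OF H y])
    then have y': "aut_inv G a y \<in> H" using apow_pred [of y 0] HG [OF y] by simp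
    have "?b (K #> y) = K #> aut_inv G a y"
      unfolding aut_inv_def [of "subquot G H K"]
    proof (rule inv_into_f_eq [OF inj_induced [OF S]])
      show "K #> aut_inv G a y \<in> carrier (subquot G H K)" using y' by (simp add: carrier_subquot)
      show "induced_aut a (K #> aut_inv G a y) = K #> y"
        using induced_coset [OF K HG [OF y']] a_aut_inv [OF HG [OF y]] by simp
    qed
    then show ?thesis using y' by blast
  qed
  have "(?b ^^ n) (K #> x) = K #> (aut_inv G a ^^ n) x \<and> (aut_inv G a ^^ n) x \<in> H" for n
    by (induction n) (use x b in auto)
  moreover have "(induced_aut a ^^ n) (K #> x) = K #> (a ^^ n) x \<and> (a ^^ n) x \<in> H" for n
  proof (induction n)
    case (Suc n)
    then have "a ((a ^^ n) x) \<in> H" using H by (auto simp: stable_sub_def)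
    then show ?case using Suc induced_coset [OF K HG] by simp
  qed (use x in simp)
  ultimately show ?thesis by (simp add: apow_def)
qed

lemma top_transitive_subquot:
  assumes S: "csection H K" and tr: "trans H"
  shows "top_transitive (subquot G H K) (subquot_top G T H K) (induced_aut a)"
proof -
  obtain x where x: "x \<in> H" and cl: "T closure_of (range (\<lambda>k. A k x)) = H"
    using tr by (auto simp: trans_def)
  let ?TQ = "subquot_top G T H K"
  have r: "range (\<lambda>k. A k x) \<subseteq> H" using stable_sub_apow [OF section_stable_sub(1) [OF S] x] by blast
  have orb: "orbit (subquot G H K) (induced_aut a) (K #> x) = (\<lambda>y. K #> y) ` range (\<lambda>k. A k x)"
    by (simp add: orbit_conv_apow apow_induced [OF S x] image_image)
  have "(\<lambda>y. K #> y) ` (subtopology T H closure_of (range (\<lambda>k. A k x)))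
      \<subseteq> ?TQ closure_of ((\<lambda>y. K #> y) ` range (\<lambda>k. A k x))"
    by (rule continuous_map_image_closure_subset [OF continuous_map_coset [OF S]])
  moreover have "subtopology T H closure_of (range (\<lambda>k. A k x)) = H"
    using r cl by (simp add: closure_of_subtopology Int_absorb1)
  ultimately have "carrier (subquot G H K) \<subseteq> ?TQ closure_of (orbit (subquot G H K) (induced_aut a) (K #> x))"
    by (simp add: orb carrier_subquot)
  moreover have "?TQ closure_of (orbit (subquot G H K) (induced_aut a) (K #> x)) \<subseteq> carrier (subquot G H K)"
    using closure_of_subset_topspace topgroup_subquot [OF S] by (metis topgroup_def)
  ultimately show ?thesis
    unfolding top_transitive_def using x by (intro bexI [of _ "K #> x"]) (auto simp: carrier_subquot)
qed

lemma coset_mem_image: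
  assumes K: "stable_sub K" and M: "stable_sub M" and KM: "K \<subseteq> M" and x: "x \<in> carrier G" and mem: "K #> x \<in> (\<lambda>y. K #> y) ` M"
  shows "x \<in> M"
proof -
  obtain y where y: "y \<in> M" "K #> x = K #> y" using mem by blast
  then have yG: "y \<in> carrier G" using stable_sub_subset [OF M] by blast
  have "x \<otimes> inv y \<in> M" using y coset_eq_iff [OF K x yG] KM by blast
  then have "x \<otimes> inv y \<otimes> y \<in> M" using y subgroup.m_closed [OF stable_sub_subgroup [OF M]] by blast
  then show ?thesis using x yG by (simp add: m_assoc)
qed

text \<open>By \<open>coset_mem_image\<close>, \<open>M\<close> is the full preimage of its set of
  cosets, which is therefore closed and proper; normality and stability pass to the image.\<close>

lemma irred_of_irreducible:
  assumes S: "csection H K"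
    and irred: "irreducible_pair (subquot G H K) (subquot_top G T H K) (induced_aut a)"
  shows "irred H K"
  unfolding irred_def
proof (intro conjI allI impI)
  note K = section_stable_sub(2) [OF S] and H = section_stable_sub(1) [OF S]
  let ?Q = "subquot G H K"
  let ?p = "\<lambda>x. K #> x"
  show "\<not> fin_index K H" using irred by (simp add: irreducible_pair_def carrier_subquot fin_index_def)
  fix M assume "stable_sub M \<and> K \<subseteq> M \<and> normal_in M H \<and> M \<noteq> H"
  then have M: "stable_sub M" "K \<subseteq> M" "normal_in M H" "M \<noteq> H" by auto
  note MH = normal_in_subset [OF M(3)]
  have HG: "x \<in> carrier G" if "x \<in> H" for x using that section_subset(2) [OF S] by blast
  have "?p ` M \<noteq> carrier ?Q"
  proof
    assume eq: "?p ` M = carrier ?Q"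
    have "H \<subseteq> M"
    proof
      fix x assume x: "x \<in> H"
      then have "?p x \<in> ?p ` M" unfolding eq carrier_subquot by blast
      then show "x \<in> M" by (rule coset_mem_image [OF K M(1,2) HG [OF x]])
    qed
    then show False using M(4) MH by blast
  qed
  moreover have "closedin (subquot_top G T H K) (?p ` M)"
  proof -
    have "{x \<in> H. ?p x \<in> ?p ` M} = M"
      using coset_mem_image [OF K M(1,2) HG] MH by blast
    then show ?thesis
      unfolding closedin_subquot_top [OF S] carrier_subquot
      using MH closedin_subset_topspace [OF stable_sub_closed [OF M(1)] MH] by auto
  qed
  moreover have "?p ` M \<lhd> ?Q"
  proof -
    have gH: "group (G\<lparr>carrier := H\<rparr>)" by (rule subgroup.subgroup_is_group [OF stable_sub_subgroup [OF H] is_group])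
    have hom: "group_hom (G\<lparr>carrier := H\<rparr>) ?Q ?p"
      unfolding group_hom_def group_hom_axioms_def
      using gH group_subquot [OF S] by (auto simp: hom_def carrier_subquot mult_subquot [OF S])
    have nM: "M \<lhd> G\<lparr>carrier := H\<rparr>"
      using normal_in_iff_normal [OF stable_sub_subgroup [OF H] stable_sub_subgroup [OF M(1)] MH] M(3) by simp
    have "?p ` carrier (G\<lparr>carrier := H\<rparr>) = carrier ?Q"
      unfolding carrier_subquot by simp
    then show ?thesis
      by (rule normal.surj_hom_normal_subgroup [OF nM hom])
  qed
  moreover have "stable (induced_aut a) (?p ` M)"
  proof -
    have "induced_aut a ` ?p ` M = ?p ` (a ` M)"
      unfolding image_image using induced_coset [OF K] stable_sub_subset [OF M(1)] by (intro image_cong) auto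
    then show ?thesis using M(1) by (simp add: stable_def stable_sub_def)
  qed
  ultimately have "finite (?p ` M)" using irred unfolding irreducible_pair_def by blast
  then show "fin_index K M" by (simp add: fin_index_def)
qed

lemma irreducible_of_irred:
  assumes S: "csection H K" and irred: "irred H K"
  shows "irreducible_pair (subquot G H K) (subquot_top G T H K) (induced_aut a)"
  unfolding irreducible_pair_def
proof (intro conjI allI impI)
  note K = section_stable_sub(2) [OF S] and H = section_stable_sub(1) [OF S]
  let ?Q = "subquot G H K"
  let ?p = "\<lambda>x. K #> x"
  have HG: "x \<in> carrier G" if "x \<in> H" for x using that section_subset(2) [OF S] by blast
  note Hm = subgroup.m_closed [OF stable_sub_subgroup [OF H]] subgroup.m_inv_closed [OF stable_sub_subgroup [OF H]]
    subgroup.one_closed [OF stable_sub_subgroup [OF H]]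
  interpret Q: group ?Q by (rule group_subquot [OF S])
  show "compact_space (subquot_top G T H K)" by (rule compact_subquot_top [OF S])
  show "infinite (carrier ?Q)" using irred_not_fin_index [OF irred] by (simp add: carrier_subquot fin_index_def)
  fix \<N> assume N: "\<N> \<noteq> carrier ?Q \<and> closedin (subquot_top G T H K) \<N> \<and> \<N> \<lhd> ?Q \<and> stable (induced_aut a) \<N>"
  then have sN: "subgroup \<N> ?Q" by (blast intro: normal_imp_subgroup)
  have inv_p: "inv\<^bsub>?Q\<^esub> (?p x) = ?p (inv x)" if "x \<in> H" for x
  proof (rule Q.inv_equality)
    show "?p (inv x) \<otimes>\<^bsub>?Q\<^esub> ?p x = \<one>\<^bsub>?Q\<^esub>"
      using that Hm HG mult_subquot [OF S] stable_sub_subset [OF K] by (simp add: one_subquot)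
  qed (use that Hm in \<open>auto simp: carrier_subquot\<close>)
  let ?M = "{x \<in> H. ?p x \<in> \<N>}"
  have eq: "?p ` ?M = \<N>"
    using subgroup.subset [OF sN] by (auto simp: carrier_subquot)
  have sM: "subgroup ?M G"
  proof
    show "?M \<subseteq> carrier G" using HG by auto
    show "\<one> \<in> ?M" using Hm subgroup.one_closed [OF sN] stable_sub_subset [OF K] by (simp add: one_subquot)
    show "x \<otimes> y \<in> ?M" if "x \<in> ?M" "y \<in> ?M" for x y
      using that Hm subgroup.m_closed [OF sN, of "?p x" "?p y"] mult_subquot [OF S] by simp
    show "inv x \<in> ?M" if "x \<in> ?M" for x
      using that Hm subgroup.m_inv_closed [OF sN, of "?p x"] inv_p by simp
  qed
  have KM: "K \<subseteq> ?M"
  proof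
    fix k assume k: "k \<in> K"
    then have "?p k = K" using coset_join2 [OF _ stable_sub_subgroup [OF K]] stable_sub_subset [OF K] by blast
    then show "k \<in> ?M" using k section_subset(1) [OF S] subgroup.one_closed [OF sN] by (auto simp: one_subquot)
  qed
  have "closedin T ?M"
    using N closedin_subquot_top [OF S] closedin_trans_full stable_sub_closed [OF H] by blast
  moreover have "a ` ?M = ?M"
  proof
    show "a ` ?M \<subseteq> ?M"
    proof clarify
      fix x assume x: "x \<in> H" "?p x \<in> \<N>"
      have "induced_aut a (?p x) \<in> \<N>" using N x by (auto simp: stable_def)
      moreover have "a x \<in> H" using x H by (auto simp: stable_sub_def)
      ultimately show "a x \<in> H \<and> ?p (a x) \<in> \<N>" using induced_coset [OF K HG [OF x(1)]] by simp
    qed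
    show "?M \<subseteq> a ` ?M"
    proof
      fix x assume x: "x \<in> ?M"
      then have "?p x \<in> induced_aut a ` \<N>" using N by (simp add: stable_def)
      then obtain C where C: "C \<in> \<N>" "?p x = induced_aut a C" by blast
      then have "C \<in> ?p ` ?M" unfolding eq by simp
      then obtain y where y: "y \<in> H" "?p y \<in> \<N>" "?p x = induced_aut a (?p y)"
        using C by blast
      have "x \<in> a ` H" using x H by (simp add: stable_sub_def)
      then obtain z where z: "z \<in> H" "x = a z" by blast
      \<comment> \<open>\<open>y\<close> is known only up to \<open>K\<close>, so \<open>x\<close>
        need not be \<open>a y\<close>. Instead \<open>x = a z\<close> with \<open>z\<close> in
        \<open>H\<close>, and \<open>z\<close> has the same coset as \<open>y\<close>, which lies in
        \<open>\<N>\<close>.\<close>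
      have "?p (A 1 z) = ?p (A 1 y)" using y z induced_coset [OF K] HG apow_1 by simp
      then have "?p z = ?p y" by (rule coset_apow_cong [OF K HG [OF z(1)] HG [OF y(1)]])
      then show "x \<in> a ` ?M" using y z by auto
    qed
  qed
  ultimately have cM: "stable_sub ?M" using sM by (simp add: stable_sub_def)
  have nM: "normal_in ?M H"
    unfolding normal_in_def
  proof (intro conjI ballI)
    fix h x assume h: "h \<in> H" and x: "x \<in> ?M"
    have "?p h \<otimes>\<^bsub>?Q\<^esub> ?p x \<otimes>\<^bsub>?Q\<^esub> inv\<^bsub>?Q\<^esub> (?p h) \<in> \<N>"
      using N h x unfolding Q.normal_inv_iff by (auto simp: carrier_subquot)
    then have "?p (h \<otimes> x \<otimes> inv h) \<in> \<N>" using h x Hm inv_p mult_subquot [OF S] by simp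
    then show "h \<otimes> x \<otimes> inv h \<in> ?M" using h x Hm by simp
  qed auto
  have "?M \<noteq> H"
  proof
    assume "?M = H"
    then have "\<N> = carrier ?Q" using eq by (simp add: carrier_subquot)
    then show False using N by blast
  qed
  then have "fin_index K ?M" using irred_fin_index [OF irred cM KM nM] by blast
  then show "finite \<N>" using eq by (simp add: fin_index_def)
qed

text \<open>The witness is the image of \<open>R\<close> in the product of the two quotients, with
  the coordinate projections. It is compact because \<open>R\<close> is closed in
  \<open>G \<times> G\<close>, and the two finite index clauses of \<open>commens\<close> make the
  kernels finite.\<close>

lemma co_commensurable_of_commens:
  assumes S: "csection P Q" and S': "csection P' Q'" and co: "commens (P, Q) (P', Q')"
  shows "co_commensurable (subquot G P Q) (subquot_top G T P Q) (induced_aut a)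
     (subquot G P' Q') (subquot_top G T P' Q') (induced_aut a)"
proof -
  obtain R where R: "subgroup R (G \<times>\<times> G)" "closedin (prod_topology T T) R"
     "\<And>x y k. (x, y) \<in> R \<Longrightarrow> (A k x, A k y) \<in> R" "fst ` R = P" "snd ` R = P'" "Q \<times> Q' \<subseteq> R"
     "fin_index Q {x. \<exists>y\<in>Q'. (x, y) \<in> R}" "fin_index Q' {y. \<exists>x\<in>Q. (x, y) \<in> R}"
    using co unfolding commens.simps by blast
  note R' = subgroup_DirProdD [OF R(1)]
  note Q = section_stable_sub(2) [OF S] and Q' = section_stable_sub(2) [OF S']
  let ?G1 = "subquot G P Q" and ?G2 = "subquot G P' Q'"
  let ?T1 = "subquot_top G T P Q" and ?T2 = "subquot_top G T P' Q'"
  let ?p = "\<lambda>x. Q #> x" and ?p' = "\<lambda>x. Q' #> x"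
  let ?f = "\<lambda>(x, y). (?p x, ?p' y)"
  let ?S = "?f ` R"
  let ?H = "(?G1 \<times>\<times> ?G2)\<lparr>carrier := ?S\<rparr>"
  let ?TH = "subtopology (prod_topology ?T1 ?T2) ?S"
  let ?b = "\<lambda>(C, D). (induced_aut a C, induced_aut a D)"
  have RP: "x \<in> P" "y \<in> P'" if "(x, y) \<in> R" for x y using that R(4,5) by force+
  have RG: "x \<in> carrier G" "y \<in> carrier G" if "(x, y) \<in> R" for x y using R'(1,2) that by blast+
  have g1: "group ?G1" and g2: "group ?G2" using group_subquot S S' by blast+
  note tg = topgroup_DirProd [OF topgroup_subquot [OF S] topgroup_subquot [OF S']]
  have gP: "group (?G1 \<times>\<times> ?G2)" by (rule DirProd_group [OF g1 g2])
  have f_mult: "?f (x \<otimes> x', y \<otimes> y') = ?f (x, y) \<otimes>\<^bsub>?G1 \<times>\<times> ?G2\<^esub> ?f (x', y')"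
    if "(x, y) \<in> R" "(x', y') \<in> R" for x y x' y'
    using that RP mult_subquot [OF S] mult_subquot [OF S'] by simp
  have "group_hom ((G \<times>\<times> G)\<lparr>carrier := R\<rparr>) (?G1 \<times>\<times> ?G2) ?f"
    unfolding group_hom_def group_hom_axioms_def
  proof (intro conjI gP)
    show "group ((G \<times>\<times> G)\<lparr>carrier := R\<rparr>)"
      by (rule subgroup.subgroup_is_group [OF R(1) DirProd_group [OF is_group is_group]])
    show "?f \<in> hom ((G \<times>\<times> G)\<lparr>carrier := R\<rparr>) (?G1 \<times>\<times> ?G2)"
      using f_mult RP by (auto simp: hom_def carrier_subquot)
  qed
  then have "subgroup (?f ` carrier ((G \<times>\<times> G)\<lparr>carrier := R\<rparr>)) (?G1 \<times>\<times> ?G2)"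
    by (rule group_hom.img_is_subgroup)
  then have subS: "subgroup ?S (?G1 \<times>\<times> ?G2)" by simp
  have tgH: "topgroup ?H ?TH" by (rule topgroup_subgroup [OF tg subS])
  have "R \<subseteq> P \<times> P'" using RP by auto
  then have "compactin (prod_topology (subtopology T P) (subtopology T P')) R"
    using closedin_compact_space [OF compact_square R(2)]
    unfolding subtopology_Times [symmetric] compactin_subtopology by blast
  moreover have "continuous_map (prod_topology (subtopology T P) (subtopology T P')) (prod_topology ?T1 ?T2) ?f"
    using continuous_map_compose [OF continuous_map_fst continuous_map_coset [OF S]]
      continuous_map_compose [OF continuous_map_snd continuous_map_coset [OF S']]
    unfolding case_prod_beta by (intro continuous_map_pairedI) (simp_all add: o_def)
  ultimately have "compactin (prod_topology ?T1 ?T2) ?S" by (rule image_compactin)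
  then have compH: "compact_space ?TH" by (rule compact_space_subtopology)
  have b_f: "?b (?f (x, y)) = ?f (a x, a y)" if "(x, y) \<in> R" for x y
    using RG [OF that] induced_coset [OF Q] induced_coset [OF Q'] by simp
  have aR: "(a x, a y) \<in> R" if "(x, y) \<in> R" for x y
    using R(3) [OF that, of 1] RG [OF that] apow_1 by simp
  have SG: "?S \<subseteq> carrier ?G1 \<times> carrier ?G2" using subgroup.subset [OF subS] by simp
  have img: "?b ` ?S = ?S"
  proof
    show "?b ` ?S \<subseteq> ?S"
    proof
      fix z assume "z \<in> ?b ` ?S"
      then obtain x y where "(x, y) \<in> R" "z = ?b (?f (x, y))" by auto
      then show "z \<in> ?S" using b_f aR by auto
    qed
    show "?S \<subseteq> ?b ` ?S"
    proof
      fix z assume "z \<in> ?S"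
      then obtain x y where xy: "(x, y) \<in> R" "z = ?f (x, y)" by auto
      let ?x = "A (-1) x" and ?y = "A (-1) y"
      have 1: "(?x, ?y) \<in> R" by (rule R(3) [OF xy(1)])
      have "a ?x = x" "a ?y = y" using apow_succ [of x "-1"] apow_succ [of y "-1"] RG [OF xy(1)] by auto
      then have "z = ?b (?f (?x, ?y))" using b_f [OF 1] xy(2) by simp
      then show "z \<in> ?b ` ?S" using 1 by blast
    qed
  qed
  have injb: "inj_on ?b ?S"
  proof (rule inj_onI)
    fix z z' assume "z \<in> ?S" "z' \<in> ?S" "?b z = ?b z'"
    moreover from this have "fst z \<in> carrier ?G1" "fst z' \<in> carrier ?G1" "snd z \<in> carrier ?G2" "snd z' \<in> carrier ?G2"
      using SG by auto
    ultimately show "z = z'"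
      using inj_onD [OF inj_induced [OF S], of "fst z" "fst z'"] inj_onD [OF inj_induced [OF S'], of "snd z" "snd z'"]
      by (auto simp: case_prod_beta prod_eq_iff)
  qed
  have cont1: "continuous_map (subquot_top G T H K) (subquot_top G T H K) (induced_aut a)" if S: "csection H K" for H K
  proof -
    have aH: "continuous_map (subtopology T H) (subtopology T H) a"
      using continuous_map_from_subtopology [OF continuous_a, of H] section_stable_sub(1) [OF S]
      by (auto simp: continuous_map_in_subtopology stable_sub_def)
    have "continuous_map (subtopology T H) (subquot_top G T H K) (\<lambda>x. K #> a x)"
      using continuous_map_compose [OF aH continuous_map_coset [OF S]] by (simp add: o_def)
    then have "continuous_map (subtopology T H) (subquot_top G T H K) (induced_aut a \<circ> (\<lambda>x. K #> x))"
      by (rule continuous_map_eq) (use induced_coset [OF section_stable_sub(2) [OF S]] in auto)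
    moreover have "quotient_map (subtopology T H) (subquot_top G T H K) (\<lambda>x. K #> x)"
      using topgroup_quotient.quotient_map_proj [OF topgroup_quotient [OF S]] by (simp add: subquot_top_def)
    ultimately show ?thesis by (rule continuous_compose_quotient_map [rotated])
  qed
  have "continuous_map (prod_topology ?T1 ?T2) (prod_topology ?T1 ?T2) ?b"
    using continuous_map_compose [OF continuous_map_fst cont1 [OF S]]
      continuous_map_compose [OF continuous_map_snd cont1 [OF S']]
    unfolding case_prod_beta by (intro continuous_map_pairedI) (simp_all add: o_def)
  note cb = continuous_map_from_subtopology [OF this, of ?S]
  have topH: "topspace ?TH = ?S" unfolding topgroup_topspace [OF tgH] by (rule carrier_restrict)
  have b_closed: "?b z \<in> ?S" if "z \<in> ?S" for z
  proof -
    have "?b z \<in> ?b ` ?S" using that by (rule imageI)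
    then show ?thesis by (simp only: img)
  qed
  then have "?b \<in> topspace ?TH \<rightarrow> ?S"
    unfolding topH by (rule funcsetI)
  then have contb: "continuous_map ?TH ?TH ?b"
    unfolding continuous_map_in_subtopology using cb by blast
  have homeo: "homeomorphic_map ?TH ?TH ?b"
  proof (rule continuous_imp_homeomorphic_map [OF contb compH])
    show "Hausdorff_space ?TH" by (rule topgroup_Hausdorff [OF tgH])
  qed (simp_all only: topH img injb)
  have b_mult: "?b (z \<otimes>\<^bsub>?H\<^esub> z') = ?b z \<otimes>\<^bsub>?H\<^esub> ?b z'" if z: "z \<in> ?S" "z' \<in> ?S" for z z'
  proof -
    obtain x y where xy: "(x, y) \<in> R" "z = ?f (x, y)" using z by auto
    obtain x' y' where xy': "(x', y') \<in> R" "z' = ?f (x', y')" using z by auto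
    have b_mult: "?b (z \<otimes>\<^bsub>?H\<^esub> z') = ?b (?f (x \<otimes> x', y \<otimes> y'))"
      using f_mult [OF xy(1) xy'(1)] xy xy' by simp
    also have "\<dots> = ?f (a x \<otimes> a x', a y \<otimes> a y')"
      using b_f [OF R'(4) [OF xy(1) xy'(1)]] RG [OF xy(1)] RG [OF xy'(1)] by (simp add: a_mult)
    also have "\<dots> = ?b z \<otimes>\<^bsub>?H\<^esub> ?b z'"
      using f_mult [OF aR [OF xy(1)] aR [OF xy'(1)]] b_f [OF xy(1)] b_f [OF xy'(1)] xy xy' by simp
    finally show ?thesis .
  qed
  have "?b \<in> iso ?H ?H"
  proof (rule isoI)
    show "?b \<in> hom ?H ?H"
      by (rule homI; unfold carrier_restrict) (rule b_closed b_mult; assumption)+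
    show "bij_betw ?b (carrier ?H) (carrier ?H)"
      unfolding carrier_restrict bij_betw_def using injb img by (rule conjI)
  qed
  then have aut: "top_aut ?H ?TH ?b" unfolding top_aut_def using homeo by (rule conjI)
  have fst_S: "fst ` ?S = carrier ?G1" and snd_S: "snd ` ?S = carrier ?G2"
    unfolding carrier_subquot R(4,5) [symmetric] by (force simp: image_image)+
  have homf: "fst \<in> hom ?H ?G1" "snd \<in> hom ?H ?G2"
    using SG by (auto simp: hom_def mult_DirProd' split: prod.splits)
  have contf: "continuous_map ?TH ?T1 fst" "continuous_map ?TH ?T2 snd"
    by (intro continuous_map_from_subtopology continuous_map_fst continuous_map_snd)+
  have "kernel ?H ?G1 fst \<subseteq> {Q} \<times> ?p' ` {y. \<exists>x\<in>Q. (x, y) \<in> R}"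
  proof
    fix z assume "z \<in> kernel ?H ?G1 fst"
    then have z: "z \<in> ?S" "fst z = Q" unfolding kernel_def carrier_restrict one_subquot by blast+
    then obtain x y where xy: "(x, y) \<in> R" "z = (?p x, ?p' y)" by auto
    then have eq: "?p x = Q" using z(2) by simp
    have "x \<in> Q" using rcos_self [OF RG(1) [OF xy(1)] stable_sub_subgroup [OF Q]] unfolding eq .
    then show "z \<in> {Q} \<times> ?p' ` {y. \<exists>x\<in>Q. (x, y) \<in> R}" using xy eq by auto
  qed
  then have ker1: "finite (kernel ?H ?G1 fst)"
    using R(8) unfolding fin_index_def by (meson finite.emptyI finite.insertI finite_SigmaI finite_subset)
  have "kernel ?H ?G2 snd \<subseteq> ?p ` {x. \<exists>y\<in>Q'. (x, y) \<in> R} \<times> {Q'}"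
  proof
    fix z assume "z \<in> kernel ?H ?G2 snd"
    then have z: "z \<in> ?S" "snd z = Q'" unfolding kernel_def carrier_restrict one_subquot by blast+
    then obtain x y where xy: "(x, y) \<in> R" "z = (?p x, ?p' y)" by auto
    then have eq: "?p' y = Q'" using z(2) by simp
    have "y \<in> Q'" using rcos_self [OF RG(2) [OF xy(1)] stable_sub_subgroup [OF Q']] unfolding eq .
    then show "z \<in> ?p ` {x. \<exists>y\<in>Q'. (x, y) \<in> R} \<times> {Q'}" using xy eq by auto
  qed
  then have ker2: "finite (kernel ?H ?G2 snd)"
    using R(7) unfolding fin_index_def by (meson finite.emptyI finite.insertI finite_SigmaI finite_subset)
  show ?thesis
    unfolding co_commensurable_def
  proof (intro exI conjI)
    show "topgroup ?H ?TH" "compact_space ?TH" "top_aut ?H ?TH ?b" by fact+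
    show "fst \<in> hom ?H ?G1" "snd \<in> hom ?H ?G2" by fact+
    show "continuous_map ?TH ?T1 fst" "continuous_map ?TH ?T2 snd" by fact+
    show "fst ` carrier ?H = carrier ?G1" "snd ` carrier ?H = carrier ?G2"
      using fst_S snd_S by simp_all
    show "finite (kernel ?H ?G1 fst)" "finite (kernel ?H ?G2 snd)" by fact+
    show "\<forall>x\<in>carrier ?H. fst (?b x) = induced_aut a (fst x)"
      "\<forall>x\<in>carrier ?H. snd (?b x) = induced_aut a (snd x)" by auto
  qed
qed

lemma stable_sub_iff: "stable_sub H \<longleftrightarrow> subgroup H G \<and> closedin T H \<and> stable a H"
  by (simp add: stable_sub_def stable_def)

lemma composition_series_iff:
  "composition_series G T a Gs r \<longleftrightarrow> Gs 0 = {\<one>} \<and> Gs r = carrier G \<and> (\<forall>j\<le>r. trans_sub (Gs j)) \<and>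
     (\<forall>j\<in>{1..r}. normal_in (Gs (j - 1)) (Gs j) \<and> irred (Gs j) (Gs (j - 1)))"
proof
  assume "composition_series G T a Gs r"
  then have s: "Gs 0 = {\<one>}" "Gs r = carrier G"
    "\<And>j. j \<le> r \<Longrightarrow> stable_sub (Gs j) \<and> sub_top_transitive G T a (Gs j)"
    "\<And>j. j \<in> {1..r} \<Longrightarrow> Gs (j - 1) \<subseteq> Gs j \<and> Gs (j - 1) \<lhd> G\<lparr>carrier := Gs j\<rparr>"
    "\<And>j. j \<in> {1..r} \<Longrightarrow> irreducible_pair (subquot G (Gs j) (Gs (j - 1)))
                       (subquot_top G T (Gs j) (Gs (j - 1))) (induced_aut a)"
    by (auto simp: composition_series_def subnormal_series_def stable_sub_iff)
  have "trans_sub (Gs j)" if "j \<le> r" for j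
    unfolding trans_sub_def using s(3) [OF that] sub_top_transitive_iff by blast
  moreover have "normal_in (Gs (j - 1)) (Gs j) \<and> irred (Gs j) (Gs (j - 1))" if j: "j \<in> {1..r}" for j
  proof
    have c: "stable_sub (Gs j)" "stable_sub (Gs (j - 1))" using s(3) j by auto
    then show n: "normal_in (Gs (j - 1)) (Gs j)"
      using s(4) [OF j] normal_in_iff_normal stable_sub_subgroup by blast
    then show "irred (Gs j) (Gs (j - 1))"
      using irred_of_irreducible [OF _ s(5) [OF j]] c by (simp add: csection_def)
  qed
  ultimately show "Gs 0 = {\<one>} \<and> Gs r = carrier G \<and> (\<forall>j\<le>r. trans_sub (Gs j)) \<and>
     (\<forall>j\<in>{1..r}. normal_in (Gs (j - 1)) (Gs j) \<and> irred (Gs j) (Gs (j - 1)))" using s by blast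
next
  assume s: "Gs 0 = {\<one>} \<and> Gs r = carrier G \<and> (\<forall>j\<le>r. trans_sub (Gs j)) \<and>
     (\<forall>j\<in>{1..r}. normal_in (Gs (j - 1)) (Gs j) \<and> irred (Gs j) (Gs (j - 1)))"
  have t: "trans_sub (Gs j)" if "j \<le> r" for j using s that by blast
  have sec: "csection (Gs j) (Gs (j - 1))" if "j \<in> {1..r}" for j
    using s t that by (auto simp: csection_def intro: trans_sub_stable_sub)
  show "composition_series G T a Gs r"
    unfolding composition_series_def subnormal_series_def
  proof (intro conjI ballI allI impI)
    show "Gs 0 = {\<one>}" "Gs r = carrier G" using s by auto
    fix j assume "j \<le> r"
    note tj = t [OF this]
    show "subgroup (Gs j) G" "closedin T (Gs j)" "stable a (Gs j)"
      using trans_sub_stable_sub [OF tj] stable_sub_iff by auto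
    show "sub_top_transitive G T a (Gs j)"
      using sub_top_transitive_iff [OF trans_sub_stable_sub [OF tj]] trans_sub_trans [OF tj] by simp
  next
    fix j assume j: "j \<in> {1..r}"
    note S = sec [OF j]
    show "Gs (j - 1) \<subseteq> Gs j" by (rule section_subset [OF S])
    then show "Gs (j - 1) \<lhd> G\<lparr>carrier := Gs j\<rparr>"
      using S normal_in_iff_normal stable_sub_subgroup unfolding csection_def by blast
    show "top_transitive (subquot G (Gs j) (Gs (j - 1))) (subquot_top G T (Gs j) (Gs (j - 1))) (induced_aut a)"
      using j by (intro top_transitive_subquot [OF S] trans_sub_trans t) simp
    show "irreducible_pair (subquot G (Gs j) (Gs (j - 1))) (subquot_top G T (Gs j) (Gs (j - 1))) (induced_aut a)"
      using s j by (intro irreducible_of_irred [OF S]) blast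
  qed
qed

section \<open>Indexed series and lists of factors\<close>

abbreviation series_list :: "(nat \<Rightarrow> 'a set) \<Rightarrow> nat \<Rightarrow> ('a set \<times> 'a set) list" where
  "series_list Gs r \<equiv> map (\<lambda>j. (Gs (Suc j), Gs j)) [0..<r]"

text \<open>\<open>cseries\<close> starts at the top term, hence the \<open>rev\<close>, which
  disappears on passing to multisets.\<close>

lemma cseries_of_series:
  assumes "composition_series G T a Gs r" shows "cseries (carrier G) (rev (series_list Gs r))"
proof -
  note s = assms [unfolded composition_series_iff]
  have "cseries (Gs j) (rev (series_list Gs j))" if "j \<le> r" for j
    using that
  proof (induction j)
    case 0
    then show ?case using s cseries_Nil by simp
  next
    case (Suc j)
    have "Suc j \<in> {1..r}" using Suc.prems by simp
    then have "normal_in (Gs (Suc j - 1)) (Gs (Suc j)) \<and> irred (Gs (Suc j)) (Gs (Suc j - 1))" using s by blast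
    then have "normal_in (Gs j) (Gs (Suc j))" "irred (Gs (Suc j)) (Gs j)" by simp_all
    moreover have "trans_sub (Gs (Suc j))" using s Suc.prems by blast
    ultimately have "cseries (Gs (Suc j)) ((Gs (Suc j), Gs j) # rev (series_list Gs j))"
      using Suc by (intro cseries_Cons) auto
    then show ?case by simp
  qed
  from this [of r] show ?thesis using s by simp
qed

lemma series_of_cseries:
  assumes "cseries H l"
  shows "\<exists>Gs. Gs 0 = {\<one>} \<and> Gs (length l) = H \<and> (\<forall>j\<le>length l. trans_sub (Gs j)) \<and>
     (\<forall>j\<in>{1..length l}. normal_in (Gs (j - 1)) (Gs j) \<and> irred (Gs j) (Gs (j - 1)))"
  using assms
proof (induction rule: cseries.induct)
  case cseries_Nil
  then show ?case using trans_sub_one by (intro exI [of _ "\<lambda>_. {\<one>}"]) simp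
next
  case (cseries_Cons K l H)
  then obtain Gs where Gs: "Gs 0 = {\<one>}" "Gs (length l) = K" "\<forall>j\<le>length l. trans_sub (Gs j)"
     "\<forall>j\<in>{1..length l}. normal_in (Gs (j - 1)) (Gs j) \<and> irred (Gs j) (Gs (j - 1))" by blast
  let ?Gs = "Gs(Suc (length l) := H)"
  have "trans_sub (?Gs j)" if "j \<le> Suc (length l)" for j
    using that Gs cseries_Cons by (cases "j = Suc (length l)") auto
  moreover have "normal_in (?Gs (j - 1)) (?Gs j) \<and> irred (?Gs j) (?Gs (j - 1))" if "j \<in> {1..Suc (length l)}" for j
  proof (cases "j = Suc (length l)")
    case True
    then show ?thesis using Gs cseries_Cons by simp
  next
    case False
    then have "j \<in> {1..length l}" "j - 1 \<noteq> Suc (length l)" using that by auto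
    then show ?thesis using Gs(4) False by simp
  qed
  ultimately show ?case using Gs by (intro exI [of _ ?Gs]) auto
qed

lemma composition_series_exists:
  assumes "trans (carrier G)" shows "\<exists>Gs r. composition_series G T a Gs r"
proof -
  have "trans_sub (carrier G)" using assms stable_sub_carrier by (simp add: trans_sub_def)
  then obtain l where "cseries (carrier G) l" using cseries_exists by blast
  from series_of_cseries [OF this] show ?thesis unfolding composition_series_iff by meson
qed

lemma equivalent_series_of_commens_mset:
  assumes Gs: "composition_series G T a Gs r" and Hs: "composition_series G T a Hs s"
    and rel: "commens_mset (mset (series_list Gs r)) (mset (series_list Hs s))"
  shows "equivalent_series G T a Gs r Hs s"
proof -
  let ?xs = "series_list Gs r" and ?ys = "series_list Hs s"
  obtain xs ys where "mset xs = mset ?xs" "mset ys = mset ?ys" "list_all2 commens xs ys"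
    using rel by (auto simp: rel_mset_def)
  \<comment> \<open>Both lists in \<open>rel_mset\<close> may be permuted; restoring the order on
    the left moves the whole permutation to the right.\<close>
  then obtain zs where zs: "list_all2 commens ?xs zs" "mset zs = mset ?ys"
    using list_all2_reorder_left_invariance [of commens xs ys ?xs] by auto
  have rs: "r = s" using list_all2_lengthD [OF zs(1)] mset_eq_length [OF zs(2)] by simp
  obtain p where p: "p permutes {..<length ?ys}" "permute_list p ?ys = zs"
    using mset_eq_permutation [OF zs(2)] by blast
  have pr: "p permutes {..<r}" using p(1) rs by simp
  have co: "commens (Gs (Suc j), Gs j) (Hs (Suc (p j)), Hs (p j))" if j: "j < r" for j
  proof -
    have "p j < r" using permutes_in_image [OF pr, of j] j by simp
    then have "zs ! j = (Hs (Suc (p j)), Hs (p j))"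
      using p j rs permute_list_nth [OF p(1), of j] by auto
    then show ?thesis using list_all2_nthD [OF zs(1), of j] j by simp
  qed
  note G' = Gs [unfolded composition_series_iff] and H' = Hs [unfolded composition_series_iff]
  have secG: "csection (Gs (Suc j)) (Gs j)" if "j < r" for j
  proof -
    have "Suc j \<in> {1..r}" using that by simp
    then have "normal_in (Gs (Suc j - 1)) (Gs (Suc j))" using G' by blast
    then show ?thesis using G' that by (simp add: csection_def trans_sub_stable_sub)
  qed
  have secH: "csection (Hs (Suc j)) (Hs j)" if "j < r" for j
  proof -
    have "Suc j \<in> {1..s}" using that rs by simp
    then have "normal_in (Hs (Suc j - 1)) (Hs (Suc j))" using H' by blast
    then show ?thesis using H' that rs by (simp add: csection_def trans_sub_stable_sub)
  qed
  \<comment> \<open>Factors are numbered from 1 but list positions from 0, so \<open>p\<close> is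
    conjugated by the successor.\<close>
  define \<pi> where "\<pi> j = Suc (p (j - 1))" for j
  have "bij_betw \<pi> {1..r} {1..r}"
  proof -
    have 1: "bij_betw (\<lambda>j. j - 1) {1..r} {..<r}"
      by (rule bij_betw_byWitness [where f' = Suc]) auto
    have 2: "bij_betw p {..<r} {..<r}" by (rule permutes_imp_bij [OF pr])
    have 3: "bij_betw Suc {..<r} {1..r}"
      by (rule bij_betw_byWitness [where f' = "\<lambda>j. j - 1"]) auto
    have "\<pi> = Suc \<circ> (p \<circ> (\<lambda>j. j - 1))" by (auto simp: \<pi>_def)
    then show ?thesis using bij_betw_trans [OF bij_betw_trans [OF 1 2] 3] by simp
  qed
  moreover have "co_commensurable
             (subquot G (Gs j) (Gs (j - 1))) (subquot_top G T (Gs j) (Gs (j - 1))) (induced_aut a)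
             (subquot G (Hs (\<pi> j)) (Hs (\<pi> j - 1))) (subquot_top G T (Hs (\<pi> j)) (Hs (\<pi> j - 1)))
             (induced_aut a)" if j: "j \<in> {1..r}" for j
  proof -
    obtain i where i: "j = Suc i" "i < r" using j by (cases j) auto
    have "p i < r" using permutes_in_image [OF pr, of i] i by simp
    then show ?thesis
      using co_commensurable_of_commens [OF secG [OF i(2)] secH co [OF i(2)]] i by (simp add: \<pi>_def)
  qed
  ultimately show ?thesis unfolding equivalent_series_def using rs by blast
qed

lemma composition_series_equivalent:
  assumes Gs: "composition_series G T a Gs r" and Hs: "composition_series G T a Hs s"
  shows "equivalent_series G T a Gs r Hs s"
  using jordan_hoelder [OF cseries_of_series [OF Gs] cseries_of_series [OF Hs]]
  by (intro equivalent_series_of_commens_mset [OF Gs Hs]) simp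

end

text \<open>Passing from \<open>V\<close> to its normal core only shrinks the intersection. The two
  families in \<open>finite_depth\<close> cover the times of either sign.\<close>

lemma (in compact_group_aut) finite_depth_imp_expansive:
  assumes "finite_depth G T a"
  obtains N where "expansive_group_aut G T a N"
proof -
  obtain V where V: "subgroup V G" "openin T V"
    "(\<Inter>n. (a ^^ n) ` V) \<inter> (\<Inter>n. (aut_inv G a ^^ n) ` V) = {\<one>}"
    using assms by (auto simp: finite_depth_def)
  obtain N where N: "N \<lhd> G" "openin T N" "N \<subseteq> V" using normal_core [OF V(1,2)] by blast
  have "x = \<one>" if x: "x \<in> carrier G" "\<And>k. A k x \<in> N" for x
  proof -
    have "x \<in> (a ^^ n) ` V" for n
    proof -
      have "A (int n) (A (- int n) x) = x" using x by (simp add: apow_add)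
      then have "(a ^^ n) (A (- int n) x) = x" by (simp add: apow_def)
      then show ?thesis using x(2) N(3) by (metis image_eqI subsetD)
    qed
    moreover have "x \<in> (aut_inv G a ^^ n) ` V" for n
    proof -
      have "A (- int n) (A (int n) x) = x" using x by (simp add: apow_add)
      moreover have "A (- int n) y = (aut_inv G a ^^ n) y" for y
        by (cases n) (simp_all add: apow_def nat_add_distrib)
      ultimately have "(aut_inv G a ^^ n) (A (int n) x) = x" by simp
      then show ?thesis using x(2) N(3) by (metis image_eqI subsetD)
    qed
    ultimately show ?thesis using V(3) by blast
  qed
  then have "expansive_group_aut G T a N"
    using N compact_group_aut_axioms
    by (simp add: expansive_group_aut_def expansive_group_aut_axioms_def)
  then show ?thesis by (rule that)
qed

theorem theorem6p20:
  fixes G :: "'a monoid" and T :: "'a topology" and \<alpha> :: "'a \<Rightarrow> 'a"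
  assumes "topgroup G T" and "compact_space T" and "top_aut G T \<alpha>"
    and "top_transitive G T \<alpha>" and "finite_depth G T \<alpha>"
  shows "(\<exists>Gs r. composition_series G T \<alpha> Gs r) \<and>
         (\<forall>Gs r Hs s. composition_series G T \<alpha> Gs r \<and> composition_series G T \<alpha> Hs s
             \<longrightarrow> equivalent_series G T \<alpha> Gs r Hs s)"
proof -
  interpret compact_group_aut G T \<alpha>
    using assms(1-3) by (simp add: compact_group_aut_def compact_group_aut_axioms_def topgroup_def)
  obtain N where "expansive_group_aut G T \<alpha> N"
    using finite_depth_imp_expansive [OF assms(5)] by blast
  then interpret expansive_group_aut G T \<alpha> N .
  have "trans (carrier G)"
    using assms(4) by (simp add: top_transitive_def trans_def orbit_conv_apow)
  then show ?thesis
    using composition_series_exists composition_series_equivalent by blast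
qed

end
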